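(* Let $\alpha\ge0$, $p>1$, $\beta>0$ and $\frac1p+\frac1{p'}=1$. The generalized dual Cesàro operator $\mathcal{C}_\beta^*$ is bounded on $\mathcal{T}_p^{(\alpha)}(t^\alpha)$ with $$\|\mathcal{C}_\beta^*\|=\frac{\Gamma(\beta+1)\Gamma(1/p)}{\Gamma(\beta+1/p)}.$$ The dual operator of $\mathcal{C}_\beta$ on $\mathcal{T}_p^{(\alpha)}(t^\alpha)$ is $\mathcal{C}_\beta^*$ on $\mathcal{T}_{p'}^{(\alpha)}(t^\alpha)$, i.e. $$\langle\mathcal{C}_\beta f,g\rangle_\alpha=\langle f,\mathcal{C}_\beta^*g\rangle_\alpha,\qquad f\in\mathcal{T}_p^{(\alpha)}(t^\alpha),\ g\in\mathcal{T}_{p'}^{(\alpha)}(t^\alpha).$$ Moreover, for $f\in\mathcal{T}_p^{(\alpha)}(t^\alpha)$, $$\mathcal{C}_\beta^*f(t)=\beta\int_{-\infty}^0(e^{-r}-1)^{\beta-1}e^{-r(1-1/p-\beta)}\,T_{r,p}f(t)\,dr,\qquad t\ge0,$$ where $T_{r,p}f(s)=e^{-r/p}f(e^{-r}s)$.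
   Context: $\mathcal{S}_+$ denotes the Schwartz class on $[0,\infty)$. For $\alpha>0$ and $f\in\mathcal{S}_+$, the Weyl fractional integral is $W_+^{-\alpha}f(t)=\frac{1}{\Gamma(\alpha)}\int_t^\infty (s-t)^{\alpha-1}f(s)\,ds$, and the Weyl fractional derivative is $W_+^{\alpha}f(t)=(-1)^n\frac{d^n}{dt^n}W_+^{-(n-\alpha)}f(t)$ with $n=[\alpha]+1$; $W_+^0$ is the identity. For $\alpha>0$ and $1\le p<\infty$, $\mathcal{T}_p^{(\alpha)}(t^\alpha)$ is the completion of $\mathcal{S}_+$ in the norm $\|f\|_{\alpha,p}=\frac{1}{\Gamma(\alpha+1)}\left(\int_0^\infty |W_+^\alpha f(t)|^p t^{\alpha p}\,dt\right)^{1/p}$; $\mathcal{T}_p^{(0)}(t^0)=L^p(\mathbb{R}^+)$. These spaces embed continuously into $L^p(\mathbb{R}^+)$. For $p>1$ the dual of $\mathcal{T}_p^{(\alpha)}(t^\alpha)$ is $\mathcal{T}_{p'}^{(\alpha)}(t^\alpha)$ via $\langle f,g\rangle_\alpha=\frac{1}{\Gamma(\alpha+1)^2}\int_0^\infty W_+^\alpha f(t)W_+^\alpha g(t)\,t^{2\alpha}\,dt$. The generalized Cesàro operator is $\mathcal{C}_\beta f(t)=\frac{\beta}{t^\beta}\int_0^t(t-s)^{\beta-1}f(s)\,ds$ and the generalized dual Cesàro operator is $\mathcal{C}_\beta^*f(t)=\beta\int_t^\infty\frac{(s-t)^{\beta-1}}{s^\beta}f(s)\,ds$, for $t>0$.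
   Formalization: The integral representation of the dual Cesàro operator is stated for t > 0 rather than t ≥ 0: the operator is defined only for t > 0, and at t = 0 the formula fails (e.g. f(t) = t e^{-t} gives β on the left and 0 on the right). *)

theory Defs
  imports "HOL-Analysis.Analysis"
begin

text \<open>Functions are complex-valued functions on the reals; only their values on
  [0,\<infinity>) (resp. (0,\<infinity>)) matter.\<close>

definition schwartz_plus :: "(real \<Rightarrow> complex) set" where
  "schwartz_plus = {f. \<exists>D :: nat \<Rightarrow> real \<Rightarrow> complex.
      (\<forall>t\<ge>0. D 0 t = f t) \<and>
      (\<forall>m. \<forall>t\<ge>0. (D m has_vector_derivative D (Suc m) t) (at t within {0..})) \<and>
      (\<forall>n m. \<exists>C. \<forall>t\<ge>0. (1 + t) ^ n * norm (D m t) \<le> C)}"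

definition vderiv_iter :: "nat \<Rightarrow> (real \<Rightarrow> complex) \<Rightarrow> real \<Rightarrow> complex" where
  "vderiv_iter n f = ((\<lambda>g t. vector_derivative g (at t)) ^^ n) f"

definition weyl_int :: "real \<Rightarrow> (real \<Rightarrow> complex) \<Rightarrow> real \<Rightarrow> complex" where
  "weyl_int \<gamma> f t =
     (LINT s:{t<..}|lborel. complex_of_real ((s - t) powr (\<gamma> - 1)) * f s) / complex_of_real (Gamma \<gamma>)"

definition weyl_deriv :: "real \<Rightarrow> (real \<Rightarrow> complex) \<Rightarrow> real \<Rightarrow> complex" where
  "weyl_deriv \<alpha> f t =
     (if \<alpha> = 0 then f t
      else (let n = nat \<lfloor>\<alpha>\<rfloor> + 1 in (-1) ^ n * vderiv_iter n (weyl_int (real n - \<alpha>) f) t))"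

text \<open>The completion T_p^(\<alpha>)(t^\<alpha>), realised inside L^p(0,\<infinity>) via the continuous
  embedding: f is in the space with (generalised) Weyl derivative F if there is a
  sequence of Schwartz functions \<phi>_k converging to f in L^p(0,\<infinity>) such that
  W^\<alpha> \<phi>_k converges to F in L^p((0,\<infinity>), t^{\<alpha> p} dt).\<close>
definition T_approx :: "real \<Rightarrow> real \<Rightarrow> (real \<Rightarrow> complex) \<Rightarrow> (real \<Rightarrow> complex) \<Rightarrow> bool" where
  "T_approx \<alpha> p f F \<longleftrightarrow>
     f \<in> borel_measurable lborel \<and> F \<in> borel_measurable lborel \<and>
     (\<integral>\<^sup>+ t. indicator {0<..} t * ennreal (norm (F t) powr p * t powr (\<alpha> * p)) \<partial>lborel) < \<infinity> \<and>
     (\<exists>\<phi> :: nat \<Rightarrow> real \<Rightarrow> complex. (\<forall>k. \<phi> k \<in> schwartz_plus) \<and>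
        ((\<lambda>k. \<integral>\<^sup>+ t. indicator {0<..} t * ennreal (norm (\<phi> k t - f t) powr p) \<partial>lborel)
            \<longlonglongrightarrow> 0) \<and>
        ((\<lambda>k. \<integral>\<^sup>+ t. indicator {0<..} t *
               ennreal (norm (weyl_deriv \<alpha> (\<phi> k) t - F t) powr p * t powr (\<alpha> * p)) \<partial>lborel)
            \<longlonglongrightarrow> 0))"

definition T_space :: "real \<Rightarrow> real \<Rightarrow> (real \<Rightarrow> complex) set" where
  "T_space \<alpha> p = {f. \<exists>F. T_approx \<alpha> p f F}"

definition weylD :: "real \<Rightarrow> real \<Rightarrow> (real \<Rightarrow> complex) \<Rightarrow> real \<Rightarrow> complex" where
  "weylD \<alpha> p f = (SOME F. T_approx \<alpha> p f F)"

definition T_norm :: "real \<Rightarrow> real \<Rightarrow> (real \<Rightarrow> complex) \<Rightarrow> real" where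
  "T_norm \<alpha> p f =
     (LINT t:{0<..}|lborel. norm (weylD \<alpha> p f t) powr p * t powr (\<alpha> * p)) powr (1 / p)
       / Gamma (\<alpha> + 1)"

definition T_pair :: "real \<Rightarrow> real \<Rightarrow> real \<Rightarrow> (real \<Rightarrow> complex) \<Rightarrow> (real \<Rightarrow> complex) \<Rightarrow> complex" where
  "T_pair \<alpha> p p' f g =
     (LINT t:{0<..}|lborel. weylD \<alpha> p f t * weylD \<alpha> p' g t * complex_of_real (t powr (2 * \<alpha>)))
       / complex_of_real (Gamma (\<alpha> + 1) ^ 2)"

definition cesaro :: "real \<Rightarrow> (real \<Rightarrow> complex) \<Rightarrow> real \<Rightarrow> complex" where
  "cesaro \<beta> f t = complex_of_real (\<beta> / t powr \<beta>) *
     (LINT s:{0<..<t}|lborel. complex_of_real ((t - s) powr (\<beta> - 1)) * f s)"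

definition cesaro_dual :: "real \<Rightarrow> (real \<Rightarrow> complex) \<Rightarrow> real \<Rightarrow> complex" where
  "cesaro_dual \<beta> f t = complex_of_real \<beta> *
     (LINT s:{t<..}|lborel. complex_of_real ((s - t) powr (\<beta> - 1) / s powr \<beta>) * f s)"

definition T_dil :: "real \<Rightarrow> real \<Rightarrow> (real \<Rightarrow> complex) \<Rightarrow> real \<Rightarrow> complex" where
  "T_dil r p f s = complex_of_real (exp (- r / p)) * f (exp (- r) * s)"

end

theory Submission
  imports Defs "HOL-Computational_Algebra.Polynomial"
begin

text \<open>
  On \<open>L\<^sup>p(0,\<infinity>)\<close> both Cesaro operators are multiplicative convolutions
  \<open>h \<mapsto> (\<lambda>t. \<integral> \<kappa> u * h (t * u) du)\<close>; these commute with each other and, by Jensen's inequality,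
  have norm at most \<open>\<integral> \<kappa> u * u powr (- 1 / p) du\<close>, which is a Beta integral.
  The Weyl integral is itself of this kind: \<open>W\<^sup>-\<^sup>\<alpha> F\<close> is
  \<open>1 / \<Gamma>(\<alpha> + 1)\<close> times the dual Cesaro operator of order \<open>\<alpha>\<close> applied to \<open>t\<^sup>\<alpha> F\<close>. Hence
  \<open>h \<mapsto> W\<^sup>-\<^sup>\<alpha> (t\<^sup>-\<^sup>\<alpha> h)\<close> intertwines the Cesaro operators on \<open>L\<^sup>p\<close> and on the space
  of order \<open>\<alpha>\<close>, and it is a multiple of an isometry onto: its range is the whole completion because
  sums of exponentials \<open>exp (- j t)\<close> are dense and \<open>W\<^sup>\<alpha>\<close> acts on them diagonally, and it is injective
  because the functions \<open>t\<^sup>-\<^sup>1 exp (- j / t)\<close> lie in the range of the adjoint and are total.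
  All assertions thus reduce to \<open>\<alpha> = 0\<close>, where duality is Fubini's theorem and the truncated powers
  \<open>t powr (- a)\<close> on \<open>{1<..}\<close>, with \<open>a\<close> decreasing to \<open>1 / p\<close>, show that the constant is sharp.
\<close>

section \<open>Lebesgue measure on the half-line\<close>

text \<open>Working on the dense class is not an option: the operators do not preserve it. For
  Schwartz f the function C_1^* f has a logarithmic singularity at 0 unless f(0) = 0. Moreover the
  space is given by approximation and \<open>weylD\<close> by choice, so neither norm nor pairing
  can be evaluated from the definitions. \<open>T_approx_iff\<close> removes the first difficulty: a
  pair (f, F) is admissible exactly when h = t^\<alpha> F lies in L^p and f is the potential of h
  almost everywhere. Injectivity removes the second: it determines the chosen derivative up to null
  sets. The constant does not depend on \<alpha> because the operators act on h as they act on L^p.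
  It is the eigenvalue of the dual operator at the power t^(-1/p), which just fails to lie in L^p;
  hence the truncated powers with slightly larger exponent. They are prescribed as h, so the
  corresponding potentials never have to be computed.\<close>

definition half_line :: "real measure" where
  "half_line = density lborel (indicator {0<..})"

lemma sets_half_line [measurable_cong, simp]: "sets half_line = sets borel"
  by (simp add: half_line_def)

lemma space_half_line [simp]: "space half_line = UNIV"
  by (simp add: half_line_def)

lemma measurable_half_line1 [simp]: "measurable half_line N = measurable borel N"
  by (rule measurable_cong_sets) auto

lemma AE_half_line: "(AE t in half_line. P t) \<longleftrightarrow> (AE t in lborel. 0 < t \<longrightarrow> P t)"
  unfolding half_line_def by (subst AE_density) (auto simp: indicator_def)

lemma AE_half_lineI: "(\<And>t. 0 < t \<Longrightarrow> P t) \<Longrightarrow> AE t in half_line. P t"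
  by (simp add: AE_half_line)

lemma half_line_eq_real_indicator: "half_line = density lborel (\<lambda>x. ennreal (indicator {0<..} x))"
  by (simp add: half_line_def ennreal_indicator)

interpretation half_line: sigma_finite_measure half_line
  unfolding half_line_eq_real_indicator
  by (subst sigma_finite_measure.sigma_finite_iff_density_finite[OF sigma_finite_lborel]) auto

lemma nn_integral_half_line:
  assumes "f \<in> borel_measurable borel"
  shows "(\<integral>\<^sup>+t. f t \<partial>half_line) = (\<integral>\<^sup>+t. indicator {0<..} t * f t \<partial>lborel)"
  unfolding half_line_def using assms by (subst nn_integral_density) auto

lemma nn_integral_half_line_cong:
  "(\<And>t. 0 < t \<Longrightarrow> f t = g t) \<Longrightarrow> (\<integral>\<^sup>+t. f t \<partial>half_line) = (\<integral>\<^sup>+t. g t \<partial>half_line)"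
  by (intro nn_integral_cong_AE AE_half_lineI)

lemma integrable_half_line_iff:
  fixes f :: "real \<Rightarrow> 'a::{banach, second_countable_topology}"
  assumes "f \<in> borel_measurable borel"
  shows "integrable half_line f \<longleftrightarrow> set_integrable lborel {0<..} f"
  unfolding half_line_eq_real_indicator set_integrable_def using assms
  by (subst integrable_density) auto

lemma integral_half_line:
  fixes f :: "real \<Rightarrow> 'a::{banach, second_countable_topology}"
  assumes "f \<in> borel_measurable borel"
  shows "(LINT t|half_line. f t) = (LINT t:{0<..}|lborel. f t)"
  unfolding half_line_eq_real_indicator set_lebesgue_integral_def using assms
  by (subst integral_density) auto

lemma integral_half_line_cong:
  fixes f :: "real \<Rightarrow> 'a::{banach, second_countable_topology}"
  assumes "\<And>t. 0 < t \<Longrightarrow> f t = g t" "f \<in> borel_measurable borel" "g \<in> borel_measurable borel"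
  shows "(LINT t|half_line. f t) = (LINT t|half_line. g t)"
  using assms by (intro integral_cong_AE AE_half_lineI) auto

text \<open>Stated as an identity of measures, so that the substitution rules for nonnegative
  integrals, Bochner integrals, integrability and null sets all follow from it.\<close>

lemma half_line_dilate:
  assumes "0 < c"
  shows "half_line = density (distr half_line borel (\<lambda>x. c * x)) (\<lambda>_. ennreal c)"
proof -
  have [simp]: "0 < x / c \<longleftrightarrow> 0 < x" for x
    using assms by (simp add: zero_less_divide_iff)
  have "density (distr half_line borel (\<lambda>x. c * x)) (\<lambda>_. ennreal c) =
      density (distr (density lborel (\<lambda>x. indicator {0<..} (c * x))) borel (\<lambda>x. c * x)) (\<lambda>_. ennreal c)"
  proof -
    have "indicator {0<..} (c * x) = (indicator {0<..} x :: ennreal)" for x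
      using assms by (simp add: indicator_def zero_less_mult_iff)
    then show ?thesis by (simp add: half_line_def)
  qed
  also have "distr (density lborel (\<lambda>x. indicator {0<..} (c * x))) borel (\<lambda>x. c * x) =
      density (distr lborel borel (\<lambda>x. c * x)) (indicator {0<..})"
    by (subst density_distr) auto
  also have "density \<dots> (\<lambda>_. ennreal c) =
      density (density (distr lborel borel (\<lambda>x. c * x)) (\<lambda>_. ennreal c)) (indicator {0<..})"
    by (subst (1 2) density_density_eq) (auto simp: mult.commute)
  also have "density (distr lborel borel (\<lambda>x. c * x)) (\<lambda>_. ennreal c) = lborel"
    using lborel_real_affine[of c 0] assms by simp
  finally show ?thesis
    by (simp add: half_line_def)
qed

lemma nn_integral_half_line_dilate:
  fixes c :: real
  assumes [measurable]: "f \<in> borel_measurable borel" and "0 < c"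
  shows "(\<integral>\<^sup>+x. f x \<partial>half_line) = ennreal c * (\<integral>\<^sup>+x. f (c * x) \<partial>half_line)"
  by (subst half_line_dilate[OF \<open>0 < c\<close>])
    (simp add: nn_integral_density nn_integral_distr nn_integral_cmult)

lemma integral_half_line_dilate:
  fixes f :: "real \<Rightarrow> 'a::{banach, second_countable_topology}"
  assumes [measurable]: "f \<in> borel_measurable borel" and "0 < c"
  shows "(LINT x|half_line. f x) = c *\<^sub>R (LINT x|half_line. f (c * x))"
  using \<open>0 < c\<close>
  by (subst half_line_dilate[OF \<open>0 < c\<close>]) (simp add: integral_density integral_distr)

lemma integrable_half_line_dilate_iff:
  fixes f :: "real \<Rightarrow> 'a::{banach, second_countable_topology}"
  assumes [measurable]: "f \<in> borel_measurable borel" and "0 < c"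
  shows "integrable half_line (\<lambda>x. f (c * x)) \<longleftrightarrow> integrable half_line f"
  using \<open>0 < c\<close> nn_integral_half_line_dilate[of "\<lambda>x. ennreal (norm (f x))" c]
  by (auto simp: integrable_iff_bounded ennreal_mult_less_top)

text \<open>Dilations preserve null sets. A multiplicative convolution evaluates its argument at t *
  u with t fixed, so this is what lets it depend only on the almost-everywhere class of the
  argument.\<close>

lemma AE_half_line_dilate:
  assumes "AE x in half_line. P x" and "0 < c"
  shows "AE x in half_line. P (c * x)"
proof -
  \<comment> \<open>\<open>P\<close> need not be measurable, so the argument runs through a Borel
    null set containing its exceptional set.\<close>
  obtain N where N: "{x. \<not> P x} \<subseteq> N" "emeasure half_line N = 0" "N \<in> sets half_line"
    using assms(1) by (auto elim: AE_E)
  from N(3) have [measurable]: "N \<in> sets borel" by simp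
  have "AE x in half_line. x \<notin> N"
    using N by (intro AE_not_in) (auto simp: null_sets_def)
  then have "AE x in density (distr half_line borel (\<lambda>x. c * x)) (\<lambda>_. ennreal c). x \<notin> N"
    by (subst half_line_dilate[OF assms(2), symmetric])
  then have "AE x in half_line. c * x \<notin> N"
    using assms(2) by (simp add: AE_density AE_distr_iff)
  then show ?thesis
    by eventually_elim (use N(1) in auto)
qed

text \<open>The substitution x = exp r as an identity of measures, checked on the intervals (a, b]
  by the fundamental theorem of calculus. It turns dilations into translations and inversion into
  reflection.\<close>

lemma half_line_exp: "half_line = distr (density lborel (\<lambda>r. ennreal (exp r))) borel exp"
proof (rule measure_eqI_generator_eq)
  let ?N = "distr (density lborel (\<lambda>r. ennreal (exp r))) borel exp"
  let ?E = "range (\<lambda>(a, b). {a<..b::real})"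
  show "Int_stable ?E"
  proof (rule Int_stableI)
    fix A B assume "A \<in> ?E" "B \<in> ?E"
    then obtain a b c d where "A = {a<..b}" "B = {c<..d}" by auto
    then have "A \<inter> B = (case (max a c, min b d) of (x, y) \<Rightarrow> {x<..y})" by auto
    then show "A \<inter> B \<in> ?E" by blast
  qed
  show "?E \<subseteq> Pow UNIV" by simp
  show "sets half_line = sigma_sets UNIV ?E" "sets ?N = sigma_sets UNIV ?E"
    by (simp_all add: borel_sigma_sets_Ioc)
  show "range (\<lambda>i::nat. {- real i<..real i}) \<subseteq> ?E" by auto
  show "(\<Union>i::nat. {- real i<..real i}) = UNIV"
  proof -
    have "\<exists>i. x \<in> {- real i<..real i}" for x
    proof -
      obtain i where "\<bar>x\<bar> < real i" using reals_Archimedean2 by blast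
      then have "x \<in> {- real i<..real i}" by auto
      then show ?thesis ..
    qed
    then show ?thesis by blast
  qed
  have half: "emeasure half_line {a<..b} = emeasure lborel ({0<..} \<inter> {a<..b})" for a b
  proof -
    have "emeasure half_line {a<..b} = (\<integral>\<^sup>+x. indicator {0<..} x * indicator {a<..b} x \<partial>lborel)"
      by (simp add: half_line_def emeasure_density)
    also have "\<dots> = (\<integral>\<^sup>+x. indicator ({0<..} \<inter> {a<..b}) x \<partial>lborel)"
      by (simp only: indicator_inter_arith)
    finally show ?thesis by simp
  qed
  show "emeasure half_line {- real i<..real i} \<noteq> \<infinity>" for i
  proof -
    have "emeasure lborel ({0<..} \<inter> {- real i<..real i}) \<le> emeasure lborel {- real i<..real i}"
      by (intro emeasure_mono) auto
    also have "\<dots> < \<infinity>" by simp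
    finally show ?thesis by (simp add: half)
  qed
  fix X assume "X \<in> ?E"
  then obtain a b where X: "X = {a<..b}" by auto
  \<comment> \<open>Both measures live on the positive reals, so the left endpoint may be raised to
    0.\<close>
  define a' where "a' = max a 0"
  have *: "{0<..} \<inter> {a<..b} = {a'<..b}" by (auto simp: a'_def)
  have "emeasure ?N X = (\<integral>\<^sup>+r. ennreal (exp r) * indicator {a<..b} (exp r) \<partial>lborel)"
  proof -
    have "(exp -` {a<..b} :: real set) \<in> sets borel"
      using measurable_sets[of exp borel borel "{a<..b}"] by simp
    then show ?thesis
      unfolding X by (subst emeasure_distr) (auto simp: emeasure_density indicator_def intro!: nn_integral_cong)
  qed
  also have "\<dots> = (\<integral>\<^sup>+r. ennreal (exp r) * indicator {a'<..b} (exp r) \<partial>lborel)"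
    by (intro nn_integral_cong) (auto simp: a'_def indicator_def)
  also have "\<dots> = emeasure lborel {a'<..b}"
  proof (cases "a' < b")
    case False then show ?thesis by simp
  next
    case True
    have b: "0 < b" using True by (auto simp: a'_def)
    show ?thesis
    \<comment> \<open>For left endpoint 0 the preimage under exp is unbounded below; a reflection
      brings it into the form of the half-line version of the fundamental theorem. Otherwise the
      preimage is a bounded interval.\<close>
    proof (cases "a' = 0")
      case True
      have "(\<integral>\<^sup>+r. ennreal (exp r) * indicator {a'<..b} (exp r) \<partial>lborel) =
          (\<integral>\<^sup>+r. ennreal (exp (- r)) * indicator {a'<..b} (exp (- r)) \<partial>lborel)"
        using nn_integral_real_affine[of "\<lambda>r. ennreal (exp r) * indicator {a'<..b} (exp r)" "-1" 0] by simp
      also have "\<dots> = (\<integral>\<^sup>+r. ennreal (exp (- r)) * indicator {- ln b..} r \<partial>lborel)"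
      proof (intro nn_integral_cong)
        fix r
        have "exp (- r) \<le> b \<longleftrightarrow> - ln b \<le> r"
          using b by (metis exp_le_cancel_iff exp_ln minus_le_iff)
        then show "ennreal (exp (- r)) * indicator {a'<..b} (exp (- r)) = ennreal (exp (- r)) * indicator {- ln b..} r"
          using True by (auto simp: indicator_def)
      qed
      also have "\<dots> = ennreal (0 - - exp (- (- ln b)))"
      proof (rule nn_integral_FTC_atLeast)
        show "((\<lambda>a::real. - exp (- a)) \<longlongrightarrow> 0) at_top"
          using tendsto_minus[OF filterlim_compose[OF exp_at_bot filterlim_uminus_at_bot_at_top]] by simp
      qed (auto intro!: derivative_eq_intros)
      finally show ?thesis using b True by simp
    next
      case False
      then have a: "0 < a'" by (auto simp: a'_def max_def split: if_splits)
      have "(\<integral>\<^sup>+r. ennreal (exp r) * indicator {a'<..b} (exp r) \<partial>lborel) =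
          (\<integral>\<^sup>+r. ennreal (exp r) * indicator {ln a'..ln b} r \<partial>lborel)"
      proof (intro nn_integral_cong_AE, use AE_lborel_singleton[of "ln a'"] in eventually_elim)
        case (elim r)
        have "a' < exp r \<longleftrightarrow> ln a' < r" "exp r \<le> b \<longleftrightarrow> r \<le> ln b"
          using a b by (metis exp_less_cancel_iff exp_ln, metis exp_le_cancel_iff exp_ln)
        then show ?case using elim by (auto simp: indicator_def)
      qed
      also have "\<dots> = ennreal (exp (ln b) - exp (ln a'))"
        using \<open>a' < b\<close> a by (intro nn_integral_FTC_Icc) (auto intro!: derivative_eq_intros)
      finally show ?thesis using a b \<open>a' < b\<close> by simp
    qed
  qed
  finally show "emeasure half_line X = emeasure ?N X"
    unfolding X half * ..
qed

lemma nn_integral_half_line_exp: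
  assumes [measurable]: "f \<in> borel_measurable borel"
  shows "(\<integral>\<^sup>+x. f x \<partial>half_line) = (\<integral>\<^sup>+r. ennreal (exp r) * f (exp r) \<partial>lborel)"
  by (subst half_line_exp) (simp add: nn_integral_distr nn_integral_density)

lemma integral_half_line_exp:
  fixes f :: "real \<Rightarrow> 'a::{banach, second_countable_topology}"
  assumes [measurable]: "f \<in> borel_measurable borel"
  shows "(LINT x|half_line. f x) = (LINT r|lborel. exp r *\<^sub>R f (exp r))"
  by (subst half_line_exp) (simp add: integral_distr integral_density)

text \<open>In the variable r = ln x the inversion is r \<mapsto> -r, for which Lebesgue measure is
  invariant; the weight comes from exp (-r) = exp r / (exp r)^2.\<close>

lemma nn_integral_half_line_inverse:
  assumes [measurable]: "f \<in> borel_measurable borel"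
  shows "(\<integral>\<^sup>+x. f x \<partial>half_line) = (\<integral>\<^sup>+x. ennreal (1 / x\<^sup>2) * f (1 / x) \<partial>half_line)"
proof -
  have "(\<integral>\<^sup>+x. f x \<partial>half_line) = (\<integral>\<^sup>+r. ennreal (exp r) * f (exp r) \<partial>lborel)"
    by (rule nn_integral_half_line_exp) simp
  also have "\<dots> = (\<integral>\<^sup>+r. ennreal (exp (- r)) * f (exp (- r)) \<partial>lborel)"
    using nn_integral_real_affine[of "\<lambda>r. ennreal (exp r) * f (exp r)" "-1" 0] by simp
  also have "\<dots> = (\<integral>\<^sup>+r. ennreal (exp r) * (ennreal (1 / (exp r)\<^sup>2) * f (1 / exp r)) \<partial>lborel)"
    by (intro nn_integral_cong)
      (simp add: mult.assoc[symmetric] ennreal_mult[symmetric] exp_minus field_simps power2_eq_square)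
  also have "\<dots> = (\<integral>\<^sup>+x. ennreal (1 / x\<^sup>2) * f (1 / x) \<partial>half_line)"
    by (rule nn_integral_half_line_exp[symmetric]) simp
  finally show ?thesis .
qed

section \<open>Multiplicative convolution on $L^p$\<close>

definition in_Lp :: "real \<Rightarrow> (real \<Rightarrow> complex) \<Rightarrow> bool" where
  "in_Lp p h \<longleftrightarrow> h \<in> borel_measurable borel \<and> (\<integral>\<^sup>+t. ennreal (norm (h t) powr p) \<partial>half_line) < \<infinity>"

lemma in_Lp_integrable: "in_Lp p h \<Longrightarrow> integrable half_line (\<lambda>t. norm (h t) powr p)"
  by (auto simp: in_Lp_def integrable_iff_bounded)

lemma in_Lp_norm: "in_Lp p h \<Longrightarrow> in_Lp p (\<lambda>t. complex_of_real (norm (h t)))"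
  by (auto simp: in_Lp_def)

text \<open>A crude substitute for Minkowski's inequality. The constant 2^p is harmless wherever
  only finiteness or convergence to 0 is at stake; the sharp constant is obtained elsewhere.\<close>

lemma powr_add_le:
  fixes x y p :: real
  assumes "0 \<le> x" "0 \<le> y" "0 \<le> p"
  shows "(x + y) powr p \<le> 2 powr p * (x powr p + y powr p)"
proof -
  have "(x + y) powr p \<le> (2 * max x y) powr p"
    using assms by (intro powr_mono2) auto
  also have "\<dots> = 2 powr p * max x y powr p"
    using assms by (simp add: powr_mult)
  also have "\<dots> \<le> 2 powr p * (x powr p + y powr p)"
    by (intro mult_left_mono) (auto simp: max_def)
  finally show ?thesis .
qed

lemma nn_integral_powr_add_le:
  fixes f g :: "'a \<Rightarrow> complex"
  assumes [measurable]: "f \<in> borel_measurable M" "g \<in> borel_measurable M" and "0 \<le> p"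
  shows "(\<integral>\<^sup>+t. ennreal (norm (f t + g t) powr p) \<partial>M) \<le>
    ennreal (2 powr p) * ((\<integral>\<^sup>+t. ennreal (norm (f t) powr p) \<partial>M) + (\<integral>\<^sup>+t. ennreal (norm (g t) powr p) \<partial>M))"
proof -
  have "(\<integral>\<^sup>+t. ennreal (norm (f t + g t) powr p) \<partial>M) \<le>
      (\<integral>\<^sup>+t. ennreal (2 powr p) * (ennreal (norm (f t) powr p) + ennreal (norm (g t) powr p)) \<partial>M)"
  proof (intro nn_integral_mono)
    fix t
    have "norm (f t + g t) powr p \<le> (norm (f t) + norm (g t)) powr p"
      using assms by (intro powr_mono2 norm_triangle_ineq) auto
    also have "\<dots> \<le> 2 powr p * (norm (f t) powr p + norm (g t) powr p)"
      using assms by (intro powr_add_le) auto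
    finally show "ennreal (norm (f t + g t) powr p) \<le>
        ennreal (2 powr p) * (ennreal (norm (f t) powr p) + ennreal (norm (g t) powr p))"
      by (simp add: ennreal_plus[symmetric] ennreal_mult[symmetric] del: ennreal_plus)
  qed
  also have "\<dots> = ennreal (2 powr p) *
      ((\<integral>\<^sup>+t. ennreal (norm (f t) powr p) \<partial>M) + (\<integral>\<^sup>+t. ennreal (norm (g t) powr p) \<partial>M))"
    by (simp add: nn_integral_cmult nn_integral_add)
  finally show ?thesis .
qed

lemma in_Lp_diff:
  assumes "in_Lp p f" "in_Lp p g" "0 \<le> p"
  shows "in_Lp p (\<lambda>t. f t - g t)"
proof -
  have [measurable]: "f \<in> borel_measurable borel" "g \<in> borel_measurable borel"
    using assms by (auto simp: in_Lp_def)
  have "(\<integral>\<^sup>+t. ennreal (norm (f t + - g t) powr p) \<partial>half_line) \<le>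
    ennreal (2 powr p) * ((\<integral>\<^sup>+t. ennreal (norm (f t) powr p) \<partial>half_line) + (\<integral>\<^sup>+t. ennreal (norm (- g t) powr p) \<partial>half_line))"
    using assms by (intro nn_integral_powr_add_le) auto
  also have "\<dots> < \<infinity>"
    using assms by (auto simp: in_Lp_def ennreal_mult_less_top)
  finally show ?thesis by (simp add: in_Lp_def)
qed

text \<open>The graph of x^p lies above its tangent at a. This is Young's inequality for x and
  a^(p-1), whose conjugate power is again a^p.\<close>

lemma powr_tangent_le:
  fixes a x p :: real
  assumes "1 < p" "0 \<le> a" "0 \<le> x"
  shows "a powr p + p * a powr (p - 1) * (x - a) \<le> x powr p"
proof -
  define q where "q = p / (p - 1)"
  have q: "1 < q" "1 / p + 1 / q = 1" "(p - 1) * q = p" "p / q = p - 1"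
    using assms by (auto simp: q_def field_simps)
  have "x * a powr (p - 1) \<le> x powr p / p + (a powr (p - 1)) powr q / q"
    using assms q by (intro Youngs_inequality) auto
  then have "p * (x * a powr (p - 1)) \<le> p * (x powr p / p + a powr p / q)"
    using assms q by (intro mult_left_mono) (auto simp: powr_powr)
  also have "\<dots> = x powr p + (p / q) * a powr p"
    using assms by (simp add: field_simps)
  finally have "p * (x * a powr (p - 1)) \<le> x powr p + (p - 1) * a powr p"
    by (simp add: q)
  moreover have "a * a powr (p - 1) = a powr p"
    using assms by (cases "a = 0") (auto simp: powr_diff)
  ultimately show ?thesis by (simp add: algebra_simps)
qed

text \<open>Jensen's inequality for an unnormalised weight: the power (p - 1) of the total mass is
  the price of not dividing by it. The proof integrates the tangent inequality against w.\<close>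

lemma integral_powr_le:
  fixes w g :: "'a \<Rightarrow> real"
  assumes "1 < p" and [measurable]: "w \<in> borel_measurable M" "g \<in> borel_measurable M"
    and nn: "\<And>x. 0 \<le> w x" "\<And>x. 0 \<le> g x" and w: "integrable M w"
    and fin: "(\<integral>\<^sup>+x. ennreal (w x * g x powr p) \<partial>M) < \<infinity>"
  shows "integrable M (\<lambda>x. w x * g x)"
    and "ennreal ((LINT x|M. w x * g x) powr p) \<le>
      ennreal ((LINT x|M. w x) powr (p - 1)) * (\<integral>\<^sup>+x. ennreal (w x * g x powr p) \<partial>M)"
proof -
  have wgp: "integrable M (\<lambda>x. w x * g x powr p)"
    using fin nn by (simp add: integrable_iff_bounded)
  \<comment> \<open>Integrability of w * g comes from that of w and w * g^p through this elementary
    comparison.\<close>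
  have "x \<le> 1 + x powr p" if "0 \<le> x" for x :: real
  proof (cases "x \<le> 1")
    case True then show ?thesis by (simp add: add_increasing2)
  next
    case False then show ?thesis using powr_mono[of 1 p x] assms(1) by simp
  qed
  then have bnd: "w x * g x \<le> w x + w x * g x powr p" for x
    using mult_left_mono[OF _ nn(1), of "g x" "1 + g x powr p" x] nn(2)[of x] by (simp add: algebra_simps)
  show wg: "integrable M (\<lambda>x. w x * g x)"
    by (rule Bochner_Integration.integrable_bound[OF Bochner_Integration.integrable_add[OF w wgp]])
      (use bnd nn in auto)
  define W where "W = (LINT x|M. w x)"
  define I where "I = (LINT x|M. w x * g x)"
  have nnWI: "0 \<le> W" "0 \<le> I"
    unfolding W_def I_def using nn by (auto intro!: Bochner_Integration.integral_nonneg)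
  have eq: "(\<integral>\<^sup>+x. ennreal (w x * g x powr p) \<partial>M) = ennreal (LINT x|M. w x * g x powr p)"
    using wgp nn by (intro nn_integral_eq_integral) auto
  have "I powr p \<le> W powr (p - 1) * (LINT x|M. w x * g x powr p)"
  proof (cases "W = 0")
    case True
    then have "AE x in M. w x = 0"
      using integral_nonneg_eq_0_iff_AE[OF w] nn by (auto simp: W_def)
    then have "I = (LINT x|M. 0)"
      unfolding I_def by (intro integral_cong_AE) auto
    then show ?thesis using nn by (auto intro!: mult_nonneg_nonneg Bochner_Integration.integral_nonneg)
  next
    case False
    \<comment> \<open>The w-mean of g. With the tangent taken at this point the linear term
      integrates to zero.\<close>
    define a where "a = I / W"
    have W: "0 < W" and a: "0 \<le> a" using False nnWI by (auto simp: a_def)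
    have "(LINT x|M. w x * a powr p + p * a powr (p - 1) * (w x * g x - a * w x)) \<le> (LINT x|M. w x * g x powr p)"
    proof (intro integral_mono)
      show "integrable M (\<lambda>x. w x * a powr p + p * a powr (p - 1) * (w x * g x - a * w x))"
        using w wg by auto
      show "w x * a powr p + p * a powr (p - 1) * (w x * g x - a * w x) \<le> w x * g x powr p" for x
        using mult_left_mono[OF powr_tangent_le[OF assms(1) a nn(2)[of x]] nn(1)[of x]]
        by (simp add: algebra_simps)
    qed (rule wgp)
    also have "(LINT x|M. w x * a powr p + p * a powr (p - 1) * (w x * g x - a * w x)) =
        W * a powr p + p * a powr (p - 1) * (I - a * W)"
      using w wg by (simp add: W_def I_def)
    also have "\<dots> = W * a powr p" using W by (simp add: a_def)
    finally have "W powr (p - 1) * (W * a powr p) \<le> W powr (p - 1) * (LINT x|M. w x * g x powr p)"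
      by (intro mult_left_mono) auto
    moreover have "W powr (p - 1) * (W * a powr p) = I powr p"
      using W nnWI by (simp add: a_def powr_divide powr_diff)
    ultimately show ?thesis by simp
  qed
  then show "ennreal ((LINT x|M. w x * g x) powr p) \<le>
      ennreal ((LINT x|M. w x) powr (p - 1)) * (\<integral>\<^sup>+x. ennreal (w x * g x powr p) \<partial>M)"
    using nn by (simp add: eq W_def I_def ennreal_mult[symmetric])
qed

definition mult_conv :: "(real \<Rightarrow> real) \<Rightarrow> (real \<Rightarrow> complex) \<Rightarrow> real \<Rightarrow> complex" where
  "mult_conv \<kappa> h t = (LINT u|half_line. complex_of_real (\<kappa> u) * h (t * u))"

definition Lp_kernel :: "real \<Rightarrow> (real \<Rightarrow> real) \<Rightarrow> bool" where
  "Lp_kernel p \<kappa> \<longleftrightarrow> \<kappa> \<in> borel_measurable borel \<and> (\<forall>u. 0 \<le> \<kappa> u) \<and>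
     integrable half_line (\<lambda>u. \<kappa> u * u powr (- 1 / p))"

text \<open>Replacing h(t) by h(t * u) multiplies the L^p norm by u^(-1/p). Averaging these dilates
  against \<kappa> therefore costs at most this integral, which is the candidate operator
  norm.\<close>

definition kernel_mass :: "real \<Rightarrow> (real \<Rightarrow> real) \<Rightarrow> real" where
  "kernel_mass p \<kappa> = (LINT u|half_line. \<kappa> u * u powr (- 1 / p))"

lemma mult_conv_measurable [measurable]:
  assumes [measurable]: "\<kappa> \<in> borel_measurable borel" "h \<in> borel_measurable borel"
  shows "mult_conv \<kappa> h \<in> borel_measurable borel"
  unfolding mult_conv_def[abs_def] by measurable

text \<open>Jensen's inequality for the weight \<open>\<kappa> u * u powr (- 1 / p)\<close>, applied to the
  \<open>L\<^sup>p\<close>-isometric dilations \<open>u powr (1 / p) * h (t * u)\<close>, gives the sharp constant.\<close>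
lemma
  assumes p: "1 < p" and h: "in_Lp p h" and \<kappa>: "Lp_kernel p \<kappa>"
  shows mult_conv_AE_integrable:
      "AE t in half_line. integrable half_line (\<lambda>u. complex_of_real (\<kappa> u) * h (t * u))"
    and mult_conv_bound: "(\<integral>\<^sup>+t. ennreal (norm (mult_conv \<kappa> h t) powr p) \<partial>half_line) \<le>
      ennreal (kernel_mass p \<kappa> powr p) * (\<integral>\<^sup>+t. ennreal (norm (h t) powr p) \<partial>half_line)"
proof -
  have [measurable]: "h \<in> borel_measurable borel" "\<kappa> \<in> borel_measurable borel"
    using h \<kappa> by (auto simp: in_Lp_def Lp_kernel_def)
  define w where "w u = \<kappa> u * u powr (- 1 / p)" for u
  define g where "g t u = u powr (1 / p) * norm (h (t * u))" for t u
  have [measurable]: "w \<in> borel_measurable borel" "(\<lambda>x. g (fst x) (snd x)) \<in> borel_measurable (borel \<Otimes>\<^sub>M borel)"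
    "\<And>t. g t \<in> borel_measurable borel"
    by (simp_all add: w_def[abs_def] g_def[abs_def])
  define J where "J t = (\<integral>\<^sup>+u. ennreal (w u * g t u powr p) \<partial>half_line)" for t
  let ?N = "\<integral>\<^sup>+t. ennreal (norm (h t) powr p) \<partial>half_line"
  have w: "0 \<le> w u" "integrable half_line w" for u
    using \<kappa> by (auto simp: w_def[abs_def] Lp_kernel_def)
  have W: "(LINT u|half_line. w u) = kernel_mass p \<kappa>" "0 \<le> kernel_mass p \<kappa>"
    using w by (auto simp: w_def kernel_mass_def intro!: Bochner_Integration.integral_nonneg)
  have [measurable]: "J \<in> borel_measurable borel"
    unfolding J_def g_def w_def by measurable
  interpret pair_sigma_finite half_line half_line ..
  have "(\<integral>\<^sup>+t. J t \<partial>half_line) = (\<integral>\<^sup>+u. \<integral>\<^sup>+t. ennreal (w u * g t u powr p) \<partial>half_line \<partial>half_line)"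
    unfolding J_def using Fubini'[of "\<lambda>t u. ennreal (w u * g t u powr p)"] by (simp add: g_def w_def)
  also have "\<dots> = (\<integral>\<^sup>+u. ennreal (w u) * ?N \<partial>half_line)"
  \<comment> \<open>The p-th power of u^(1/p) is exactly the Jacobian of the dilation by u, so the
    inner integral does not depend on u beyond the factor \<open>w u\<close>.\<close>
  proof (intro nn_integral_half_line_cong)
    fix u :: real assume u: "0 < u"
    have "(\<integral>\<^sup>+t. ennreal (w u * g t u powr p) \<partial>half_line) =
        (\<integral>\<^sup>+t. ennreal (w u) * (ennreal u * ennreal (norm (h (u * t)) powr p)) \<partial>half_line)"
      using u p w by (intro nn_integral_half_line_cong)
        (simp add: g_def powr_mult powr_powr ennreal_mult mult.commute)
    also have "\<dots> = ennreal (w u) * (ennreal u * (\<integral>\<^sup>+t. ennreal (norm (h (u * t)) powr p) \<partial>half_line))"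
      by (simp add: nn_integral_cmult)
    also have "ennreal u * (\<integral>\<^sup>+t. ennreal (norm (h (u * t)) powr p) \<partial>half_line) = ?N"
      using nn_integral_half_line_dilate[of "\<lambda>t. ennreal (norm (h t) powr p)" u] u by simp
    finally show "(\<integral>\<^sup>+t. ennreal (w u * g t u powr p) \<partial>half_line) = ennreal (w u) * ?N" .
  qed
  also have "\<dots> = ennreal (kernel_mass p \<kappa>) * ?N"
    using w W nn_integral_eq_integral[of half_line w] by (simp add: nn_integral_multc)
  finally have JN: "(\<integral>\<^sup>+t. J t \<partial>half_line) = ennreal (kernel_mass p \<kappa>) * ?N" .
  have "(\<integral>\<^sup>+t. J t \<partial>half_line) \<noteq> \<infinity>"
    using h by (auto simp: JN in_Lp_def ennreal_mult_eq_top_iff)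
  then have "AE t in half_line. J t \<noteq> \<infinity>"
    by (intro nn_integral_PInf_AE) auto
  then have AEJ: "AE t in half_line. integrable half_line (\<lambda>u. w u * g t u) \<and>
      ennreal ((LINT u|half_line. w u * g t u) powr p) \<le> ennreal (kernel_mass p \<kappa> powr (p - 1)) * J t"
  proof eventually_elim
    case (elim t)
    have fin: "(\<integral>\<^sup>+u. ennreal (w u * g t u powr p) \<partial>half_line) < \<infinity>"
      using elim by (simp add: J_def top.not_eq_extremum)
    have gt: "0 \<le> g t u" for u by (simp add: g_def)
    show ?case
      using integral_powr_le[OF p _ _ w(1) gt w(2) fin] by (simp add: W J_def)
  qed
  have wg: "AE u in half_line. norm (complex_of_real (\<kappa> u) * h (t * u)) = w u * g t u" for t
  proof (rule AE_half_lineI)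
    fix u :: real assume "0 < u"
    then show "norm (complex_of_real (\<kappa> u) * h (t * u)) = w u * g t u"
      using \<kappa> by (simp add: w_def g_def norm_mult Lp_kernel_def powr_minus field_simps)
  qed
  show "AE t in half_line. integrable half_line (\<lambda>u. complex_of_real (\<kappa> u) * h (t * u))"
    using AEJ
  proof eventually_elim
    case (elim t)
    show ?case
      by (rule Bochner_Integration.integrable_bound[OF conjunct1[OF elim]]) (use wg[of t] in \<open>auto\<close>)
  qed
  have "AE t in half_line. ennreal (norm (mult_conv \<kappa> h t) powr p) \<le> ennreal (kernel_mass p \<kappa> powr (p - 1)) * J t"
    using AEJ
  proof eventually_elim
    case (elim t)
    have "norm (mult_conv \<kappa> h t) \<le> (LINT u|half_line. norm (complex_of_real (\<kappa> u) * h (t * u)))"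
      unfolding mult_conv_def by (rule integral_norm_bound)
    also have "\<dots> = (LINT u|half_line. w u * g t u)"
      using wg[of t] by (intro integral_cong_AE) auto
    finally have "ennreal (norm (mult_conv \<kappa> h t) powr p) \<le> ennreal ((LINT u|half_line. w u * g t u) powr p)"
      using p by (intro ennreal_leI powr_mono2) auto
    with elim show ?case by (meson order_trans)
  qed
  then have "(\<integral>\<^sup>+t. ennreal (norm (mult_conv \<kappa> h t) powr p) \<partial>half_line) \<le>
      (\<integral>\<^sup>+t. ennreal (kernel_mass p \<kappa> powr (p - 1)) * J t \<partial>half_line)"
    by (rule nn_integral_mono_AE)
  also have "\<dots> = ennreal (kernel_mass p \<kappa> powr (p - 1)) * (ennreal (kernel_mass p \<kappa>) * ?N)"
    by (simp add: nn_integral_cmult JN)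
  also have "\<dots> = ennreal (kernel_mass p \<kappa> powr (p - 1) * kernel_mass p \<kappa>) * ?N"
    using W by (simp add: ennreal_mult mult.assoc)
  also have "kernel_mass p \<kappa> powr (p - 1) * kernel_mass p \<kappa> = kernel_mass p \<kappa> powr p"
    using W by (cases "kernel_mass p \<kappa> = 0") (auto simp: powr_diff)
  finally show "(\<integral>\<^sup>+t. ennreal (norm (mult_conv \<kappa> h t) powr p) \<partial>half_line) \<le>
      ennreal (kernel_mass p \<kappa> powr p) * ?N" .
qed

lemma in_Lp_mult_conv:
  assumes "1 < p" "in_Lp p h" "Lp_kernel p \<kappa>"
  shows "in_Lp p (mult_conv \<kappa> h)"
  using mult_conv_bound[OF assms] assms(2,3)
  by (auto simp: in_Lp_def Lp_kernel_def ennreal_mult_less_top elim!: le_less_trans)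

text \<open>Equality holds at every positive t, not merely almost everywhere, since for each fixed t
  the dilation by t preserves null sets.\<close>

lemma mult_conv_cong_AE:
  assumes [measurable]: "\<kappa> \<in> borel_measurable borel" "f \<in> borel_measurable borel" "g \<in> borel_measurable borel"
    and "AE t in half_line. f t = g t" and "0 < t"
  shows "mult_conv \<kappa> f t = mult_conv \<kappa> g t"
  unfolding mult_conv_def using AE_half_line_dilate[OF assms(4,5)]
  by (intro integral_cong_AE) auto

text \<open>Both sides are iterated integrals of \<kappa>(u) \<mu>(v) h(t u v). Fubini's theorem
  applies for almost every t, because replacing h by its modulus gives a convolution that is again
  in L^p and hence can be convolved with \<kappa>.\<close>

lemma mult_conv_commute:
  assumes p: "1 < p" and h: "in_Lp p h" and \<kappa>: "Lp_kernel p \<kappa>" and \<mu>: "Lp_kernel p \<mu>"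
  shows "AE t in half_line. mult_conv \<kappa> (mult_conv \<mu> h) t = mult_conv \<mu> (mult_conv \<kappa> h) t"
proof -
  have [measurable]: "h \<in> borel_measurable borel" "\<kappa> \<in> borel_measurable borel" "\<mu> \<in> borel_measurable borel"
    using h \<kappa> \<mu> by (auto simp: in_Lp_def Lp_kernel_def)
  define H where "H = mult_conv \<mu> (\<lambda>t. complex_of_real (norm (h t)))"
  have H: "in_Lp p H"
    unfolding H_def by (intro in_Lp_mult_conv in_Lp_norm p h \<mu>)
  have [measurable]: "H \<in> borel_measurable borel" using H by (simp add: in_Lp_def)
  interpret pair_sigma_finite half_line half_line ..
  have "AE t in half_line. integrable half_line (\<lambda>u. complex_of_real (\<kappa> u) * H (t * u))"
    by (rule mult_conv_AE_integrable[OF p H \<kappa>])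
  moreover have "AE t in half_line. 0 < t" by (simp add: AE_half_line)
  ultimately show ?thesis
  proof eventually_elim
    case (elim t)
    let ?f = "\<lambda>x. complex_of_real (\<kappa> (fst x)) * (complex_of_real (\<mu> (snd x)) * h (t * fst x * snd x))"
    have "AE u in half_line. integrable half_line (\<lambda>v. complex_of_real (\<mu> v) * h (t * u * v))"
      using AE_half_line_dilate[OF mult_conv_AE_integrable[OF p h \<mu>] elim(2)] by simp
    then have sec: "AE u in half_line. integrable half_line (\<lambda>v. ?f (u, v))"
      by eventually_elim simp
    have nrm: "(LINT v|half_line. norm (?f (u, v))) = norm (complex_of_real (\<kappa> u) * H (t * u))" for u
    proof -
      have "H (t * u) = complex_of_real (LINT v|half_line. \<mu> v * norm (h (t * u * v)))"
        unfolding H_def mult_conv_def by (simp flip: integral_complex_of_real)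
      moreover have "0 \<le> (LINT v|half_line. \<mu> v * norm (h (t * u * v)))"
        using \<mu> by (intro Bochner_Integration.integral_nonneg) (auto simp: Lp_kernel_def)
      ultimately show ?thesis
        using \<mu> by (simp add: norm_mult Lp_kernel_def mult.assoc)
    qed
    have int: "integrable (half_line \<Otimes>\<^sub>M half_line) ?f"
    proof (rule Fubini_integrable)
      show "integrable half_line (\<lambda>u. LINT v|half_line. norm (?f (u, v)))"
        unfolding nrm using elim(1) by (rule integrable_norm)
    qed (use sec in auto)
    have "(LINT u|half_line. LINT v|half_line. ?f (u, v)) = (LINT v|half_line. LINT u|half_line. ?f (u, v))"
      using Fubini_integral[of "\<lambda>u v. ?f (u, v)"] int by (simp add: case_prod_beta')
    also have "(\<lambda>v. LINT u|half_line. ?f (u, v)) =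
        (\<lambda>v. complex_of_real (\<mu> v) * (LINT u|half_line. complex_of_real (\<kappa> u) * h (t * v * u)))"
      by (subst integral_mult_right_zero[symmetric]) (simp add: mult_ac)
    finally show ?case
      by (simp add: mult_conv_def)
  qed
qed

section \<open>The Cesaro kernels\<close>

text \<open>One kernel serves both operators: integration in \<open>s\<close> gives
  \<open>cesaro\<close>, integration in \<open>t\<close> gives \<open>cesaro_dual\<close>. Their
  duality is then the exchange of the two integrations.\<close>

definition cesaro_kernel :: "real \<Rightarrow> real \<Rightarrow> real \<Rightarrow> real" where
  "cesaro_kernel \<beta> t s = (if s < t then \<beta> * (t - s) powr (\<beta> - 1) / t powr \<beta> else 0)"

lemma cesaro_kernel_measurable [measurable (raw)]:
  assumes [measurable]: "f \<in> borel_measurable M" "g \<in> borel_measurable M"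
  shows "(\<lambda>x. cesaro_kernel \<beta> (f x) (g x)) \<in> borel_measurable M"
  unfolding cesaro_kernel_def by measurable

lemma cesaro_kernel_nonneg: "0 < \<beta> \<Longrightarrow> 0 \<le> cesaro_kernel \<beta> t s"
  by (simp add: cesaro_kernel_def)

text \<open>Homogeneity of degree -1 is what makes both operators multiplicative convolutions, with
  the one-variable kernels \<open>cesaro_kernel \<beta> 1 u\<close> and
  \<open>cesaro_kernel \<beta> u 1\<close>.\<close>

lemma cesaro_kernel_homogeneous:
  assumes "0 < c" "0 \<le> t"
  shows "c * cesaro_kernel \<beta> (c * t) (c * s) = cesaro_kernel \<beta> t s"
proof (cases "s < t")
  case True
  have "c * t - c * s = c * (t - s)" by (simp add: algebra_simps)
  then show ?thesis
    using assms True by (simp add: cesaro_kernel_def powr_mult powr_diff)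
qed (use assms in \<open>simp add: cesaro_kernel_def\<close>)

lemma cesaro_half_line:
  assumes [measurable]: "f \<in> borel_measurable borel"
  shows "cesaro \<beta> f t = (LINT s|half_line. complex_of_real (cesaro_kernel \<beta> t s) * f s)"
proof -
  have "(LINT s|half_line. complex_of_real (cesaro_kernel \<beta> t s) * f s) =
      (LINT s|lborel. complex_of_real (\<beta> / t powr \<beta>) *
        (indicator {0<..<t} s *\<^sub>R (complex_of_real ((t - s) powr (\<beta> - 1)) * f s)))"
    by (subst integral_half_line)
      (auto simp: set_lebesgue_integral_def cesaro_kernel_def indicator_def intro!: Bochner_Integration.integral_cong)
  then show ?thesis
    by (simp only: integral_mult_right_zero cesaro_def set_lebesgue_integral_def)
qed

lemma cesaro_dual_half_line:
  assumes [measurable]: "f \<in> borel_measurable borel" and "0 < s"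
  shows "cesaro_dual \<beta> f s = (LINT t|half_line. complex_of_real (cesaro_kernel \<beta> t s) * f t)"
proof -
  have "(LINT t|half_line. complex_of_real (cesaro_kernel \<beta> t s) * f t) =
      (LINT t|lborel. complex_of_real \<beta> *
        (indicator {s<..} t *\<^sub>R (complex_of_real ((t - s) powr (\<beta> - 1) / t powr \<beta>) * f t)))"
    using assms(2) by (subst integral_half_line)
      (auto simp: set_lebesgue_integral_def cesaro_kernel_def indicator_def intro!: Bochner_Integration.integral_cong)
  then show ?thesis
    by (simp only: integral_mult_right_zero cesaro_dual_def set_lebesgue_integral_def)
qed

lemma cesaro_eq_mult_conv:
  assumes [measurable]: "f \<in> borel_measurable borel" and "0 < t"
  shows "cesaro \<beta> f t = mult_conv (\<lambda>u. cesaro_kernel \<beta> 1 u) f t"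
proof -
  have "cesaro \<beta> f t = t *\<^sub>R (LINT u|half_line. complex_of_real (cesaro_kernel \<beta> t (t * u)) * f (t * u))"
    by (subst cesaro_half_line, simp, subst integral_half_line_dilate[OF _ assms(2)]) auto
  also have "\<dots> = (LINT u|half_line. complex_of_real (t * cesaro_kernel \<beta> (t * 1) (t * u)) * f (t * u))"
    by (subst integral_scaleR_right[symmetric]) (simp add: scaleR_conv_of_real mult.assoc)
  finally show ?thesis
    using assms(2) by (simp only: cesaro_kernel_homogeneous zero_le_one mult_conv_def)
qed

lemma cesaro_dual_eq_mult_conv:
  assumes [measurable]: "f \<in> borel_measurable borel" and "0 < t"
  shows "cesaro_dual \<beta> f t = mult_conv (\<lambda>u. cesaro_kernel \<beta> u 1) f t"
proof -
  have "cesaro_dual \<beta> f t = t *\<^sub>R (LINT u|half_line. complex_of_real (cesaro_kernel \<beta> (t * u) t) * f (t * u))"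
    by (subst cesaro_dual_half_line[OF _ assms(2)], simp, subst integral_half_line_dilate[OF _ assms(2)]) auto
  also have "\<dots> = (LINT u|half_line. complex_of_real (t * cesaro_kernel \<beta> (t * u) (t * 1)) * f (t * u))"
    by (subst integral_scaleR_right[symmetric]) (simp add: scaleR_conv_of_real mult.assoc)
  also have "\<dots> = mult_conv (\<lambda>u. cesaro_kernel \<beta> u 1) f t"
    unfolding mult_conv_def using assms(2)
    by (intro integral_half_line_cong) (auto simp: cesaro_kernel_homogeneous[of t _ \<beta> 1, simplified])
  finally show ?thesis .
qed

lemma cesaro_dual_measurable [measurable]:
  assumes [measurable]: "f \<in> borel_measurable borel"
  shows "cesaro_dual \<beta> f \<in> borel_measurable borel"
proof -
  \<comment> \<open>Integrating over the whole line gives a formula valid also for t \<le> 0, where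
    the half-line representation would cut off part of the range; measurability is needed on all of
    the real line.\<close>
  have "cesaro_dual \<beta> f t = (LINT s|lborel. complex_of_real (cesaro_kernel \<beta> s t) * f s)" for t
    unfolding cesaro_dual_def set_lebesgue_integral_def integral_mult_right_zero[symmetric]
    by (intro Bochner_Integration.integral_cong) (auto simp: cesaro_kernel_def)
  then show ?thesis
    by (simp cong: measurable_cong)
qed

lemma cesaro_measurable [measurable]:
  assumes [measurable]: "f \<in> borel_measurable borel"
  shows "cesaro \<beta> f \<in> borel_measurable borel"
  unfolding cesaro_half_line[OF assms, abs_def] by measurable

section \<open>Beta integrals and the mass of the kernels\<close>

lemma nn_integral_half_line_Beta:
  assumes "0 < a" "0 < b"
  shows "(\<integral>\<^sup>+x. ennreal (if x < 1 then x powr (a - 1) * (1 - x) powr (b - 1) else 0) \<partial>half_line) = ennreal (Beta a b)"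
proof -
  have "(\<integral>\<^sup>+x. ennreal (if x < 1 then x powr (a - 1) * (1 - x) powr (b - 1) else 0) \<partial>half_line) =
      (\<integral>\<^sup>+x. ennreal (indicator {0..1} x * (x powr (a - 1) * (1 - x) powr (b - 1))) \<partial>lborel)"
    by (subst nn_integral_half_line) (auto simp: indicator_def intro!: nn_integral_cong)
  also have "\<dots> = ennreal (Beta a b)"
    using nn_integral_has_integral_lebesgue[OF _ has_integral_Beta_real[OF assms]] by simp
  finally show ?thesis .
qed

text \<open>The inversion u = 1 / x turns this into the integral of Beta(a, \<beta>). With a = 1 / p
  it gives the operator norm, with a > 1 / p the factor by which the dual operator multiplies the
  power t^(-a).\<close>

lemma nn_integral_cesaro_dual_kernel:
  assumes "0 < \<beta>" "0 < a"
  shows "(\<integral>\<^sup>+u. ennreal (cesaro_kernel \<beta> u 1 * u powr (- a)) \<partial>half_line) = ennreal (\<beta> * Beta \<beta> a)"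
proof -
  have "(\<integral>\<^sup>+u. ennreal (cesaro_kernel \<beta> u 1 * u powr (- a)) \<partial>half_line) =
     (\<integral>\<^sup>+x. ennreal (1 / x\<^sup>2) * ennreal (cesaro_kernel \<beta> (1 / x) 1 * (1 / x) powr (- a)) \<partial>half_line)"
    by (rule nn_integral_half_line_inverse) simp
  also have "\<dots> = (\<integral>\<^sup>+x. ennreal \<beta> * ennreal (if x < 1 then x powr (a - 1) * (1 - x) powr (\<beta> - 1) else 0) \<partial>half_line)"
  proof (rule nn_integral_half_line_cong)
    fix x :: real assume x: "0 < x"
    show "ennreal (1 / x\<^sup>2) * ennreal (cesaro_kernel \<beta> (1 / x) 1 * (1 / x) powr (- a)) =
      ennreal \<beta> * ennreal (if x < 1 then x powr (a - 1) * (1 - x) powr (\<beta> - 1) else 0)"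
    proof (cases "x < 1")
      case True
      have "1 / x - 1 = (1 - x) / x" using x by (simp add: field_simps)
      then have "1 / x\<^sup>2 * (cesaro_kernel \<beta> (1 / x) 1 * (1 / x) powr (- a)) = \<beta> * (x powr (a - 1) * (1 - x) powr (\<beta> - 1))"
        using x True by (simp add: cesaro_kernel_def powr_divide powr_diff powr_minus power2_eq_square field_simps)
      then show ?thesis
        using x True assms by (simp add: ennreal_mult[symmetric] cesaro_kernel_nonneg)
    qed (use x in \<open>simp add: cesaro_kernel_def\<close>)
  qed
  also have "\<dots> = ennreal (\<beta> * Beta \<beta> a)"
    using assms by (simp add: nn_integral_cmult nn_integral_half_line_Beta ennreal_mult' Beta_commute)
  finally show ?thesis .
qed

lemma Beta_real_pos: "0 < a \<Longrightarrow> 0 < b \<Longrightarrow> 0 < Beta a (b::real)"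
  by (simp add: Beta_def Gamma_real_pos)

lemma integrable_cesaro_dual_kernel:
  assumes "0 < \<beta>" "0 < a"
  shows "integrable half_line (\<lambda>u. cesaro_kernel \<beta> u 1 * u powr (- a))"
    and "(LINT u|half_line. cesaro_kernel \<beta> u 1 * u powr (- a)) = \<beta> * Beta \<beta> a"
proof -
  have nn: "0 \<le> cesaro_kernel \<beta> u 1 * u powr (- a)" for u
    using assms by (simp add: cesaro_kernel_nonneg)
  show int: "integrable half_line (\<lambda>u. cesaro_kernel \<beta> u 1 * u powr (- a))"
    using nn_integral_cesaro_dual_kernel[OF assms] nn by (auto simp: integrable_iff_bounded)
  have "0 \<le> \<beta> * Beta \<beta> a" using assms by (simp add: Beta_real_pos less_imp_le)
  then show "(LINT u|half_line. cesaro_kernel \<beta> u 1 * u powr (- a)) = \<beta> * Beta \<beta> a"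
    using nn_integral_cesaro_dual_kernel[OF assms] nn
    by (subst integral_eq_nn_integral) auto
qed

lemma Lp_kernel_cesaro_dual:
  assumes "0 < \<beta>" "1 < p"
  shows "Lp_kernel p (\<lambda>u. cesaro_kernel \<beta> u 1)" "kernel_mass p (\<lambda>u. cesaro_kernel \<beta> u 1) = \<beta> * Beta \<beta> (1 / p)"
  using integrable_cesaro_dual_kernel[of \<beta> "1 / p"] assms
  by (auto simp: Lp_kernel_def kernel_mass_def cesaro_kernel_nonneg)

text \<open>Since -1/p = (1 - 1/p) - 1, the integral is \<beta> Beta(1 - 1/p, \<beta>), and p > 1
  makes the first argument positive.\<close>

lemma Lp_kernel_cesaro:
  assumes "0 < \<beta>" "1 < p"
  shows "Lp_kernel p (\<lambda>u. cesaro_kernel \<beta> 1 u)"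
proof -
  have "(\<integral>\<^sup>+u. ennreal (cesaro_kernel \<beta> 1 u * u powr (- 1 / p)) \<partial>half_line) =
      (\<integral>\<^sup>+u. ennreal \<beta> * ennreal (if u < 1 then u powr (1 - 1 / p - 1) * (1 - u) powr (\<beta> - 1) else 0) \<partial>half_line)"
    using assms by (intro nn_integral_half_line_cong) (auto simp: cesaro_kernel_def ennreal_mult[symmetric] mult_ac)
  also have "\<dots> = ennreal \<beta> * ennreal (Beta (1 - 1 / p) \<beta>)"
    using assms by (subst nn_integral_cmult, simp, subst nn_integral_half_line_Beta) auto
  also have "\<dots> < \<infinity>" by (simp add: ennreal_mult_less_top)
  finally show ?thesis
    using assms by (auto simp: Lp_kernel_def integrable_iff_bounded cesaro_kernel_nonneg abs_mult)
qed

text \<open>Only integrability is wanted, so the pointwise Young inequality takes the place of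
  Hoelder's.\<close>

lemma in_Lp_mult_integrable:
  assumes "1 < p" "1 < q" "1 / p + 1 / q = 1" and h: "in_Lp p h" and k: "in_Lp q k"
  shows "integrable half_line (\<lambda>t. h t * k t)"
proof -
  have [measurable]: "h \<in> borel_measurable borel" "k \<in> borel_measurable borel"
    using h k by (auto simp: in_Lp_def)
  have "integrable half_line (\<lambda>t. norm (h t) powr p / p + norm (k t) powr q / q)"
    using in_Lp_integrable[OF h] in_Lp_integrable[OF k] by auto
  then show ?thesis
    by (rule Bochner_Integration.integrable_bound)
      (use Youngs_inequality[OF assms(1-3)] assms(1,2) in \<open>auto simp: norm_mult intro!: AE_I2\<close>)
qed

text \<open>Fubini for the common kernel. Absolute integrability holds because the Cesaro operator
  applied to the modulus of h stays in L^p and can be paired with k in the conjugate space.\<close>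

lemma cesaro_duality:
  assumes pq: "1 < p" "1 < q" "1 / p + 1 / q = 1" and h: "in_Lp p h" and k: "in_Lp q k" and \<beta>: "0 < \<beta>"
  shows "(LINT t|half_line. cesaro \<beta> h t * k t) = (LINT s|half_line. h s * cesaro_dual \<beta> k s)"
proof -
  have [measurable]: "h \<in> borel_measurable borel" "k \<in> borel_measurable borel"
    using h k by (auto simp: in_Lp_def)
  interpret pair_sigma_finite half_line half_line ..
  let ?f = "\<lambda>x. complex_of_real (cesaro_kernel \<beta> (fst x) (snd x)) * h (snd x) * k (fst x)"
  define H where "H = mult_conv (\<lambda>u. cesaro_kernel \<beta> 1 u) (\<lambda>t. complex_of_real (norm (h t)))"
  have H: "in_Lp p H"
    unfolding H_def by (intro in_Lp_mult_conv in_Lp_norm pq h Lp_kernel_cesaro \<beta>)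
  have pos: "AE t in half_line. 0 < t" by (simp add: AE_half_line)
  have sec: "AE t in half_line. integrable half_line (\<lambda>s. ?f (t, s))"
    using mult_conv_AE_integrable[OF pq(1) h Lp_kernel_cesaro[OF \<beta> pq(1)]] pos
  proof eventually_elim
    case (elim t)
    \<comment> \<open>The known integrability concerns the normalised kernel at t * u; homogeneity
      and the dilation by t carry it over to the kernel in the variable s = t * u.\<close>
    have "(\<lambda>u. complex_of_real (cesaro_kernel \<beta> 1 u) * h (t * u)) =
        (\<lambda>u. complex_of_real t * (complex_of_real (cesaro_kernel \<beta> t (t * u)) * h (t * u)))"
      using cesaro_kernel_homogeneous[OF elim(2), of 1 \<beta>] by (auto simp flip: of_real_mult mult.assoc)
    then have "integrable half_line (\<lambda>u. complex_of_real t * (complex_of_real (cesaro_kernel \<beta> t (t * u)) * h (t * u)))"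
      using elim(1) by metis
    then have "integrable half_line (\<lambda>u. complex_of_real (1 / t) *
        (complex_of_real t * (complex_of_real (cesaro_kernel \<beta> t (t * u)) * h (t * u))))"
      by (rule integrable_mult_right)
    then have "integrable half_line (\<lambda>u. complex_of_real (cesaro_kernel \<beta> t (t * u)) * h (t * u))"
      using elim(2) by simp
    then have "integrable half_line (\<lambda>s. complex_of_real (cesaro_kernel \<beta> t s) * h s)"
      using integrable_half_line_dilate_iff[of "\<lambda>s. complex_of_real (cesaro_kernel \<beta> t s) * h s" t] elim(2) by simp
    then show ?case by simp
  qed
  have nrm: "(LINT s|half_line. norm (?f (t, s))) = norm (H t * k t)" if t: "0 < t" for t
  proof -
    have "H t = cesaro \<beta> (\<lambda>t. complex_of_real (norm (h t))) t"
      unfolding H_def using t by (subst cesaro_eq_mult_conv) auto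
    also have "\<dots> = complex_of_real (LINT s|half_line. cesaro_kernel \<beta> t s * norm (h s))"
      by (subst cesaro_half_line) (simp_all flip: integral_complex_of_real)
    finally have "H t = complex_of_real (LINT s|half_line. cesaro_kernel \<beta> t s * norm (h s))" .
    moreover have "0 \<le> (LINT s|half_line. cesaro_kernel \<beta> t s * norm (h s))"
      using \<beta> by (intro Bochner_Integration.integral_nonneg) (auto simp: cesaro_kernel_nonneg)
    ultimately show ?thesis
      using \<beta> by (simp add: norm_mult cesaro_kernel_nonneg)
  qed
  have int: "integrable (half_line \<Otimes>\<^sub>M half_line) ?f"
  proof (rule Fubini_integrable)
    have [measurable]: "H \<in> borel_measurable borel" using H by (simp add: in_Lp_def)
    have "integrable half_line (\<lambda>t. norm (H t * k t))"
      by (intro integrable_norm in_Lp_mult_integrable[OF pq H k])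
    then show "integrable half_line (\<lambda>t. LINT s|half_line. norm (?f (t, s)))"
      by (subst integrable_cong_AE[where g = "\<lambda>t. norm (H t * k t)"]) (auto intro!: AE_half_lineI simp: nrm[simplified])
  qed (use sec in auto)
  have "(LINT t|half_line. LINT s|half_line. ?f (t, s)) = (LINT s|half_line. LINT t|half_line. ?f (t, s))"
    using Fubini_integral[of "\<lambda>t s. ?f (t, s)"] int by (simp add: case_prod_beta')
  also have "(LINT t|half_line. LINT s|half_line. ?f (t, s)) = (LINT t|half_line. cesaro \<beta> h t * k t)"
    by (simp add: cesaro_half_line)
  also have "(LINT s|half_line. LINT t|half_line. ?f (t, s)) = (LINT s|half_line. h s * cesaro_dual \<beta> k s)"
  proof (rule integral_half_line_cong)
    fix s :: real assume s: "0 < s"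
    have "(LINT t|half_line. ?f (t, s)) = (LINT t|half_line. h s * (complex_of_real (cesaro_kernel \<beta> t s) * k t))"
      by (simp add: mult_ac)
    then show "(LINT t|half_line. ?f (t, s)) = h s * cesaro_dual \<beta> k s"
      using s by (simp only: cesaro_dual_half_line integral_mult_right_zero) (simp add: cesaro_dual_half_line)
  qed auto
  finally show ?thesis by simp
qed

text \<open>Substitute u = exp (-r) in the multiplicative convolution; u > 1 means r < 0, and the
  factor exp (-r / p) in \<open>T_dil\<close> cancels the dependence of the exponent on p. A Bochner
  integral and its transform take the default value 0 together, so the identity holds at every t > 0
  and not just almost everywhere.\<close>

lemma cesaro_dual_eq_dilation_integral:
  assumes [measurable]: "f \<in> borel_measurable borel" and t: "0 < t"
  shows "cesaro_dual \<beta> f t = complex_of_real \<beta> *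
    (LINT r:{..<0}|lborel. complex_of_real ((exp (- r) - 1) powr (\<beta> - 1) * exp (- r * (1 - 1 / p - \<beta>))) * T_dil r p f t)"
proof -
  have "cesaro_dual \<beta> f t = (LINT r|lborel. exp r *\<^sub>R (complex_of_real (cesaro_kernel \<beta> (exp r) 1) * f (t * exp r)))"
    unfolding cesaro_dual_eq_mult_conv[OF assms] mult_conv_def by (rule integral_half_line_exp) simp
  also have "\<dots> = (LINT r|lborel. exp (- r) *\<^sub>R (complex_of_real (cesaro_kernel \<beta> (exp (- r)) 1) * f (t * exp (- r))))"
    by (subst lborel_integral_real_affine[of "-1" _ 0]) auto
  also have "\<dots> = (LINT r|lborel. complex_of_real \<beta> * (indicator {..<0} r *\<^sub>R
      (complex_of_real ((exp (- r) - 1) powr (\<beta> - 1) * exp (- r * (1 - 1 / p - \<beta>))) * T_dil r p f t)))"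
  proof (intro Bochner_Integration.integral_cong refl)
    fix r :: real
    have "exp (- r) * cesaro_kernel \<beta> (exp (- r)) 1 = \<beta> * (indicator {..<0} r *
        ((exp (- r) - 1) powr (\<beta> - 1) * (exp (- r * (1 - 1 / p - \<beta>)) * exp (- r / p))))"
    proof -
      have "exp (- r) powr \<beta> = exp (- r * \<beta>)" by (simp add: powr_def)
      moreover have "exp (- r * (1 - 1 / p - \<beta>)) * exp (- r / p) = exp (- r) / exp (- r * \<beta>)"
        by (simp add: exp_diff[symmetric] exp_add[symmetric] algebra_simps)
      ultimately show ?thesis
        by (simp add: cesaro_kernel_def indicator_def)
    qed
    then have "complex_of_real (exp (- r) * cesaro_kernel \<beta> (exp (- r)) 1) * f (t * exp (- r)) =
      complex_of_real (\<beta> * (indicator {..<0} r *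
        ((exp (- r) - 1) powr (\<beta> - 1) * (exp (- r * (1 - 1 / p - \<beta>)) * exp (- r / p))))) * f (t * exp (- r))"
      by simp
    then show "exp (- r) *\<^sub>R (complex_of_real (cesaro_kernel \<beta> (exp (- r)) 1) * f (t * exp (- r))) =
      complex_of_real \<beta> * (indicator {..<0} r *\<^sub>R
      (complex_of_real ((exp (- r) - 1) powr (\<beta> - 1) * exp (- r * (1 - 1 / p - \<beta>))) * T_dil r p f t))"
      by (simp add: T_dil_def scaleR_conv_of_real mult_ac)
  qed
  finally show ?thesis
    by (simp only: set_lebesgue_integral_def integral_mult_right_zero)
qed

section \<open>Density of polynomials\<close>

text \<open>Covers two situations at once: exp (-t), decreasing, with \<sigma> = -1, for the density
  of exponential sums, and exp (-1 / t), increasing, with \<sigma> = 1 and exponent 1, for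
  injectivity. The sign \<sigma> records the direction of monotonicity; values in [0, 1] allow
  Bernstein approximation.\<close>

locale monotone_substitution =
  fixes \<nu> :: "real measure" and \<theta> :: "real \<Rightarrow> real" and \<sigma> :: real and p :: real
  assumes finite: "emeasure \<nu> UNIV \<noteq> \<infinity>"
    and sets_nu [measurable_cong, simp]: "sets \<nu> = sets borel"
    and theta_measurable [measurable]: "\<theta> \<in> borel_measurable borel"
    and theta_range: "\<theta> t \<in> {0..1}"
    and exponent: "1 \<le> p"
    and AE_pos: "AE t in \<nu>. 0 < t"
    and monotone: "0 < a \<Longrightarrow> 0 < t \<Longrightarrow> a < t \<longleftrightarrow> 0 < \<sigma> * (\<theta> t - \<theta> a)"
begin

lemma space_nu [simp]: "space \<nu> = UNIV"
  using sets_eq_imp_space_eq[OF sets_nu] by simp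

lemma measurable_nu1 [simp]: "measurable \<nu> N = measurable borel N"
  by (rule measurable_cong_sets) auto

definition poly_approximable :: "(real \<Rightarrow> complex) \<Rightarrow> bool" where
  "poly_approximable g \<longleftrightarrow> g \<in> borel_measurable borel \<and>
     (\<forall>\<epsilon>>0. \<exists>P. (\<integral>\<^sup>+t. ennreal (norm (g t - poly P (complex_of_real (\<theta> t))) powr p) \<partial>\<nu>) < ennreal \<epsilon>)"

lemma poly_theta_measurable [measurable]: "(\<lambda>t. poly P (complex_of_real (\<theta> t))) \<in> borel_measurable borel"
  unfolding poly_altdef by measurable

lemma poly_approximableI:
  assumes [measurable]: "g \<in> borel_measurable borel"
    and *: "\<And>\<epsilon>. 0 < \<epsilon> \<Longrightarrow> \<exists>g'. poly_approximable g' \<and> (\<integral>\<^sup>+t. ennreal (norm (g t - g' t) powr p) \<partial>\<nu>) < ennreal \<epsilon>"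
  shows "poly_approximable g"
  unfolding poly_approximable_def
proof (intro conjI allI impI)
  fix \<epsilon> :: real assume "0 < \<epsilon>"
  \<comment> \<open>Two errors of size \<delta>, inflated by the factor 2^p of the quasi-triangle
    inequality, add up to \<epsilon>.\<close>
  define \<delta> where "\<delta> = \<epsilon> / 2 / 2 powr p"
  have \<delta>: "0 < \<delta>" using \<open>0 < \<epsilon>\<close> by (simp add: \<delta>_def)
  obtain g' where g': "poly_approximable g'" "(\<integral>\<^sup>+t. ennreal (norm (g t - g' t) powr p) \<partial>\<nu>) < ennreal \<delta>"
    using *[OF \<delta>] by blast
  then obtain P where P: "(\<integral>\<^sup>+t. ennreal (norm (g' t - poly P (complex_of_real (\<theta> t))) powr p) \<partial>\<nu>) < ennreal \<delta>"
    using \<delta> by (auto simp: poly_approximable_def)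
  have [measurable]: "g' \<in> borel_measurable borel" using g' by (simp add: poly_approximable_def)
  have "(\<integral>\<^sup>+t. ennreal (norm (g t - poly P (complex_of_real (\<theta> t))) powr p) \<partial>\<nu>) =
      (\<integral>\<^sup>+t. ennreal (norm ((g t - g' t) + (g' t - poly P (complex_of_real (\<theta> t)))) powr p) \<partial>\<nu>)"
    by simp
  also have "\<dots> \<le> ennreal (2 powr p) * ((\<integral>\<^sup>+t. ennreal (norm (g t - g' t) powr p) \<partial>\<nu>) +
      (\<integral>\<^sup>+t. ennreal (norm (g' t - poly P (complex_of_real (\<theta> t))) powr p) \<partial>\<nu>))"
    using exponent by (intro nn_integral_powr_add_le) auto
  also have "\<dots> < ennreal (2 powr p) * (ennreal \<delta> + ennreal \<delta>)"
    using g'(2) P by (intro ennreal_mult_strict_left_mono add_strict_mono) auto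
  also have "\<dots> = ennreal \<epsilon>"
    using \<delta> by (simp add: ennreal_plus[symmetric] ennreal_mult[symmetric] \<delta>_def del: ennreal_plus)
  finally show "\<exists>P. (\<integral>\<^sup>+t. ennreal (norm (g t - poly P (complex_of_real (\<theta> t))) powr p) \<partial>\<nu>) < ennreal \<epsilon>"
    by blast
qed simp

lemma poly_approximable_limit:
  assumes [measurable]: "g \<in> borel_measurable borel" and s: "\<And>n. poly_approximable (s n)"
    and lim: "AE t in \<nu>. (\<lambda>n. s n t) \<longlonglongrightarrow> g t"
    and bound: "\<And>n. AE t in \<nu>. norm (g t - s n t) \<le> w t"
    and [measurable]: "w \<in> borel_measurable borel" and fin: "(\<integral>\<^sup>+t. ennreal (w t powr p) \<partial>\<nu>) < \<infinity>"
  shows "poly_approximable g"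
proof (rule poly_approximableI)
  have [measurable]: "s n \<in> borel_measurable borel" for n using s by (simp add: poly_approximable_def)
  have "(\<lambda>n. \<integral>\<^sup>+t. ennreal (norm (g t - s n t) powr p) \<partial>\<nu>) \<longlonglongrightarrow> (\<integral>\<^sup>+t. 0 \<partial>\<nu>)"
  proof (rule nn_integral_dominated_convergence[where w = "\<lambda>t. ennreal (w t powr p)"])
    show "AE t in \<nu>. ennreal (norm (g t - s n t) powr p) \<le> ennreal (w t powr p)" for n
      using bound[of n] by eventually_elim (use exponent in \<open>auto intro!: ennreal_leI powr_mono2\<close>)
    show "AE t in \<nu>. (\<lambda>n. ennreal (norm (g t - s n t) powr p)) \<longlonglongrightarrow> 0"
      using lim
    proof eventually_elim
      case (elim t)
      have "(\<lambda>n. norm (g t - s n t)) \<longlonglongrightarrow> norm (g t - g t)"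
        by (intro tendsto_intros elim)
      then have "(\<lambda>n. norm (g t - s n t)) \<longlonglongrightarrow> 0" by simp
      then have "(\<lambda>n. norm (g t - s n t) powr p) \<longlonglongrightarrow> 0"
        using exponent by (intro tendsto_zero_powrI[where b = p]) auto
      then show ?case using tendsto_ennrealI by fastforce
    qed
  qed (use fin in auto)
  then have "\<forall>\<^sub>F n in sequentially. (\<integral>\<^sup>+t. ennreal (norm (g t - s n t) powr p) \<partial>\<nu>) < ennreal \<epsilon>" if "0 < \<epsilon>" for \<epsilon>
    using that by (intro order_tendstoD) auto
  then have "\<exists>n. (\<integral>\<^sup>+t. ennreal (norm (g t - s n t) powr p) \<partial>\<nu>) < ennreal \<epsilon>" if "0 < \<epsilon>" for \<epsilon>
    using that eventually_happens'[OF sequentially_bot] by blast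
  then show "\<exists>g'. poly_approximable g' \<and> (\<integral>\<^sup>+t. ennreal (norm (g t - g' t) powr p) \<partial>\<nu>) < ennreal \<epsilon>" if "0 < \<epsilon>" for \<epsilon>
    using s that by blast
qed simp

lemma const_powr_finite: "(\<integral>\<^sup>+t. ennreal (c powr p) \<partial>\<nu>) < \<infinity>"
  using finite by (simp add: ennreal_mult_less_top top.not_eq_extremum)

lemma poly_approximable_add:
  assumes f: "poly_approximable f" and g: "poly_approximable g"
  shows "poly_approximable (\<lambda>t. f t + g t)"
  unfolding poly_approximable_def
proof (intro conjI allI impI)
  have [measurable]: "f \<in> borel_measurable borel" "g \<in> borel_measurable borel"
    using f g by (auto simp: poly_approximable_def)
  show "(\<lambda>t. f t + g t) \<in> borel_measurable borel" by simp
  fix \<epsilon> :: real assume "0 < \<epsilon>"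
  define \<delta> where "\<delta> = \<epsilon> / 2 / 2 powr p"
  have \<delta>: "0 < \<delta>" using \<open>0 < \<epsilon>\<close> by (simp add: \<delta>_def)
  obtain P where P: "(\<integral>\<^sup>+t. ennreal (norm (f t - poly P (complex_of_real (\<theta> t))) powr p) \<partial>\<nu>) < ennreal \<delta>"
    using f \<delta> by (auto simp: poly_approximable_def)
  obtain Q where Q: "(\<integral>\<^sup>+t. ennreal (norm (g t - poly Q (complex_of_real (\<theta> t))) powr p) \<partial>\<nu>) < ennreal \<delta>"
    using g \<delta> by (auto simp: poly_approximable_def)
  have "(\<integral>\<^sup>+t. ennreal (norm (f t + g t - poly (P + Q) (complex_of_real (\<theta> t))) powr p) \<partial>\<nu>) =
      (\<integral>\<^sup>+t. ennreal (norm ((f t - poly P (complex_of_real (\<theta> t))) + (g t - poly Q (complex_of_real (\<theta> t)))) powr p) \<partial>\<nu>)"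
    by (simp add: algebra_simps)
  also have "\<dots> \<le> ennreal (2 powr p) * ((\<integral>\<^sup>+t. ennreal (norm (f t - poly P (complex_of_real (\<theta> t))) powr p) \<partial>\<nu>) +
      (\<integral>\<^sup>+t. ennreal (norm (g t - poly Q (complex_of_real (\<theta> t))) powr p) \<partial>\<nu>))"
    using exponent by (intro nn_integral_powr_add_le) auto
  also have "\<dots> < ennreal (2 powr p) * (ennreal \<delta> + ennreal \<delta>)"
    using P Q by (intro ennreal_mult_strict_left_mono add_strict_mono) auto
  also have "\<dots> = ennreal \<epsilon>"
    using \<delta> by (simp add: ennreal_plus[symmetric] ennreal_mult[symmetric] \<delta>_def del: ennreal_plus)
  finally show "\<exists>P. (\<integral>\<^sup>+t. ennreal (norm (f t + g t - poly P (complex_of_real (\<theta> t))) powr p) \<partial>\<nu>) < ennreal \<epsilon>"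
    by blast
qed

lemma poly_approximable_cmult:
  assumes g: "poly_approximable g"
  shows "poly_approximable (\<lambda>t. c * g t)"
  unfolding poly_approximable_def
proof (intro conjI allI impI)
  have [measurable]: "g \<in> borel_measurable borel"
    using g by (auto simp: poly_approximable_def)
  show "(\<lambda>t. c * g t) \<in> borel_measurable borel" by simp
  fix \<epsilon> :: real assume "0 < \<epsilon>"
  \<comment> \<open>The summand 1 keeps the quotient meaningful for c = 0 and makes the final
    inequality strict.\<close>
  define \<delta> where "\<delta> = \<epsilon> / (norm c powr p + 1)"
  have pos: "0 < norm c powr p + 1" by (simp add: add_nonneg_pos)
  then have \<delta>: "0 < \<delta>" using \<open>0 < \<epsilon>\<close> by (simp add: \<delta>_def)
  obtain P where P: "(\<integral>\<^sup>+t. ennreal (norm (g t - poly P (complex_of_real (\<theta> t))) powr p) \<partial>\<nu>) < ennreal \<delta>"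
    using g \<delta> by (auto simp: poly_approximable_def)
  have "(\<integral>\<^sup>+t. ennreal (norm (c * g t - poly (smult c P) (complex_of_real (\<theta> t))) powr p) \<partial>\<nu>) =
      (\<integral>\<^sup>+t. ennreal (norm c powr p) * ennreal (norm (g t - poly P (complex_of_real (\<theta> t))) powr p) \<partial>\<nu>)"
    by (simp add: right_diff_distrib[symmetric] norm_mult powr_mult ennreal_mult)
  also have "\<dots> = ennreal (norm c powr p) * (\<integral>\<^sup>+t. ennreal (norm (g t - poly P (complex_of_real (\<theta> t))) powr p) \<partial>\<nu>)"
    by (simp add: nn_integral_cmult)
  also have "\<dots> \<le> ennreal (norm c powr p) * ennreal \<delta>"
    using P by (intro mult_left_mono) auto
  also have "\<dots> = ennreal (norm c powr p * \<delta>)"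
    using \<delta> by (simp add: ennreal_mult)
  also have "\<dots> < ennreal \<epsilon>"
    using \<open>0 < \<epsilon>\<close> pos by (intro ennreal_lessI) (auto simp: \<delta>_def field_simps)
  finally show "\<exists>P. (\<integral>\<^sup>+t. ennreal (norm (c * g t - poly P (complex_of_real (\<theta> t))) powr p) \<partial>\<nu>) < ennreal \<epsilon>"
    by blast
qed

lemma poly_approximable_continuous:
  fixes G :: "real \<Rightarrow> real"
  assumes G: "continuous_on {0..1} G" and [measurable]: "(\<lambda>t. G (\<theta> t)) \<in> borel_measurable borel"
  shows "poly_approximable (\<lambda>t. complex_of_real (G (\<theta> t)))"
  unfolding poly_approximable_def
proof (intro conjI allI impI)
  fix \<epsilon> :: real assume \<epsilon>: "0 < \<epsilon>"
  define m where "m = measure \<nu> UNIV"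
  have m: "emeasure \<nu> UNIV = ennreal m" "0 \<le> m"
    using finite by (simp_all add: m_def emeasure_eq_ennreal_measure)
  \<comment> \<open>A uniform error e on [0, 1] costs e^p times the total mass m, which this choice
    keeps strictly below \<epsilon>, also when m = 0.\<close>
  define e where "e = (\<epsilon> / (m + 1)) powr (1 / p)"
  have e: "0 < e" "e powr p = \<epsilon> / (m + 1)"
    using \<epsilon> m exponent by (auto simp: e_def powr_powr)
  obtain N where N: "\<And>n x. N \<le> n \<Longrightarrow> x \<in> {0..1} \<Longrightarrow> \<bar>G x - (\<Sum>k\<le>n. G (k / n) * Bernstein n k x)\<bar> < e"
    using Bernstein_Weierstrass[OF G e(1)] by blast
  \<comment> \<open>The Bernstein polynomial of degree N as a complex polynomial:
    \<open>[:0, 1:]\<close> stands for x and \<open>[:1, -1:]\<close> for 1 - x.\<close>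
  define P :: "complex poly" where
    "P = (\<Sum>k\<le>N. [:complex_of_real (G (k / N) * real (N choose k)):] * [:0, 1:] ^ k * [:1, -1:] ^ (N - k))"
  have P: "poly P (complex_of_real x) = complex_of_real (\<Sum>k\<le>N. G (k / N) * Bernstein N k x)" for x
    by (simp add: P_def poly_sum Bernstein_def mult_ac)
  have "(\<integral>\<^sup>+t. ennreal (norm (complex_of_real (G (\<theta> t)) - poly P (complex_of_real (\<theta> t))) powr p) \<partial>\<nu>) \<le>
      (\<integral>\<^sup>+t. ennreal (e powr p) \<partial>\<nu>)"
  proof (intro nn_integral_mono ennreal_leI powr_mono2)
    fix t
    show "norm (complex_of_real (G (\<theta> t)) - poly P (complex_of_real (\<theta> t))) \<le> e"
      using N[OF order_refl theta_range, of t] unfolding P of_real_diff[symmetric] norm_of_real by simp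
  qed (use exponent in auto)
  also have "\<dots> = ennreal (e powr p * m)"
    using m by (simp add: ennreal_mult)
  also have "\<dots> < ennreal \<epsilon>"
    unfolding e(2) using \<epsilon> m by (intro ennreal_lessI) (auto simp: field_simps)
  finally show "\<exists>P. (\<integral>\<^sup>+t. ennreal (norm (complex_of_real (G (\<theta> t)) - poly P (complex_of_real (\<theta> t))) powr p) \<partial>\<nu>) < ennreal \<epsilon>"
    by blast
qed simp

lemma poly_approximable_one: "poly_approximable (\<lambda>t. 1)"
  using poly_approximable_continuous[of "\<lambda>_. 1"] by simp

section \<open>From continuous functions of the substitution to all of L^p\<close>

lemma poly_approximable_cong_AE:
  assumes g: "poly_approximable g" and [measurable]: "f \<in> borel_measurable borel" and "AE t in \<nu>. f t = g t"
  shows "poly_approximable f"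
proof (rule poly_approximable_limit[where s = "\<lambda>_. g" and w = "\<lambda>_. 0"])
  show "AE t in \<nu>. norm (f t - g t) \<le> 0" using assms(3) by eventually_elim simp
  show "AE t in \<nu>. (\<lambda>_. g t) \<longlonglongrightarrow> f t" using assms(3) by eventually_elim simp
qed (use g const_powr_finite in auto)

lemma poly_approximable_Ioi: "poly_approximable (indicator {a<..})"
proof (cases "0 < a")
  case False
  have "AE t in \<nu>. indicator {a<..} t = (1::complex)"
    using AE_pos by eventually_elim (use False in auto)
  then show ?thesis
    by (intro poly_approximable_cong_AE[OF poly_approximable_one]) auto
next
  case True
  \<comment> \<open>Continuous ramps in x, vanishing where \<sigma> (x - \<theta> a) \<le> 0 and
    tending to 1 where it is positive. By strict monotonicity the latter condition at x = \<theta> t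
    means exactly a < t.\<close>
  define G where "G n x = min 1 (max 0 (real n * (\<sigma> * (x - \<theta> a))))" for n x
  have [measurable]: "G n \<in> borel_measurable borel" for n
    unfolding G_def[abs_def] by measurable
  show ?thesis
  proof (rule poly_approximable_limit[where s = "\<lambda>n t. complex_of_real (G n (\<theta> t))" and w = "\<lambda>_. 2"])
    show "poly_approximable (\<lambda>t. complex_of_real (G n (\<theta> t)))" for n
      by (rule poly_approximable_continuous) (auto simp: G_def intro!: continuous_intros)
    show "AE t in \<nu>. (\<lambda>n. complex_of_real (G n (\<theta> t))) \<longlonglongrightarrow> indicator {a<..} t"
      using AE_pos
    proof eventually_elim
      case (elim t)
      show ?case
      proof (cases "a < t")
        case False
        then have "\<sigma> * (\<theta> t - \<theta> a) \<le> 0" using monotone[OF True elim] by simp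
        then have "real n * (\<sigma> * (\<theta> t - \<theta> a)) \<le> 0" for n
          using mult_nonneg_nonpos[of "real n" "\<sigma> * (\<theta> t - \<theta> a)"] by simp
        then have "G n (\<theta> t) = 0" for n by (simp add: G_def max_absorb1)
        then show ?thesis using False by simp
      next
        case True
        then have pos: "0 < \<sigma> * (\<theta> t - \<theta> a)" using monotone[OF \<open>0 < a\<close> elim] by simp
        have "\<forall>\<^sub>F n in sequentially. 1 / (\<sigma> * (\<theta> t - \<theta> a)) \<le> real n"
          using filterlim_real_sequentially by (auto simp: filterlim_at_top)
        then have "\<forall>\<^sub>F n in sequentially. complex_of_real (G n (\<theta> t)) = 1"
          by eventually_elim (use pos in \<open>auto simp: G_def min_def max_def field_simps\<close>)
        then show ?thesis using True by (simp add: tendsto_eventually)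
      qed
    qed
    show "AE t in \<nu>. norm (indicator {a<..} t - complex_of_real (G n (\<theta> t))) \<le> 2" for n
    proof (rule AE_I2)
      fix t
      have "norm (indicator {a<..} t :: complex) \<le> 1" by (simp add: indicator_def)
      moreover have "norm (complex_of_real (G n (\<theta> t))) \<le> 1" by (simp add: G_def)
      ultimately show "norm (indicator {a<..} t - complex_of_real (G n (\<theta> t))) \<le> 2"
        using norm_triangle_ineq4[of "indicator {a<..} t" "complex_of_real (G n (\<theta> t))"] by linarith
    qed
  qed (use const_powr_finite in auto)
qed

lemma poly_approximable_sum:
  "finite I \<Longrightarrow> (\<And>i. i \<in> I \<Longrightarrow> poly_approximable (f i)) \<Longrightarrow> poly_approximable (\<lambda>t. \<Sum>i\<in>I. f i t)"
proof (induction I rule: finite_induct)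
  case empty
  show ?case using poly_approximable_cmult[OF poly_approximable_one, of 0] by simp
qed (auto intro: poly_approximable_add)

text \<open>The half-lines {a<..} form an intersection-stable generator of the Borel sets.
  Complements are linear combinations with 1, and for disjoint unions the partial sums are
  indicators, dominated by a constant that the finite measure integrates.\<close>

lemma poly_approximable_indicator:
  assumes "A \<in> sets borel"
  shows "poly_approximable (indicator A)"
proof -
  have sig: "A \<in> sigma_sets UNIV (range (\<lambda>a::real. {a<..}))"
    using assms by (subst (asm) borel_Ioi) (simp add: sets_measure_of)
  have sub: "range (\<lambda>a::real. {a<..}) \<subseteq> Pow UNIV" by simp
  have stable: "Int_stable (range (\<lambda>a::real. {a<..}))"
  proof (rule Int_stableI)
    fix A B assume "A \<in> range (\<lambda>a::real. {a<..})" "B \<in> range (\<lambda>a::real. {a<..})"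
    then obtain a b where "A = {a<..}" "B = {b<..}" by auto
    then have "A \<inter> B = {max a b<..}" by auto
    then show "A \<inter> B \<in> range (\<lambda>a::real. {a<..})" by blast
  qed
  show ?thesis
    using stable sub sig
  proof (induction rule: sigma_sets_induct_disjoint)
    case (basic A)
    then show ?case using poly_approximable_Ioi by auto
  next
    case empty
    show ?case using poly_approximable_cmult[OF poly_approximable_one, of 0] by (simp add: indicator_def)
  next
    case (compl A)
    have "indicator (UNIV - A) = (\<lambda>t. 1 + (-1) * indicator A t :: complex)"
      by (auto simp: indicator_def)
    then show ?case
      using poly_approximable_add[OF poly_approximable_one poly_approximable_cmult[OF compl.IH, of "-1"]] by simp
  next
    case (union A)
    have sets: "A i \<in> sets borel" for i
      using union.hyps(2) by (subst borel_Ioi) (auto simp: sets_measure_of)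
    have part: "(\<Sum>i<n. indicator (A i) t) = (indicator (\<Union>i<n. A i) t :: complex)" for n t
      using union.hyps(1)
      by (subst indicator_UN_disjoint) (auto simp: disjoint_family_on_def)
    show ?case
    proof (rule poly_approximable_limit[where s = "\<lambda>n t. \<Sum>i<n. indicator (A i) t" and w = "\<lambda>_. 2"])
      show "indicator (\<Union> (range A)) \<in> borel_measurable borel"
        using sets by measurable
      show "poly_approximable (\<lambda>t. \<Sum>i<n. indicator (A i) t)" for n
        by (intro poly_approximable_sum) (auto intro: union.IH)
      show "AE t in \<nu>. (\<lambda>n. \<Sum>i<n. indicator (A i) t) \<longlonglongrightarrow> (indicator (\<Union> (range A)) t :: complex)"
        unfolding part using LIMSEQ_indicator_UN[of A] by auto
      show "AE t in \<nu>. norm (indicator (\<Union> (range A)) t - (\<Sum>i<n. indicator (A i) t) :: complex) \<le> 2" for n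
        unfolding part by (auto simp: indicator_def)
    qed (use const_powr_finite in auto)
  qed
qed

lemma poly_approximable_Lp:
  assumes [measurable]: "g \<in> borel_measurable borel" and fin: "(\<integral>\<^sup>+t. ennreal (norm (g t) powr p) \<partial>\<nu>) < \<infinity>"
  shows "poly_approximable g"
proof -
  obtain s where s: "\<And>i. simple_function \<nu> (s i)" "\<And>t. (\<lambda>i. s i t) \<longlonglongrightarrow> g t"
    "\<And>i t. norm (s i t) \<le> 2 * norm (g t)"
    using borel_measurable_implies_sequence_metric[of g \<nu> 0] by (auto simp: dist_norm)
  show ?thesis
  \<comment> \<open>The approximating simple functions satisfy norm (s n) \<le> 2 norm g, so 3 norm
    g dominates the differences.\<close>
  proof (rule poly_approximable_limit[where s = s and w = "\<lambda>t. 3 * norm (g t)"])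
    show "poly_approximable (s n)" for n
    proof -
      have "s n = (\<lambda>t. \<Sum>y\<in>range (s n). y * indicator (s n -` {y}) t)"
      proof
        fix t
        have "(\<Sum>y\<in>range (s n). y * indicator (s n -` {y}) t) = (\<Sum>y\<in>{s n t}. y * indicator (s n -` {y}) t)"
          using simple_functionD(1)[OF s(1)[of n]]
          by (intro sum.mono_neutral_right) (auto simp: indicator_def)
        then show "s n t = (\<Sum>y\<in>range (s n). y * indicator (s n -` {y}) t)" by simp
      qed
      moreover have "poly_approximable (\<lambda>t. \<Sum>y\<in>range (s n). y * indicator (s n -` {y}) t)"
        using simple_functionD[OF s(1)[of n]]
        by (intro poly_approximable_sum poly_approximable_cmult poly_approximable_indicator) auto
      ultimately show ?thesis by simp
    qed
    show "AE t in \<nu>. norm (g t - s n t) \<le> 3 * norm (g t)" for n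
    proof (rule AE_I2)
      fix t
      show "norm (g t - s n t) \<le> 3 * norm (g t)"
        using norm_triangle_ineq4[of "g t" "s n t"] s(3)[of n t] by linarith
    qed
    have "(\<integral>\<^sup>+t. ennreal ((3 * norm (g t)) powr p) \<partial>\<nu>) = ennreal (3 powr p) * (\<integral>\<^sup>+t. ennreal (norm (g t) powr p) \<partial>\<nu>)"
      by (simp add: powr_mult ennreal_mult nn_integral_cmult)
    then show "(\<integral>\<^sup>+t. ennreal ((3 * norm (g t)) powr p) \<partial>\<nu>) < \<infinity>"
      using fin by (simp add: ennreal_mult_less_top)
  qed (use s in auto)
qed

end

section \<open>Weyl calculus on the Schwartz class\<close>

lemma integral_half_line_translate:
  fixes f :: "real \<Rightarrow> 'a::{banach, second_countable_topology}"
  assumes [measurable]: "f \<in> borel_measurable borel"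
  shows "(LINT u|half_line. f (t + u)) = (LINT s:{t<..}|lborel. f s)"
proof -
  have "(LINT s|lborel. indicator {t<..} s *\<^sub>R f s) = (LINT u|lborel. indicator {t<..} (t + u) *\<^sub>R f (t + u))"
    by (subst lborel_integral_real_affine[of 1 _ t]) auto
  then show ?thesis
    by (simp add: integral_half_line set_lebesgue_integral_def indicator_def)
qed

lemma nn_integral_half_line_translate:
  assumes [measurable]: "f \<in> borel_measurable borel"
  shows "(\<integral>\<^sup>+u. f (t + u) \<partial>half_line) = (\<integral>\<^sup>+s. indicator {t<..} s * f s \<partial>lborel)"
proof -
  have "(\<integral>\<^sup>+s. indicator {t<..} s * f s \<partial>lborel) = (\<integral>\<^sup>+u. indicator {t<..} (t + u) * f (t + u) \<partial>lborel)"
    by (subst nn_integral_real_affine[of _ 1 t]) auto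
  then show ?thesis
    by (simp add: nn_integral_half_line indicator_def)
qed

text \<open>After translation t occurs only in the argument of f and no longer in the singular
  power, so differentiation in t falls on f alone.\<close>

lemma weyl_int_half_line:
  assumes [measurable]: "f \<in> borel_measurable borel"
  shows "weyl_int \<gamma> f t = (LINT u|half_line. complex_of_real (u powr (\<gamma> - 1)) * f (t + u)) / complex_of_real (Gamma \<gamma>)"
  using integral_half_line_translate[of "\<lambda>s. complex_of_real ((s - t) powr (\<gamma> - 1)) * f s" t]
  by (simp add: weyl_int_def)

lemma weyl_int_cong: "(\<And>s. t < s \<Longrightarrow> f s = g s) \<Longrightarrow> weyl_int \<gamma> f t = weyl_int \<gamma> g t"
  unfolding weyl_int_def set_lebesgue_integral_def
  by (intro arg_cong2[where f = "(/)"] Bochner_Integration.integral_cong) (auto simp: indicator_def)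

lemma weyl_int_cmult: "weyl_int \<gamma> (\<lambda>s. c * f s) t = c * weyl_int \<gamma> f t"
  unfolding weyl_int_def set_lebesgue_integral_def
  by (subst times_divide_eq_right, subst integral_mult_right_zero[symmetric])
    (simp add: mult_ac)

text \<open>The integrable majorant for all Weyl integrals of rapidly decreasing functions. With s =
  1 + u it is 1 / \<gamma> times the dual Cesaro kernel against s^(-1), hence a Beta
  integral.\<close>

lemma integrable_powr_weight:
  assumes "0 < \<gamma>"
  shows "integrable half_line (\<lambda>u. u powr (\<gamma> - 1) * (1 + u) powr (- (\<gamma> + 1)))"
proof -
  have "(\<integral>\<^sup>+u. ennreal (u powr (\<gamma> - 1) * (1 + u) powr (- (\<gamma> + 1))) \<partial>half_line) =
      (\<integral>\<^sup>+s. indicator {1<..} s * ennreal ((s - 1) powr (\<gamma> - 1) * s powr (- (\<gamma> + 1))) \<partial>lborel)"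
    using nn_integral_half_line_translate[of "\<lambda>s. ennreal ((s - 1) powr (\<gamma> - 1) * s powr (- (\<gamma> + 1)))" 1] by simp
  also have "\<dots> = (\<integral>\<^sup>+s. indicator {0<..} s * (ennreal (1 / \<gamma>) * ennreal (cesaro_kernel \<gamma> s 1 * s powr (- 1))) \<partial>lborel)"
  proof (intro nn_integral_cong)
    fix s :: real
    have "s powr (- (\<gamma> + 1)) = s powr (- 1) / s powr \<gamma>"
      using powr_diff[of s "- 1" \<gamma>] by (simp add: algebra_simps)
    then show "indicator {1<..} s * ennreal ((s - 1) powr (\<gamma> - 1) * s powr (- (\<gamma> + 1))) =
        indicator {0<..} s * (ennreal (1 / \<gamma>) * ennreal (cesaro_kernel \<gamma> s 1 * s powr (- 1)))"
      using assms by (auto simp: indicator_def cesaro_kernel_def ennreal_mult[symmetric])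
  qed
  also have "\<dots> = (\<integral>\<^sup>+s. ennreal (1 / \<gamma>) * ennreal (cesaro_kernel \<gamma> s 1 * s powr (- 1)) \<partial>half_line)"
    by (rule nn_integral_half_line[symmetric]) simp
  also have "\<dots> = ennreal (1 / \<gamma>) * ennreal (\<gamma> * Beta \<gamma> 1)"
    using assms by (subst nn_integral_cmult, simp, subst nn_integral_cesaro_dual_kernel) auto
  also have "\<dots> < \<infinity>" by (simp add: ennreal_mult_less_top)
  finally show ?thesis
    by (simp add: integrable_iff_bounded abs_mult)
qed

text \<open>Two mean value estimates, at the cost of the factor 1/2 of Taylor's formula. The bound
  on the second derivative is assumed only beyond c: taking c = u below makes the remainder inherit
  decay in u.\<close>

lemma taylor_two_bound:
  fixes f f' f'' :: "real \<Rightarrow> complex"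
  assumes f: "\<And>x. c \<le> x \<Longrightarrow> (f has_vector_derivative f' x) (at x within {c..})"
    and f': "\<And>x. c \<le> x \<Longrightarrow> (f' has_vector_derivative f'' x) (at x within {c..})"
    and B: "\<And>x. c \<le> x \<Longrightarrow> norm (f'' x) \<le> B" and "c \<le> a" "c \<le> b"
  shows "norm (f b - f a - (b - a) *\<^sub>R f' a) \<le> B * (b - a)\<^sup>2"
proof -
  have "0 \<le> B" using B[of c] by (meson norm_ge_zero order_refl order_trans)
  have lip: "norm (f' x - f' a) \<le> B * norm (x - a)" if "c \<le> x" for x
  proof (rule differentiable_bound[where S = "{c..}" and f' = "\<lambda>x h. h *\<^sub>R f'' x"])
    show "onorm (\<lambda>h. h *\<^sub>R f'' x) \<le> B" if "x \<in> {c..}" for x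
    proof (rule onorm_le)
      fix h
      show "norm (h *\<^sub>R f'' x) \<le> B * norm h"
        using that B[of x] mult_right_mono[of "norm (f'' x)" B "\<bar>h\<bar>"] by (simp add: mult.commute)
    qed
  qed (use f' that assms in \<open>auto simp: has_vector_derivative_def\<close>)
  have seg: "closed_segment a b \<subseteq> {c..}"
    using assms by (auto simp: closed_segment_eq_real_ivl)
  have "norm (f b - f a - (b - a) *\<^sub>R f' a) \<le> norm (b - a) * (B * norm (b - a))"
  proof (rule vector_differentiable_bound_linearization[where S = "closed_segment a b"])
    fix x assume x: "x \<in> closed_segment a b"
    show "(f has_vector_derivative f' x) (at x within closed_segment a b)"
      using f[of x] x seg by (auto intro: has_vector_derivative_within_subset)
    have "norm (f' x - f' a) \<le> B * norm (x - a)" using lip x seg by auto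
    also have "\<dots> \<le> B * norm (b - a)"
      using x \<open>0 \<le> B\<close> by (intro mult_left_mono) (auto simp: closed_segment_eq_real_ivl split: if_splits)
    finally show "norm (f' x - f' a) \<le> B * norm (b - a)" .
  qed auto
  then show ?thesis by (simp add: power2_eq_square mult_ac)
qed

text \<open>A Schwartz function with all its one-sided derivatives, extended by 0 to the negative
  axis so that every member is Borel measurable on the whole line.\<close>

locale schwartz_family =
  fixes D :: "nat \<Rightarrow> real \<Rightarrow> complex"
  assumes deriv: "0 \<le> t \<Longrightarrow> (D m has_vector_derivative D (Suc m) t) (at t within {0..})"
    and decay: "\<exists>C. \<forall>t\<ge>0. (1 + t) ^ n * norm (D m t) \<le> C"
    and zero: "t < 0 \<Longrightarrow> D m t = 0"
begin

lemma continuous_D: "continuous_on {0..} (D m)"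
  using deriv by (auto simp: continuous_on_eq_continuous_within intro: has_vector_derivative_continuous)

lemma isCont_D: "0 < t \<Longrightarrow> isCont (D m) t"
  using continuous_D[of m] by (auto simp: continuous_on_interior interior_Ici)

lemma deriv_at: "0 < t \<Longrightarrow> (D m has_vector_derivative D (Suc m) t) (at t)"
  using deriv[of t m] at_within_interior[of t "{0..}"] by (simp add: interior_Ici)

lemma D_measurable [measurable]: "D m \<in> borel_measurable borel"
proof -
  have "(\<lambda>t. indicator {0..} t *\<^sub>R D m t) \<in> borel_measurable borel"
    by (intro borel_measurable_continuous_on_indicator continuous_D) auto
  moreover have "(\<lambda>t. indicator {0..} t *\<^sub>R D m t) = D m"
    using zero by (auto simp: indicator_def not_le fun_eq_iff)
  ultimately show ?thesis by simp
qed

lemma decay_powr: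
  obtains C where "0 \<le> C" "\<And>t. 0 \<le> t \<Longrightarrow> norm (D m t) \<le> C * (1 + t) powr (- a)"
proof -
  define n where "n = nat \<lceil>a\<rceil>"
  have n: "a \<le> real n" by (simp add: n_def) linarith
  obtain C where C: "\<And>t. 0 \<le> t \<Longrightarrow> (1 + t) ^ n * norm (D m t) \<le> C"
    using decay[of n m] by blast
  show thesis
  proof
    show "0 \<le> C" using C[of 0] by (auto intro: order_trans[OF norm_ge_zero])
    fix t :: real assume t: "0 \<le> t"
    have "(1 + t) powr a * norm (D m t) \<le> (1 + t) powr real n * norm (D m t)"
      using n t by (intro mult_right_mono powr_mono) auto
    also have "\<dots> \<le> C" using C[OF t] t by (simp add: powr_realpow)
    finally show "norm (D m t) \<le> C * (1 + t) powr (- a)"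
      using t by (simp add: powr_minus field_simps)
  qed
qed

lemma integrable_weyl:
  assumes "0 < \<gamma>" "0 \<le> t"
  shows "integrable half_line (\<lambda>u. complex_of_real (u powr (\<gamma> - 1)) * D m (t + u))"
proof -
  obtain C where C: "0 \<le> C" "\<And>t. 0 \<le> t \<Longrightarrow> norm (D m t) \<le> C * (1 + t) powr (- (\<gamma> + 1))"
    using decay_powr[of m "\<gamma> + 1"] by blast
  have "integrable half_line (\<lambda>u. C * (u powr (\<gamma> - 1) * (1 + u) powr (- (\<gamma> + 1))))"
    using integrable_powr_weight[OF assms(1)] by simp
  then show ?thesis
  proof (rule Bochner_Integration.integrable_bound)
    show "AE u in half_line. norm (complex_of_real (u powr (\<gamma> - 1)) * D m (t + u)) \<le>
        norm (C * (u powr (\<gamma> - 1) * (1 + u) powr (- (\<gamma> + 1))))"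
    proof (rule AE_half_lineI)
      fix u :: real assume u: "0 < u"
      have "norm (D m (t + u)) \<le> C * (1 + (t + u)) powr (- (\<gamma> + 1))"
        using C u assms by simp
      also have "\<dots> \<le> C * (1 + u) powr (- (\<gamma> + 1))"
        using C u assms by (intro mult_left_mono powr_mono2') auto
      finally have "u powr (\<gamma> - 1) * norm (D m (t + u)) \<le> u powr (\<gamma> - 1) * (C * (1 + u) powr (- (\<gamma> + 1)))"
        by (intro mult_left_mono) auto
      then show "norm (complex_of_real (u powr (\<gamma> - 1)) * D m (t + u)) \<le>
          norm (C * (u powr (\<gamma> - 1) * (1 + u) powr (- (\<gamma> + 1))))"
        using C by (simp add: norm_mult abs_mult mult_ac)
    qed
  qed simp
qed

text \<open>The second-order Taylor remainder is dominated uniformly by the decay of \<open>D (m + 2)\<close>,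
  so the difference quotient converges with a linear rate.\<close>
lemma weyl_int_deriv:
  assumes \<gamma>: "0 < \<gamma>" and t: "0 < t"
  shows "(weyl_int \<gamma> (D m) has_vector_derivative weyl_int \<gamma> (D (Suc m)) t) (at t)"
proof -
  obtain C where C: "0 \<le> C" "\<And>t. 0 \<le> t \<Longrightarrow> norm (D (Suc (Suc m)) t) \<le> C * (1 + t) powr (- (\<gamma> + 1))"
    using decay_powr[of "Suc (Suc m)" "\<gamma> + 1"] by blast
  define w where "w u = u powr (\<gamma> - 1) * (1 + u) powr (- (\<gamma> + 1))" for u
  have w: "integrable half_line w" using integrable_powr_weight[OF \<gamma>] by (simp add: w_def[abs_def])
  define K where "K = C * (LINT u|half_line. w u) / Gamma \<gamma>"
  have G: "0 < Gamma \<gamma>" using \<gamma> by (rule Gamma_real_pos)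
  have "0 \<le> (LINT u|half_line. w u)"
    by (intro Bochner_Integration.integral_nonneg) (auto simp: w_def)
  then have K: "0 \<le> K" using C G by (simp add: K_def)
  have quad: "norm (weyl_int \<gamma> (D m) y - weyl_int \<gamma> (D m) t - (y - t) *\<^sub>R weyl_int \<gamma> (D (Suc m)) t) \<le> K * (y - t)\<^sup>2"
    if y: "0 < y" for y
  proof -
    let ?R = "\<lambda>u. D m (y + u) - D m (t + u) - (y - t) *\<^sub>R D (Suc m) (t + u)"
    have "weyl_int \<gamma> (D m) y - weyl_int \<gamma> (D m) t - (y - t) *\<^sub>R weyl_int \<gamma> (D (Suc m)) t =
       ((LINT u|half_line. complex_of_real (u powr (\<gamma> - 1)) * D m (y + u)) -
        (LINT u|half_line. complex_of_real (u powr (\<gamma> - 1)) * D m (t + u)) -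
        (y - t) *\<^sub>R (LINT u|half_line. complex_of_real (u powr (\<gamma> - 1)) * D (Suc m) (t + u))) / complex_of_real (Gamma \<gamma>)"
      by (simp add: weyl_int_half_line diff_divide_distrib scaleR_conv_of_real)
    also have "\<dots> = (LINT u|half_line. complex_of_real (u powr (\<gamma> - 1)) * ?R u) / complex_of_real (Gamma \<gamma>)"
      using integrable_weyl[OF \<gamma>, of y m] integrable_weyl[OF \<gamma>, of t m] integrable_weyl[OF \<gamma>, of t "Suc m"] t y
      by (simp add: right_diff_distrib)
    finally have eq: "weyl_int \<gamma> (D m) y - weyl_int \<gamma> (D m) t - (y - t) *\<^sub>R weyl_int \<gamma> (D (Suc m)) t =
        (LINT u|half_line. complex_of_real (u powr (\<gamma> - 1)) * ?R u) / complex_of_real (Gamma \<gamma>)" .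
    have bnd: "norm (complex_of_real (u powr (\<gamma> - 1)) * ?R u) \<le> C * (y - t)\<^sup>2 * w u" if u: "0 < u" for u
    proof -
      have "norm (D m (y + u) - D m (t + u) - ((y + u) - (t + u)) *\<^sub>R D (Suc m) (t + u)) \<le>
          C * (1 + u) powr (- (\<gamma> + 1)) * ((y + u) - (t + u))\<^sup>2"
      proof (rule taylor_two_bound[where c = u and f'' = "D (Suc (Suc m))"])
        fix x assume x: "u \<le> x"
        show "(D m has_vector_derivative D (Suc m) x) (at x within {u..})"
             "(D (Suc m) has_vector_derivative D (Suc (Suc m)) x) (at x within {u..})"
          using x u by (auto intro!: has_vector_derivative_within_subset[OF deriv])
        have "norm (D (Suc (Suc m)) x) \<le> C * (1 + x) powr (- (\<gamma> + 1))" using C x u by simp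
        also have "\<dots> \<le> C * (1 + u) powr (- (\<gamma> + 1))"
          using C u x \<gamma> by (intro mult_left_mono powr_mono2') auto
        finally show "norm (D (Suc (Suc m)) x) \<le> C * (1 + u) powr (- (\<gamma> + 1))" .
      qed (use t y in auto)
      then have "norm (?R u) \<le> C * (1 + u) powr (- (\<gamma> + 1)) * (y - t)\<^sup>2" by simp
      then have "u powr (\<gamma> - 1) * norm (?R u) \<le> u powr (\<gamma> - 1) * (C * (1 + u) powr (- (\<gamma> + 1)) * (y - t)\<^sup>2)"
        by (intro mult_left_mono) auto
      then show ?thesis by (simp add: norm_mult w_def mult_ac)
    qed
    have "norm (LINT u|half_line. complex_of_real (u powr (\<gamma> - 1)) * ?R u) \<le>
        (LINT u|half_line. norm (complex_of_real (u powr (\<gamma> - 1)) * ?R u))"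
      by (rule integral_norm_bound)
    also have "\<dots> \<le> (LINT u|half_line. C * (y - t)\<^sup>2 * w u)"
      using w bnd order_trans[OF norm_ge_zero bnd] by (intro integral_mono_AE' AE_half_lineI) auto
    also have "\<dots> = C * (y - t)\<^sup>2 * (LINT u|half_line. w u)" by simp
    finally show ?thesis
      unfolding eq using G by (simp add: norm_divide K_def field_simps)
  qed
  show ?thesis
    unfolding has_vector_derivative_def has_derivative_at_alt
  proof (intro conjI allI impI)
    show "bounded_linear (\<lambda>h. h *\<^sub>R weyl_int \<gamma> (D (Suc m)) t)" by (rule bounded_linear_scaleR_left)
    fix e :: real assume e: "0 < e"
    show "\<exists>d>0. \<forall>y. norm (y - t) < d \<longrightarrow>
        norm (weyl_int \<gamma> (D m) y - weyl_int \<gamma> (D m) t - (y - t) *\<^sub>R weyl_int \<gamma> (D (Suc m)) t) \<le> e * norm (y - t)"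
    \<comment> \<open>The bound t keeps y positive, where the quadratic estimate is available; K + 1
      avoids division by zero.\<close>
    proof (intro exI[of _ "min t (e / (K + 1))"] conjI allI impI)
      show "0 < min t (e / (K + 1))" using t e K by auto
      fix y assume y: "norm (y - t) < min t (e / (K + 1))"
      then have "0 < y" by auto
      have "K * norm (y - t) \<le> (K + 1) * norm (y - t)" by (simp add: algebra_simps)
      also have "\<dots> \<le> (K + 1) * (e / (K + 1))" using y K by (intro mult_left_mono) auto
      also have "\<dots> = e" using K by simp
      finally have "K * norm (y - t) * norm (y - t) \<le> e * norm (y - t)" by (intro mult_right_mono) auto
      then show "norm (weyl_int \<gamma> (D m) y - weyl_int \<gamma> (D m) t - (y - t) *\<^sub>R weyl_int \<gamma> (D (Suc m)) t) \<le> e * norm (y - t)"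
        using quad[OF \<open>0 < y\<close>] by (simp add: power2_eq_square mult.assoc)
    qed
  qed
qed

section \<open>Inverting the Weyl derivative on Schwartz functions\<close>

lemma vderiv_iter_weyl_int:
  assumes "0 < \<gamma>" "0 < t" "\<And>t. 0 \<le> t \<Longrightarrow> f t = D 0 t"
  shows "vderiv_iter n (weyl_int \<gamma> f) t = weyl_int \<gamma> (D n) t"
  using assms(2)
proof (induction n arbitrary: t)
  case 0
  then show ?case using assms(3) by (auto simp: vderiv_iter_def intro!: weyl_int_cong)
next
  case (Suc n)
  have "vderiv_iter (Suc n) (weyl_int \<gamma> f) t = vector_derivative (vderiv_iter n (weyl_int \<gamma> f)) (at t)"
    by (simp add: vderiv_iter_def)
  also have "(vderiv_iter n (weyl_int \<gamma> f) has_vector_derivative weyl_int \<gamma> (D (Suc n)) t) (at t)"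
    by (rule has_vector_derivative_transform_within_open[OF weyl_int_deriv[OF assms(1) Suc.prems], of "{0<..}"])
      (use Suc in auto)
  then have "vector_derivative (vderiv_iter n (weyl_int \<gamma> f)) (at t) = weyl_int \<gamma> (D (Suc n)) t"
    by (rule vector_derivative_at)
  finally show ?case .
qed

text \<open>Exchanging the integrations leaves the inner integral of u^(a-1) (v-u)^(b-1) over 0 < u
  < v, equal to v^(a+b-1) Beta(a, b); the Gamma factors then combine by the definition of
  Beta.\<close>

lemma weyl_int_semigroup:
  assumes a: "0 < a" and b: "0 < b" and t: "0 \<le> t"
  shows "weyl_int a (weyl_int b (D m)) t = weyl_int (a + b) (D m) t"
proof -
  interpret pair_sigma_finite half_line half_line ..
  have [measurable]: "weyl_int b (D m) \<in> borel_measurable borel"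
    by (subst weyl_int_half_line[OF D_measurable, abs_def]) auto
  let ?k = "\<lambda>u v. if u < v then u powr (a - 1) * (v - u) powr (b - 1) else 0 :: real"
  let ?f = "\<lambda>x. complex_of_real (?k (fst x) (snd x)) * D m (t + snd x)"
  have k: "(\<integral>\<^sup>+u. ennreal (?k u v) \<partial>half_line) = ennreal (v powr (a + b - 1) * Beta a b)" if v: "0 < v" for v
  proof -
    have "(\<integral>\<^sup>+u. ennreal (?k u v) \<partial>half_line) = ennreal v * (\<integral>\<^sup>+x. ennreal (?k (v * x) v) \<partial>half_line)"
      using v by (intro nn_integral_half_line_dilate) auto
    also have "(\<integral>\<^sup>+x. ennreal (?k (v * x) v) \<partial>half_line) =
       (\<integral>\<^sup>+x. ennreal (v powr (a + b - 2)) * ennreal (if x < 1 then x powr (a - 1) * (1 - x) powr (b - 1) else 0) \<partial>half_line)"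
    proof (rule nn_integral_half_line_cong)
      fix x :: real assume x: "0 < x"
      have "v - v * x = v * (1 - x)" by (simp add: algebra_simps)
      then show "ennreal (?k (v * x) v) =
          ennreal (v powr (a + b - 2)) * ennreal (if x < 1 then x powr (a - 1) * (1 - x) powr (b - 1) else 0)"
        using v x powr_add[of v "a - 1" "b - 1"]
        by (auto simp: powr_mult ennreal_mult[symmetric] add_diff_eq mult_ac)
    qed
    also have "\<dots> = ennreal (v powr (a + b - 2)) * ennreal (Beta a b)"
      using a b by (subst nn_integral_cmult, simp, subst nn_integral_half_line_Beta) auto
    also have "ennreal v * \<dots> = ennreal (v * v powr (a + b - 2) * Beta a b)"
      using v a b by (simp add: ennreal_mult[symmetric] mult.assoc Beta_real_pos less_imp_le)
    also have "v * v powr (a + b - 2) = v powr (a + b - 1)"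
      using v powr_add[of v 1 "a + b - 2"] by simp
    finally show ?thesis .
  qed
  have kint: "integrable half_line (\<lambda>u. ?k u v)" "(LINT u|half_line. ?k u v) = v powr (a + b - 1) * Beta a b" if v: "0 < v" for v
  proof -
    show "integrable half_line (\<lambda>u. ?k u v)"
      using k[OF v] by (auto simp: integrable_iff_bounded if_distrib[of abs] abs_mult cong: if_cong)
    show "(LINT u|half_line. ?k u v) = v powr (a + b - 1) * Beta a b"
      using k[OF v] a b by (subst integral_eq_nn_integral) (auto simp: Beta_real_pos less_imp_le)
  qed
  \<comment> \<open>The variables are swapped so that the integral evaluated in closed form is the
    inner one; the outer integrand is then a multiple of that of the Weyl integral of order a +
    b.\<close>
  have int: "integrable (half_line \<Otimes>\<^sub>M half_line) (\<lambda>x. ?f (snd x, fst x))"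
  proof (rule Fubini_integrable)
    have "integrable half_line (\<lambda>v. Beta a b * norm (complex_of_real (v powr (a + b - 1)) * D m (t + v)))"
      using integrable_weyl[of "a + b" t m] a b t by (intro integrable_mult_right integrable_norm) auto
    then show "integrable half_line (\<lambda>v. LINT u|half_line. norm (?f (snd (v, u), fst (v, u))))"
    proof (subst integrable_cong_AE[where g = "\<lambda>v. Beta a b * norm (complex_of_real (v powr (a + b - 1)) * D m (t + v))"])
      show "AE v in half_line. (LINT u|half_line. norm (?f (snd (v, u), fst (v, u)))) =
          Beta a b * norm (complex_of_real (v powr (a + b - 1)) * D m (t + v))"
      proof (rule AE_half_lineI)
        fix v :: real assume v: "0 < v"
        have "(LINT u|half_line. norm (?f (snd (v, u), fst (v, u)))) = (LINT u|half_line. ?k u v * norm (D m (t + v)))"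
          by (intro Bochner_Integration.integral_cong) (auto simp: norm_mult)
        then show "(LINT u|half_line. norm (?f (snd (v, u), fst (v, u)))) =
          Beta a b * norm (complex_of_real (v powr (a + b - 1)) * D m (t + v))"
          using kint[OF v] by (simp add: norm_mult mult_ac)
      qed
    qed auto
    show "AE v in half_line. integrable half_line (\<lambda>u. ?f (snd (v, u), fst (v, u)))"
      using kint(1) unfolding fst_conv snd_conv
      by (intro AE_half_lineI integrable_mult_left integrable_of_real) auto
  qed auto
  have "(LINT u|half_line. complex_of_real (u powr (a - 1)) * (LINT v|half_line. complex_of_real (v powr (b - 1)) * D m (t + u + v))) =
      (LINT u|half_line. LINT v|half_line. ?f (u, v))"
  proof (rule integral_half_line_cong)
    fix u :: real assume u: "0 < u"
    have "(LINT v|half_line. ?f (u, v)) = (LINT v:{0<..}|lborel. ?f (u, v))"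
      by (rule integral_half_line) simp
    also have "\<dots> = (LINT v:{u<..}|lborel. complex_of_real (u powr (a - 1)) * (complex_of_real ((v - u) powr (b - 1)) * D m (t + v)))"
      unfolding set_lebesgue_integral_def using u
      by (intro Bochner_Integration.integral_cong) (auto simp: indicator_def)
    also have "\<dots> = (LINT v|half_line. complex_of_real (u powr (a - 1)) * (complex_of_real (v powr (b - 1)) * D m (t + u + v)))"
      using integral_half_line_translate[of "\<lambda>v. complex_of_real (u powr (a - 1)) * (complex_of_real ((v - u) powr (b - 1)) * D m (t + v))" u]
      by (auto simp: add.assoc)
    finally show "complex_of_real (u powr (a - 1)) * (LINT v|half_line. complex_of_real (v powr (b - 1)) * D m (t + u + v)) =
        (LINT v|half_line. ?f (u, v))"
      by simp
  qed auto
  also have "\<dots> = (LINT v|half_line. LINT u|half_line. ?f (u, v))"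
    using Fubini_integral[of "\<lambda>v u. ?f (u, v)"] int by (simp add: case_prod_beta')
  also have "\<dots> = (LINT v|half_line. complex_of_real (Beta a b) * (complex_of_real (v powr (a + b - 1)) * D m (t + v)))"
  proof (rule integral_half_line_cong)
    fix v :: real assume v: "0 < v"
    have "(LINT u|half_line. ?f (u, v)) = (LINT u|half_line. complex_of_real (?k u v)) * D m (t + v)"
      by (simp only: fst_conv snd_conv integral_mult_left_zero)
    then show "(LINT u|half_line. ?f (u, v)) = complex_of_real (Beta a b) * (complex_of_real (v powr (a + b - 1)) * D m (t + v))"
      using kint(2)[OF v] by (simp only: integral_complex_of_real) (simp add: mult_ac)
  qed auto
  finally have main: "(LINT u|half_line. complex_of_real (u powr (a - 1)) * (LINT v|half_line. complex_of_real (v powr (b - 1)) * D m (t + u + v))) =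
     complex_of_real (Beta a b) * (LINT v|half_line. complex_of_real (v powr (a + b - 1)) * D m (t + v))"
    by simp
  have "weyl_int a (weyl_int b (D m)) t =
      (LINT u|half_line. complex_of_real (u powr (a - 1)) * (LINT v|half_line. complex_of_real (v powr (b - 1)) * D m (t + u + v)))
        / complex_of_real (Gamma b) / complex_of_real (Gamma a)"
    by (subst weyl_int_half_line, simp, subst weyl_int_half_line) simp_all
  also have "\<dots> = complex_of_real (Beta a b / (Gamma a * Gamma b)) *
      (LINT v|half_line. complex_of_real (v powr (a + b - 1)) * D m (t + v))"
    unfolding main by simp
  also have "Beta a b / (Gamma a * Gamma b) = 1 / Gamma (a + b)"
  proof -
    have "Gamma a \<noteq> 0" "Gamma b \<noteq> 0"
      using Gamma_real_pos[OF a] Gamma_real_pos[OF b] by linarith+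
    then show ?thesis by (simp add: Beta_def)
  qed
  finally show ?thesis
    by (simp add: weyl_int_half_line)
qed

text \<open>The fundamental theorem of calculus on (t, \<infinity>), with decay at infinity. Only
  the right limit at t enters, so the endpoint t = 0 is included.\<close>

lemma weyl_int_one:
  assumes t: "0 \<le> t"
  shows "weyl_int 1 (D (Suc m)) t = - D m t"
proof -
  have "integrable half_line (\<lambda>u. complex_of_real (u powr (1 - 1)) * D (Suc m) (t + u))"
    using t by (intro integrable_weyl) auto
  moreover have "AE u in half_line. complex_of_real (u powr (1 - 1)) * D (Suc m) (t + u) = D (Suc m) (t + u)"
    by (rule AE_half_lineI) simp
  ultimately have "integrable half_line (\<lambda>u. D (Suc m) (t + u))"
    using integrable_cong_AE_imp[of half_line _ "\<lambda>u. D (Suc m) (t + u)"] by auto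
  then have "integrable lborel (\<lambda>u. indicator {t<..} (t + 1 * u) *\<^sub>R D (Suc m) (t + 1 * u))"
    by (simp add: integrable_half_line_iff set_integrable_def indicator_def)
  then have int: "set_integrable lborel {t<..} (D (Suc m))"
    unfolding set_integrable_def by (subst (asm) lborel_integrable_real_affine_iff) auto
  have "(LBINT x=ereal t..\<infinity>. D (Suc m) x) = 0 - D m t"
  proof (rule interval_integral_FTC_integrable)
    show "((D m \<circ> real_of_ereal) \<longlongrightarrow> D m t) (at_right (ereal t))"
    proof -
      have "(D m \<longlongrightarrow> D m t) (at t within {0..})"
        using continuous_D[of m] t by (auto simp: continuous_on_def)
      then have "(D m \<longlongrightarrow> D m t) (at_right t)"
        using t by (rule_tac tendsto_within_subset) auto
      then show ?thesis by (simp add: at_right_ereal filterlim_filtermap o_def)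
    qed
    show "((D m \<circ> real_of_ereal) \<longlongrightarrow> 0) (at_left \<infinity>)"
    proof -
      obtain C where C: "\<And>t. 0 \<le> t \<Longrightarrow> norm (D m t) \<le> C * (1 + t) powr (- 1)"
        using decay_powr[of m 1] by blast
      have "(D m \<longlongrightarrow> 0) at_top"
      proof (rule Lim_null_comparison)
        show "\<forall>\<^sub>F t in at_top. norm (D m t) \<le> C * (1 + t) powr (- 1)"
          using eventually_ge_at_top[of 0] by eventually_elim (rule C)
        have "((\<lambda>t::real. (1 + t) powr (- 1)) \<longlongrightarrow> 0) at_top"
          by (intro tendsto_neg_powr filterlim_tendsto_add_at_top[OF tendsto_const filterlim_ident]) auto
        then show "((\<lambda>t. C * (1 + t) powr (- 1)) \<longlongrightarrow> 0) at_top"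
          by (rule tendsto_mult_right_zero)
      qed
      then show ?thesis by (simp add: at_left_PInf filterlim_filtermap o_def)
    qed
    show "set_integrable lborel (einterval (ereal t) \<infinity>) (D (Suc m))"
      using int by simp
  qed (use t in \<open>auto intro: deriv_at isCont_D\<close>)
  then have "(LINT s:{t<..}|lborel. D (Suc m) s) = - D m t"
    by (simp add: interval_lebesgue_integral_def)
  moreover have "(LINT s:{t<..}|lborel. complex_of_real ((s - t) powr (1 - 1)) * D (Suc m) s) = (LINT s:{t<..}|lborel. D (Suc m) s)"
    by (intro set_lebesgue_integral_cong) auto
  ultimately show ?thesis by (simp add: weyl_int_def)
qed

lemma weyl_int_inverts_derivative:
  assumes "0 \<le> t"
  shows "weyl_int (real (Suc n)) (D (Suc n)) t = (-1) ^ Suc n * D 0 t"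
proof (induction n)
  case 0
  show ?case using weyl_int_one[OF assms, of 0] by simp
next
  case (Suc n)
  have "weyl_int (real (Suc (Suc n))) (D (Suc (Suc n))) t = weyl_int (real (Suc n)) (weyl_int 1 (D (Suc (Suc n)))) t"
    using weyl_int_semigroup[of "real (Suc n)" 1 t "Suc (Suc n)"] assms by (simp add: add.commute)
  also have "\<dots> = weyl_int (real (Suc n)) (\<lambda>s. (-1) * D (Suc n) s) t"
    using assms by (intro weyl_int_cong) (simp add: weyl_int_one)
  also have "\<dots> = (-1) * weyl_int (real (Suc n)) (D (Suc n)) t"
    by (rule weyl_int_cmult)
  finally show ?case using Suc by simp
qed

lemma weyl_deriv_eq:
  assumes "0 < \<alpha>" "0 < t" "\<And>t. 0 \<le> t \<Longrightarrow> f t = D 0 t"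
  shows "weyl_deriv \<alpha> f t = (-1) ^ (nat \<lfloor>\<alpha>\<rfloor> + 1) * weyl_int (real (nat \<lfloor>\<alpha>\<rfloor> + 1) - \<alpha>) (D (nat \<lfloor>\<alpha>\<rfloor> + 1)) t"
proof -
  have "0 < real (nat \<lfloor>\<alpha>\<rfloor> + 1) - \<alpha>" using assms(1) by linarith
  then show ?thesis
    using vderiv_iter_weyl_int[OF _ assms(2,3)] assms(1) by (simp add: weyl_deriv_def Let_def)
qed

text \<open>By the semigroup law the integrals of orders \<alpha> and n + 1 - \<alpha>, with n the
  integer part of \<alpha>, compose to the integral of order n + 1, which undoes n + 1 derivatives.
  The sign it produces cancels the one in the definition of the Weyl derivative.\<close>

lemma weyl_int_weyl_deriv:
  assumes "0 < \<alpha>" "0 < t" "\<And>t. 0 \<le> t \<Longrightarrow> f t = D 0 t"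
  shows "weyl_int \<alpha> (weyl_deriv \<alpha> f) t = f t"
proof -
  define n where "n = nat \<lfloor>\<alpha>\<rfloor>"
  have n: "0 < real (Suc n) - \<alpha>" using assms(1) by (simp add: n_def) linarith
  have "weyl_int \<alpha> (weyl_deriv \<alpha> f) t =
      weyl_int \<alpha> (\<lambda>s. (-1) ^ Suc n * weyl_int (real (Suc n) - \<alpha>) (D (Suc n)) s) t"
    using assms by (intro weyl_int_cong) (simp add: weyl_deriv_eq n_def)
  also have "\<dots> = (-1) ^ Suc n * weyl_int \<alpha> (weyl_int (real (Suc n) - \<alpha>) (D (Suc n))) t"
    by (rule weyl_int_cmult)
  also have "\<dots> = (-1) ^ Suc n * weyl_int (real (Suc n)) (D (Suc n)) t"
    using weyl_int_semigroup[OF assms(1) n] assms(2) by simp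
  also have "\<dots> = (-1) ^ Suc n * ((-1) ^ Suc n * D 0 t)"
    using assms(2) by (subst weyl_int_inverts_derivative) auto
  also have "\<dots> = f t"
    using assms(2,3) by (simp flip: mult.assoc power_add power2_eq_square power_mult)
  finally show ?thesis .
qed

end

lemma schwartz_plus_family:
  assumes "f \<in> schwartz_plus"
  obtains D where "schwartz_family D" "\<And>t. 0 \<le> t \<Longrightarrow> f t = D 0 t"
proof -
  obtain D where D: "\<And>t. 0 \<le> t \<Longrightarrow> D 0 t = f t"
    "\<And>m t. 0 \<le> t \<Longrightarrow> (D m has_vector_derivative D (Suc m) t) (at t within {0..})"
    "\<And>n m. \<exists>C. \<forall>t\<ge>0. (1 + t) ^ n * norm (D m t) \<le> C"
    using assms unfolding schwartz_plus_def by blast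
  define E where "E m t = (if 0 \<le> t then D m t else 0)" for m t
  have "schwartz_family E"
  proof
    fix m and t :: real assume "0 \<le> t"
    then show "(E m has_vector_derivative E (Suc m) t) (at t within {0..})"
      using has_vector_derivative_transform[OF _ _ D(2)[of t m], of "E m"] by (simp add: E_def)
  next
    fix n m
    show "\<exists>C. \<forall>t\<ge>0. (1 + t) ^ n * norm (E m t) \<le> C"
      using D(3)[of n m] by (simp add: E_def)
  qed (simp add: E_def)
  moreover have "f t = E 0 t" if "0 \<le> t" for t using that D(1) by (simp add: E_def)
  ultimately show thesis using that by blast
qed

section \<open>Exponential sums\<close>

lemma
  assumes "0 < \<gamma>" "0 < c"
  shows nn_integral_Gamma: "(\<integral>\<^sup>+u. ennreal (u powr (\<gamma> - 1) * exp (- c * u)) \<partial>half_line) = ennreal (Gamma \<gamma> * c powr (- \<gamma>))"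
    and integrable_Gamma: "integrable half_line (\<lambda>u. u powr (\<gamma> - 1) * exp (- c * u))"
    and integral_Gamma: "(LINT u|half_line. u powr (\<gamma> - 1) * exp (- c * u)) = Gamma \<gamma> * c powr (- \<gamma>)"
proof -
  have G: "0 \<le> Gamma \<gamma>" using Gamma_real_pos[OF assms(1)] by simp
  have "ennreal (Gamma \<gamma>) = (\<integral>\<^sup>+u. ennreal (u powr (\<gamma> - 1) * exp (- u)) \<partial>half_line)"
    unfolding Gamma_conv_nn_integral_real[OF assms(1)]
    by (subst nn_integral_half_line) (auto intro!: nn_integral_cong simp: indicator_def exp_minus field_simps)
  also have "\<dots> = ennreal c * (\<integral>\<^sup>+u. ennreal ((c * u) powr (\<gamma> - 1) * exp (- (c * u))) \<partial>half_line)"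
    using assms(2) by (intro nn_integral_half_line_dilate) auto
  also have "(\<integral>\<^sup>+u. ennreal ((c * u) powr (\<gamma> - 1) * exp (- (c * u))) \<partial>half_line) =
      (\<integral>\<^sup>+u. ennreal (c powr (\<gamma> - 1)) * ennreal (u powr (\<gamma> - 1) * exp (- c * u)) \<partial>half_line)"
    using assms(2) by (intro nn_integral_half_line_cong) (auto simp: powr_mult ennreal_mult[symmetric] mult.assoc)
  also have "ennreal c * \<dots> = ennreal (c powr \<gamma>) * (\<integral>\<^sup>+u. ennreal (u powr (\<gamma> - 1) * exp (- c * u)) \<partial>half_line)"
    using assms(2) by (subst nn_integral_cmult)
      (auto simp: mult.assoc[symmetric] ennreal_mult[symmetric] powr_diff)
  finally have eq: "ennreal (Gamma \<gamma>) = ennreal (c powr \<gamma>) * (\<integral>\<^sup>+u. ennreal (u powr (\<gamma> - 1) * exp (- c * u)) \<partial>half_line)" .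
  have "ennreal (c powr (- \<gamma>)) * ennreal (Gamma \<gamma>) =
      ennreal (c powr (- \<gamma>) * c powr \<gamma>) * (\<integral>\<^sup>+u. ennreal (u powr (\<gamma> - 1) * exp (- c * u)) \<partial>half_line)"
    unfolding eq by (simp add: ennreal_mult mult.assoc)
  also have "c powr (- \<gamma>) * c powr \<gamma> = 1"
    using assms(2) by (simp add: powr_add[symmetric])
  finally show nn: "(\<integral>\<^sup>+u. ennreal (u powr (\<gamma> - 1) * exp (- c * u)) \<partial>half_line) = ennreal (Gamma \<gamma> * c powr (- \<gamma>))"
    using G by (simp add: ennreal_mult[symmetric] mult.commute)
  show "integrable half_line (\<lambda>u. u powr (\<gamma> - 1) * exp (- c * u))"
    using nn by (simp add: integrable_iff_bounded abs_mult)
  show "(LINT u|half_line. u powr (\<gamma> - 1) * exp (- c * u)) = Gamma \<gamma> * c powr (- \<gamma>)"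
    using nn G by (subst integral_eq_nn_integral) auto
qed

text \<open>The frequencies are \<open>Suc j\<close>, hence at least 1: these are the polynomials in
  exp (-t) without constant term, which decay exponentially.\<close>

definition exp_sum :: "nat \<Rightarrow> (nat \<Rightarrow> complex) \<Rightarrow> real \<Rightarrow> complex" where
  "exp_sum N c t = (\<Sum>j<N. c j * complex_of_real (exp (- real (Suc j) * t)))"

lemma exp_sum_measurable [measurable]: "exp_sum N c \<in> borel_measurable borel"
  unfolding exp_sum_def[abs_def] by measurable

lemma exp_sum_deriv:
  "(exp_sum N c has_vector_derivative exp_sum N (\<lambda>j. - of_nat (Suc j) * c j) t) (at t within S)"
proof -
  have "((\<lambda>t. complex_of_real (exp (- real (Suc j) * t))) has_vector_derivative
      complex_of_real (- real (Suc j) * exp (- real (Suc j) * t))) (at t within S)" for j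
    by (intro has_vector_derivative_of_real) (auto intro!: derivative_eq_intros simp flip: has_real_derivative_iff_has_vector_derivative)
  then have "((\<lambda>t. \<Sum>j<N. c j * complex_of_real (exp (- real (Suc j) * t))) has_vector_derivative
      (\<Sum>j<N. c j * complex_of_real (- real (Suc j) * exp (- real (Suc j) * t)))) (at t within S)"
    by (intro has_vector_derivative_sum has_vector_derivative_mult_right)
  then show ?thesis
    by (simp add: exp_sum_def[abs_def] mult_ac)
qed

lemma exp_sum_decay: "\<exists>C. \<forall>t\<ge>0. (1 + t) ^ n * norm (exp_sum N c t) \<le> C"
proof (intro exI allI impI)
  fix t :: real assume t: "0 \<le> t"
  \<comment> \<open>The exponent is divided by n + 1 so that the n-th power still grows at most like
    exp t.\<close>
  have "1 + t \<le> real (Suc n) * exp (t / real (Suc n))"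
  proof -
    have "1 + t \<le> real (Suc n) * (1 + t / real (Suc n))" by (simp add: field_simps)
    also have "\<dots> \<le> real (Suc n) * exp (t / real (Suc n))"
      by (intro mult_left_mono exp_ge_add_one_self) auto
    finally show ?thesis .
  qed
  then have "(1 + t) ^ n \<le> (real (Suc n) * exp (t / real (Suc n))) ^ n"
    using t by (intro power_mono) auto
  also have "\<dots> = real (Suc n) ^ n * exp (real n * (t / real (Suc n)))"
    by (simp only: power_mult_distrib exp_of_nat_mult)
  also have "\<dots> \<le> real (Suc n) ^ n * exp t"
    using t by (intro mult_left_mono) (auto simp: field_simps)
  finally have pw: "(1 + t) ^ n \<le> real (Suc n) ^ n * exp t" .
  have "norm (exp_sum N c t) \<le> (\<Sum>j<N. norm (c j) * exp (- real (Suc j) * t))"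
    unfolding exp_sum_def by (rule sum_norm_le) (simp add: norm_mult)
  also have "\<dots> \<le> (\<Sum>j<N. norm (c j) * exp (- t))"
    using t by (intro sum_mono mult_left_mono) (auto simp: algebra_simps)
  also have "\<dots> = (\<Sum>j<N. norm (c j)) * exp (- t)"
    by (simp add: sum_distrib_right)
  finally have "(1 + t) ^ n * norm (exp_sum N c t) \<le> (real (Suc n) ^ n * exp t) * ((\<Sum>j<N. norm (c j)) * exp (- t))"
    using pw t by (intro mult_mono) auto
  also have "\<dots> = real (Suc n) ^ n * (\<Sum>j<N. norm (c j))"
    by (simp add: exp_minus)
  finally show "(1 + t) ^ n * norm (exp_sum N c t) \<le> real (Suc n) ^ n * (\<Sum>j<N. norm (c j))" .
qed

lemma exp_sum_family:
  "schwartz_family (\<lambda>m t. if 0 \<le> t then exp_sum N (\<lambda>j. (- of_nat (Suc j)) ^ m * c j) t else 0)"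
proof
  fix m and t :: real assume "0 \<le> t"
  then show "((\<lambda>t. if 0 \<le> t then exp_sum N (\<lambda>j. (- of_nat (Suc j)) ^ m * c j) t else 0) has_vector_derivative
      (if 0 \<le> t then exp_sum N (\<lambda>j. (- of_nat (Suc j)) ^ Suc m * c j) t else 0)) (at t within {0..})"
    using has_vector_derivative_transform[OF _ _ exp_sum_deriv[of N "\<lambda>j. (- of_nat (Suc j)) ^ m * c j" t "{0..}"]]
    by (simp add: mult.assoc)
next
  fix n m
  show "\<exists>C. \<forall>t\<ge>0. (1 + t) ^ n * norm (if 0 \<le> t then exp_sum N (\<lambda>j. (- of_nat (Suc j)) ^ m * c j) t else 0) \<le> C"
    using exp_sum_decay[of n N "\<lambda>j. (- of_nat (Suc j)) ^ m * c j"] by auto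
qed auto

lemma exp_sum_schwartz: "exp_sum N c \<in> schwartz_plus"
proof -
  interpret schwartz_family "\<lambda>m t. if 0 \<le> t then exp_sum N (\<lambda>j. (- of_nat (Suc j)) ^ m * c j) t else 0"
    by (rule exp_sum_family)
  show ?thesis
    unfolding schwartz_plus_def using deriv decay
    by (intro CollectI exI[of _ "\<lambda>m t. if 0 \<le> t then exp_sum N (\<lambda>j. (- of_nat (Suc j)) ^ m * c j) t else 0"]) simp
qed

lemma weyl_int_exp_sum:
  assumes "0 < \<gamma>"
  shows "weyl_int \<gamma> (exp_sum N c) t = exp_sum N (\<lambda>j. complex_of_real (real (Suc j) powr (- \<gamma>)) * c j) t"
proof -
  have G: "Gamma \<gamma> \<noteq> 0" using Gamma_real_pos[OF assms] by simp
  have "(LINT u|half_line. complex_of_real (u powr (\<gamma> - 1)) * exp_sum N c (t + u)) =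
      (LINT u|half_line. (\<Sum>j<N. (c j * complex_of_real (exp (- real (Suc j) * t))) *
        complex_of_real (u powr (\<gamma> - 1) * exp (- real (Suc j) * u))))"
  proof -
    have "exp (- real (Suc j) * (t + u)) = exp (- real (Suc j) * t) * exp (- real (Suc j) * u)" for j u
      by (simp only: distrib_left exp_add)
    then show ?thesis
      unfolding exp_sum_def sum_distrib_left
      by (intro Bochner_Integration.integral_cong sum.cong refl) (simp only: of_real_mult mult_ac)
  qed
  also have "\<dots> = (\<Sum>j<N. (c j * complex_of_real (exp (- real (Suc j) * t))) *
        complex_of_real (LINT u|half_line. u powr (\<gamma> - 1) * exp (- real (Suc j) * u)))"
    using integrable_Gamma[OF assms]
    by (subst Bochner_Integration.integral_sum) (auto intro!: integrable_mult_right integrable_of_real simp del: of_real_mult of_nat_Suc)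
  also have "\<dots> = (\<Sum>j<N. (c j * complex_of_real (exp (- real (Suc j) * t))) *
        complex_of_real (Gamma \<gamma> * real (Suc j) powr (- \<gamma>)))"
    by (intro sum.cong refl) (subst integral_Gamma[OF assms], auto)
  finally show ?thesis
    using G by (simp add: weyl_int_half_line exp_sum_def sum_divide_distrib mult_ac)
qed

lemma weyl_deriv_exp_sum:
  assumes "0 \<le> \<alpha>" "0 < t"
  shows "weyl_deriv \<alpha> (exp_sum N c) t = exp_sum N (\<lambda>j. complex_of_real (real (Suc j) powr \<alpha>) * c j) t"
proof (cases "\<alpha> = 0")
  case True
  then show ?thesis by (simp add: weyl_deriv_def)
next
  case False
  then have \<alpha>: "0 < \<alpha>" using assms by simp
  define n where "n = nat \<lfloor>\<alpha>\<rfloor> + 1"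
  have n: "0 < real n - \<alpha>" unfolding n_def using assms(1) by linarith
  interpret schwartz_family "\<lambda>m t. if 0 \<le> t then exp_sum N (\<lambda>j. (- of_nat (Suc j)) ^ m * c j) t else 0"
    by (rule exp_sum_family)
  have "weyl_deriv \<alpha> (exp_sum N c) t =
      (-1) ^ n * weyl_int (real n - \<alpha>) (\<lambda>t. if 0 \<le> t then exp_sum N (\<lambda>j. (- of_nat (Suc j)) ^ n * c j) t else 0) t"
    unfolding n_def by (rule weyl_deriv_eq[OF \<alpha> assms(2)]) simp
  also have "\<dots> = (-1) ^ n * weyl_int (real n - \<alpha>) (exp_sum N (\<lambda>j. (- of_nat (Suc j)) ^ n * c j)) t"
    using assms(2) by (intro arg_cong2[where f = "(*)"] weyl_int_cong) auto
  also have "\<dots> = (-1) ^ n * exp_sum N (\<lambda>j. complex_of_real (real (Suc j) powr (- (real n - \<alpha>))) * ((- of_nat (Suc j)) ^ n * c j)) t"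
    by (simp only: weyl_int_exp_sum[OF n])
  also have "\<dots> = exp_sum N (\<lambda>j. complex_of_real (real (Suc j) powr \<alpha>) * c j) t"
    unfolding exp_sum_def sum_distrib_left
  proof (intro sum.cong refl)
    fix j
    have "real (Suc j) ^ n * real (Suc j) powr (- (real n - \<alpha>)) = real (Suc j) powr \<alpha>"
      by (simp add: powr_realpow[symmetric] powr_add[symmetric] del: of_nat_Suc)
    moreover have "(-1) ^ n * (- of_nat (Suc j)) ^ n = complex_of_real (real (Suc j) ^ n)"
      by (simp add: add.commute flip: power_mult_distrib)
    ultimately have *: "((-1) ^ n * (- of_nat (Suc j)) ^ n) * complex_of_real (real (Suc j) powr (- (real n - \<alpha>))) =
        complex_of_real (real (Suc j) powr \<alpha>)"
      by (simp only: of_real_mult[symmetric])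
    show "(-1) ^ n * (complex_of_real (real (Suc j) powr (- (real n - \<alpha>))) * ((- of_nat (Suc j)) ^ n * c j) *
        complex_of_real (exp (- real (Suc j) * t))) =
        complex_of_real (real (Suc j) powr \<alpha>) * c j * complex_of_real (exp (- real (Suc j) * t))"
      unfolding *[symmetric] by (simp only: mult_ac)
  qed
  finally show ?thesis .
qed

lemma exp_sum_dense:
  assumes "0 \<le> \<alpha>" "1 < p" and [measurable]: "F \<in> borel_measurable borel"
    and h: "in_Lp p (\<lambda>t. complex_of_real (t powr \<alpha>) * F t)" and "0 < \<epsilon>"
  obtains N c where "(\<integral>\<^sup>+t. ennreal (norm (complex_of_real (t powr \<alpha>) * exp_sum N c t -
      complex_of_real (t powr \<alpha>) * F t) powr p) \<partial>half_line) < ennreal \<epsilon>"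
proof -
  \<comment> \<open>An exponential sum is exp (-t) times a polynomial in exp (-t). Moving this
    common factor into the measure makes the measure finite, its mass being a Gamma integral, and
    turns the target F into exp t * F.\<close>
  define \<nu> where "\<nu> = density half_line (\<lambda>t. ennreal (t powr (\<alpha> * p) * exp (- p * t)))"
  define \<theta> where "\<theta> t = (if 0 < t then exp (- t) else 0)" for t :: real
  have nu: "(\<integral>\<^sup>+t. ennreal (f t) \<partial>\<nu>) = (\<integral>\<^sup>+t. ennreal (t powr (\<alpha> * p) * exp (- p * t) * f t) \<partial>half_line)"
    if [measurable]: "f \<in> borel_measurable borel" and "\<And>t. 0 \<le> f t" for f
    unfolding \<nu>_def using that(2) by (subst nn_integral_density) (auto simp: ennreal_mult)
  interpret monotone_substitution \<nu> \<theta> "-1" p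
  proof
    show "emeasure \<nu> UNIV \<noteq> \<infinity>"
    proof -
      have "emeasure \<nu> UNIV = (\<integral>\<^sup>+t. ennreal (t powr (\<alpha> * p + 1 - 1) * exp (- p * t)) \<partial>half_line)"
        by (simp add: \<nu>_def emeasure_density)
      also have "\<dots> = ennreal (Gamma (\<alpha> * p + 1) * p powr (- (\<alpha> * p + 1)))"
        using assms by (intro nn_integral_Gamma) (auto simp: add_nonneg_pos)
      finally show ?thesis by simp
    qed
    show "AE t in \<nu>. 0 < t" unfolding \<nu>_def by (subst AE_density) (auto simp: AE_half_line)
    show "a < t \<longleftrightarrow> 0 < - 1 * (\<theta> t - \<theta> a)" if "0 < a" "0 < t" for a t
      using that by (auto simp: \<theta>_def)
  qed (use assms in \<open>auto simp: \<nu>_def \<theta>_def[abs_def]\<close>)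
  let ?g = "\<lambda>t. complex_of_real (exp t) * F t"
  have wt: "t powr (\<alpha> * p) * exp (- p * t) * norm (complex_of_real (exp t) * z) powr p = norm (complex_of_real (t powr \<alpha>) * z) powr p" for t z
    by (simp add: norm_mult powr_mult powr_powr exp_powr_real exp_minus field_simps)
  have "poly_approximable ?g"
  proof (rule poly_approximable_Lp)
    have "(\<integral>\<^sup>+t. ennreal (norm (?g t) powr p) \<partial>\<nu>) = (\<integral>\<^sup>+t. ennreal (norm (complex_of_real (t powr \<alpha>) * F t) powr p) \<partial>half_line)"
      by (subst nu) (auto simp only: wt, auto)
    then show "(\<integral>\<^sup>+t. ennreal (norm (?g t) powr p) \<partial>\<nu>) < \<infinity>"
      using h by (simp add: in_Lp_def)
  qed simp
  then obtain P where P: "(\<integral>\<^sup>+t. ennreal (norm (?g t - poly P (complex_of_real (\<theta> t))) powr p) \<partial>\<nu>) < ennreal \<epsilon>"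
    using \<open>0 < \<epsilon>\<close> by (auto simp: poly_approximable_def)
  show thesis
  proof
    have es: "complex_of_real (exp (- t)) * poly P (complex_of_real (exp (- t))) = exp_sum (Suc (degree P)) (coeff P) t" for t
    proof -
      have "exp (- real (Suc j) * t) = exp (- t) * exp (- t) ^ j" for j
        by (simp add: exp_of_nat_mult[symmetric] exp_add[symmetric] algebra_simps)
      then show ?thesis
        by (simp add: poly_altdef exp_sum_def sum_distrib_left lessThan_Suc_atMost mult_ac)
    qed
    have "(\<integral>\<^sup>+t. ennreal (norm (?g t - poly P (complex_of_real (\<theta> t))) powr p) \<partial>\<nu>) =
        (\<integral>\<^sup>+t. ennreal (t powr (\<alpha> * p) * exp (- p * t) * norm (?g t - poly P (complex_of_real (\<theta> t))) powr p) \<partial>half_line)"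
      by (rule nu) auto
    also have "\<dots> = (\<integral>\<^sup>+t. ennreal (norm (complex_of_real (t powr \<alpha>) * exp_sum (Suc (degree P)) (coeff P) t -
      complex_of_real (t powr \<alpha>) * F t) powr p) \<partial>half_line)"
    proof (intro nn_integral_half_line_cong)
      fix t :: real assume t: "0 < t"
      have "?g t - poly P (complex_of_real (\<theta> t)) = complex_of_real (exp t) * (F t - exp_sum (Suc (degree P)) (coeff P) t)"
        using t unfolding es[symmetric] by (simp add: \<theta>_def right_diff_distrib exp_minus flip: mult.assoc of_real_mult)
      then have "t powr (\<alpha> * p) * exp (- p * t) * norm (?g t - poly P (complex_of_real (\<theta> t))) powr p =
          norm (complex_of_real (t powr \<alpha>) * (F t - exp_sum (Suc (degree P)) (coeff P) t)) powr p"
        by (simp only: wt)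
      then show "ennreal (t powr (\<alpha> * p) * exp (- p * t) * norm (?g t - poly P (complex_of_real (\<theta> t))) powr p) =
        ennreal (norm (complex_of_real (t powr \<alpha>) * exp_sum (Suc (degree P)) (coeff P) t - complex_of_real (t powr \<alpha>) * F t) powr p)"
        by (simp add: right_diff_distrib norm_minus_commute)
    qed
    finally show "(\<integral>\<^sup>+t. ennreal (norm (complex_of_real (t powr \<alpha>) * exp_sum (Suc (degree P)) (coeff P) t -
      complex_of_real (t powr \<alpha>) * F t) powr p) \<partial>half_line) < ennreal \<epsilon>"
      using P by simp
  qed
qed

section \<open>Injectivity of the dual Cesaro operator\<close>

lemma Gamma_real_plus1: "0 < x \<Longrightarrow> Gamma (x + 1) = x * Gamma (x::real)"
  by (rule Gamma_plus1) (auto elim!: nonpos_Ints_cases)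

lemma Gamma_real_nonzero: "0 < x \<Longrightarrow> Gamma (x::real) \<noteq> 0"
  using Gamma_real_pos[of x] by linarith

text \<open>Inversion gives the Gamma integral with parameter a * q - 1, whence the condition on a *
  q: the exponential controls the origin, the power controls infinity.\<close>

lemma in_Lp_powr_exp_inverse:
  assumes "0 < a" "0 < c" "1 < a * q"
  shows "in_Lp q (\<lambda>s. complex_of_real (s powr (- a) * exp (- c / s)))"
proof -
  have q: "0 < q" using assms by (metis zero_less_mult_pos zero_less_one order_less_trans)
  have "(\<integral>\<^sup>+s. ennreal (norm (complex_of_real (s powr (- a) * exp (- c / s))) powr q) \<partial>half_line) =
      (\<integral>\<^sup>+x. ennreal (1 / x\<^sup>2) * ennreal (norm (complex_of_real ((1 / x) powr (- a) * exp (- c / (1 / x)))) powr q) \<partial>half_line)"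
    by (rule nn_integral_half_line_inverse) simp
  also have "\<dots> = (\<integral>\<^sup>+x. ennreal (x powr (a * q - 1 - 1) * exp (- (c * q) * x)) \<partial>half_line)"
  proof (rule nn_integral_half_line_cong)
    fix x :: real assume x: "0 < x"
    have "norm (complex_of_real ((1 / x) powr (- a) * exp (- c / (1 / x)))) powr q = x powr (a * q) * exp (- (c * q) * x)"
      using x by (simp add: norm_mult powr_mult powr_powr powr_divide powr_minus exp_powr_real mult_ac)
    moreover have "x powr (a * q - 1 - 1) = 1 / x\<^sup>2 * x powr (a * q)"
      using x by (simp add: powr_diff power2_eq_square)
    ultimately show "ennreal (1 / x\<^sup>2) * ennreal (norm (complex_of_real ((1 / x) powr (- a) * exp (- c / (1 / x)))) powr q) =
        ennreal (x powr (a * q - 1 - 1) * exp (- (c * q) * x))"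
      using x by (simp add: ennreal_mult[symmetric] mult.assoc)
  qed
  also have "\<dots> = ennreal (Gamma (a * q - 1) * (c * q) powr (- (a * q - 1)))"
    using assms q by (intro nn_integral_Gamma) auto
  finally show ?thesis by (simp add: in_Lp_def)
qed

text \<open>Under \<open>s \<mapsto> 1 / s\<close> the Cesaro operator becomes a Weyl integral, for which exponentials
  are eigenfunctions.\<close>
lemma cesaro_powr_exp_inverse:
  assumes \<alpha>: "0 < \<alpha>" and c: "0 < c" and t: "0 < t"
  shows "cesaro \<alpha> (\<lambda>s. complex_of_real (s powr (- (\<alpha> + 1)) * exp (- c / s))) t =
    complex_of_real (Gamma (\<alpha> + 1) * c powr (- \<alpha>) * (t powr (- 1) * exp (- c / t)))"
proof -
  have "(\<integral>\<^sup>+s. ennreal (cesaro_kernel \<alpha> t s * (s powr (- (\<alpha> + 1)) * exp (- c / s))) \<partial>half_line) =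
    (\<integral>\<^sup>+x. ennreal (1 / x\<^sup>2) * ennreal (cesaro_kernel \<alpha> t (1 / x) * ((1 / x) powr (- (\<alpha> + 1)) * exp (- c / (1 / x)))) \<partial>half_line)"
    by (rule nn_integral_half_line_inverse) simp
  also have "\<dots> = (\<integral>\<^sup>+x. indicator {0<..} x * (ennreal (1 / x\<^sup>2) * ennreal (cesaro_kernel \<alpha> t (1 / x) * ((1 / x) powr (- (\<alpha> + 1)) * exp (- c / (1 / x))))) \<partial>lborel)"
    by (rule nn_integral_half_line) simp
  also have "\<dots> = (\<integral>\<^sup>+x. indicator {1 / t<..} x * ennreal (\<alpha> / t * ((x - 1 / t) powr (\<alpha> - 1) * exp (- c * x))) \<partial>lborel)"
  proof (rule nn_integral_cong)
    fix x :: real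
    show "indicator {0<..} x * (ennreal (1 / x\<^sup>2) * ennreal (cesaro_kernel \<alpha> t (1 / x) * ((1 / x) powr (- (\<alpha> + 1)) * exp (- c / (1 / x))))) =
      indicator {1 / t<..} x * ennreal (\<alpha> / t * ((x - 1 / t) powr (\<alpha> - 1) * exp (- c * x)))"
    proof (cases "1 / t < x")
      case True
      then have x: "0 < x" using t by (meson divide_pos_pos less_trans zero_less_one)
      have lt: "1 / x < t" using True x t by (simp add: field_simps)
      have "t - 1 / x = (t / x) * (x - 1 / t)" using x t by (simp add: field_simps)
      then have "(t - 1 / x) powr (\<alpha> - 1) = t powr (\<alpha> - 1) / x powr (\<alpha> - 1) * (x - 1 / t) powr (\<alpha> - 1)"
        using True x t by (simp add: powr_mult powr_divide)
      moreover have "(1 / x) powr (- (\<alpha> + 1)) = x powr (\<alpha> - 1) * x\<^sup>2"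
        using x by (simp add: powr_divide powr_minus powr_add powr_diff power2_eq_square field_simps)
      moreover have "t powr (\<alpha> - 1) / t powr \<alpha> = 1 / t"
        using t by (simp add: powr_diff)
      ultimately have "1 / x\<^sup>2 * (cesaro_kernel \<alpha> t (1 / x) * ((1 / x) powr (- (\<alpha> + 1)) * exp (- c / (1 / x)))) =
          \<alpha> / t * ((x - 1 / t) powr (\<alpha> - 1) * exp (- c * x))"
        using x t lt by (simp add: cesaro_kernel_def field_simps)
      then show ?thesis
        using True x \<alpha> by (simp add: ennreal_mult[symmetric] cesaro_kernel_nonneg)
    next
      case False
      then have "0 < x \<Longrightarrow> t \<le> 1 / x" using t by (simp add: field_simps)
      then show ?thesis
        using False by (auto simp: indicator_def cesaro_kernel_def)
    qed
  qed
  also have "\<dots> = (\<integral>\<^sup>+v. ennreal (\<alpha> / t * ((1 / t + v - 1 / t) powr (\<alpha> - 1) * exp (- c * (1 / t + v)))) \<partial>half_line)"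
    by (rule nn_integral_half_line_translate[symmetric]) simp
  also have "\<dots> = (\<integral>\<^sup>+v. ennreal (\<alpha> / t * exp (- c / t)) * ennreal (v powr (\<alpha> - 1) * exp (- c * v)) \<partial>half_line)"
  proof (intro nn_integral_cong)
    fix v
    have "exp (- c * (1 / t + v)) = exp (- c / t) * exp (- c * v)"
      by (simp add: distrib_left exp_add[symmetric])
    then show "ennreal (\<alpha> / t * ((1 / t + v - 1 / t) powr (\<alpha> - 1) * exp (- c * (1 / t + v)))) =
        ennreal (\<alpha> / t * exp (- c / t)) * ennreal (v powr (\<alpha> - 1) * exp (- c * v))"
      using \<alpha> t by (simp add: ennreal_mult[symmetric] mult_ac)
  qed
  also have "\<dots> = ennreal (\<alpha> / t * exp (- c / t)) * ennreal (Gamma \<alpha> * c powr (- \<alpha>))"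
    by (subst nn_integral_cmult) (simp_all add: nn_integral_Gamma[OF \<alpha> c, simplified])
  also have "\<dots> = ennreal (Gamma (\<alpha> + 1) * c powr (- \<alpha>) * (t powr (- 1) * exp (- c / t)))"
    using \<alpha> t Gamma_real_plus1[OF \<alpha>]
    by (simp add: ennreal_mult[symmetric] less_imp_le[OF Gamma_real_pos] powr_minus field_simps)
  finally have nn: "(\<integral>\<^sup>+s. ennreal (cesaro_kernel \<alpha> t s * (s powr (- (\<alpha> + 1)) * exp (- c / s))) \<partial>half_line) =
      ennreal (Gamma (\<alpha> + 1) * c powr (- \<alpha>) * (t powr (- 1) * exp (- c / t)))" .
  have "cesaro \<alpha> (\<lambda>s. complex_of_real (s powr (- (\<alpha> + 1)) * exp (- c / s))) t =
      complex_of_real (LINT s|half_line. cesaro_kernel \<alpha> t s * (s powr (- (\<alpha> + 1)) * exp (- c / s)))"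
    by (subst cesaro_half_line) (simp_all flip: integral_complex_of_real)
  also have "(LINT s|half_line. cesaro_kernel \<alpha> t s * (s powr (- (\<alpha> + 1)) * exp (- c / s))) =
      Gamma (\<alpha> + 1) * c powr (- \<alpha>) * (t powr (- 1) * exp (- c / t))"
    using \<alpha> nn Gamma_real_pos[of "\<alpha> + 1"]
    by (subst integral_eq_nn_integral) (auto simp: cesaro_kernel_nonneg)
  finally show ?thesis .
qed

text \<open>By density, the polynomials in \<open>\<theta>\<close> approximate the phase of \<open>cnj Q\<close> in \<open>L\<^sup>1(\<bar>Q\<bar>)\<close>.\<close>
lemma moments_zero_imp_zero:
  fixes Q :: "real \<Rightarrow> complex"
  assumes Q: "integrable half_line Q"
    and [measurable]: "\<theta> \<in> borel_measurable borel" and \<theta>: "\<And>t. \<theta> t \<in> {0..1}"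
    and mono: "\<And>a t. 0 < a \<Longrightarrow> 0 < t \<Longrightarrow> a < t \<longleftrightarrow> 0 < \<sigma> * (\<theta> t - \<theta> a)"
    and zero: "\<And>n. (LINT t|half_line. Q t * complex_of_real (\<theta> t ^ n)) = 0"
  shows "AE t in half_line. Q t = 0"
proof -
  have [measurable]: "Q \<in> borel_measurable borel"
    using borel_measurable_integrable[OF Q] by simp
  define \<nu> where "\<nu> = density half_line (\<lambda>t. ennreal (norm (Q t)))"
  \<comment> \<open>Density is used in the L^1 space of the finite measure with density norm Q,
    where the bounded phase certainly lies.\<close>
  interpret monotone_substitution \<nu> \<theta> \<sigma> 1
  proof
    show "emeasure \<nu> UNIV \<noteq> \<infinity>"
      using Q by (simp add: \<nu>_def emeasure_density integrable_iff_bounded)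
    show "AE t in \<nu>. 0 < t" unfolding \<nu>_def by (subst AE_density) (auto simp: AE_half_line)
  qed (use assms in \<open>auto simp: \<nu>_def\<close>)
  have bdd: "integrable half_line (\<lambda>t. Q t * b t)" if [measurable]: "b \<in> borel_measurable borel" and "\<And>t. norm (b t) \<le> B" for b B
  proof (rule Bochner_Integration.integrable_bound[of _ "\<lambda>t. B * norm (Q t)"])
    show "AE t in half_line. norm (Q t * b t) \<le> norm (B * norm (Q t))"
    proof (rule AE_I2)
      fix t
      have "norm (Q t) * norm (b t) \<le> norm (Q t) * B" by (intro mult_left_mono that(2)) simp
      moreover have "0 \<le> B" using that(2)[of t] by (rule order_trans[OF norm_ge_zero])
      ultimately show "norm (Q t * b t) \<le> norm (B * norm (Q t))" by (simp add: norm_mult abs_mult mult_ac)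
    qed
  qed (use Q in auto)
  define g where "g t = cnj (sgn (Q t))" for t
  have [measurable]: "cnj \<in> borel_measurable borel"
    by (intro borel_measurable_continuous_onI continuous_on_cnj continuous_on_id)
  have [measurable]: "g \<in> borel_measurable borel" unfolding g_def[abs_def] sgn_div_norm by measurable
  have g1: "norm (g t) \<le> 1" for t by (simp add: g_def norm_sgn)
  have Qg: "Q t * g t = complex_of_real (norm (Q t))" for t
    by (cases "Q t = 0") (auto simp: g_def sgn_div_norm scaleR_conv_of_real complex_norm_square[symmetric] power2_eq_square field_simps)
  have "poly_approximable g"
  proof (rule poly_approximable_Lp)
    have "(\<integral>\<^sup>+t. ennreal (norm (g t) powr 1) \<partial>\<nu>) \<le> (\<integral>\<^sup>+t. 1 \<partial>\<nu>)"
      using g1 by (intro nn_integral_mono) simp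
    also have "\<dots> < \<infinity>" using finite by (simp add: top.not_eq_extremum)
    finally show "(\<integral>\<^sup>+t. ennreal (norm (g t) powr 1) \<partial>\<nu>) < \<infinity>" .
  qed simp
  have "(LINT t|half_line. norm (Q t)) \<le> \<epsilon>" if \<epsilon>: "0 < \<epsilon>" for \<epsilon>
  proof -
    obtain P where P: "(\<integral>\<^sup>+t. ennreal (norm (g t - poly P (complex_of_real (\<theta> t))) powr 1) \<partial>\<nu>) < ennreal \<epsilon>"
      using \<open>poly_approximable g\<close> \<epsilon> unfolding poly_approximable_def by blast
    let ?P = "\<lambda>t. poly P (complex_of_real (\<theta> t))"
    have iterm: "integrable half_line (\<lambda>t. Q t * complex_of_real (\<theta> t ^ j))" for j
      using \<theta> by (intro bdd[where B = 1]) (auto simp: norm_power power_le_one)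
    have QP: "(LINT t|half_line. Q t * ?P t) = 0" "integrable half_line (\<lambda>t. Q t * ?P t)"
    proof -
      have eq: "(\<lambda>t. Q t * ?P t) = (\<lambda>t. \<Sum>j\<le>degree P. coeff P j * (Q t * complex_of_real (\<theta> t ^ j)))"
        by (simp add: poly_altdef sum_distrib_left mult_ac)
      show "integrable half_line (\<lambda>t. Q t * ?P t)"
        unfolding eq by (intro Bochner_Integration.integrable_sum integrable_mult_right iterm)
      show "(LINT t|half_line. Q t * ?P t) = 0"
        unfolding eq using iterm zero
        by (subst Bochner_Integration.integral_sum) (auto intro!: integrable_mult_right simp del: of_real_power)
    qed
    have Qgi: "integrable half_line (\<lambda>t. Q t * g t)" using bdd[OF _ g1] by simp
    have "complex_of_real (LINT t|half_line. norm (Q t)) = (LINT t|half_line. Q t * g t)"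
      by (simp add: Qg)
    \<comment> \<open>All moments of Q vanish, so any polynomial in \<theta> may be subtracted from
      the phase without changing the integral.\<close>
    also have "\<dots> = (LINT t|half_line. Q t * (g t - ?P t))"
      using QP Qgi by (simp add: right_diff_distrib)
    finally have le: "norm (complex_of_real (LINT t|half_line. norm (Q t))) \<le> (LINT t|half_line. norm (Q t * (g t - ?P t)))"
      using integral_norm_bound[of half_line "\<lambda>t. Q t * (g t - ?P t)"] by simp
    have "(LINT t|half_line. norm (Q t)) \<le> norm (complex_of_real (LINT t|half_line. norm (Q t)))"
      by (subst norm_of_real) (rule abs_ge_self)
    from order_trans[OF this le]
    have "ennreal (LINT t|half_line. norm (Q t)) \<le> ennreal (LINT t|half_line. norm (Q t * (g t - ?P t)))"
      by (rule ennreal_leI)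
    also have "\<dots> = (\<integral>\<^sup>+t. ennreal (norm (Q t * (g t - ?P t))) \<partial>half_line)"
      using QP Qgi by (intro nn_integral_eq_integral[symmetric]) (auto simp: right_diff_distrib)
    also have "\<dots> = (\<integral>\<^sup>+t. ennreal (norm (g t - ?P t) powr 1) \<partial>\<nu>)"
      unfolding \<nu>_def by (subst nn_integral_density) (auto simp: norm_mult ennreal_mult)
    also note P
    finally show ?thesis using \<epsilon> by (simp add: ennreal_less_iff Bochner_Integration.integral_nonneg less_imp_le)
  qed
  then have "(LINT t|half_line. norm (Q t)) \<le> 0" by (rule field_le_epsilon[of _ 0, simplified])
  then have "(LINT t|half_line. norm (Q t)) = 0"
    by (intro antisym Bochner_Integration.integral_nonneg) auto
  then show ?thesis
    using Q by (subst (asm) integral_nonneg_eq_0_iff_AE) auto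
qed

text \<open>Testing the vanishing image against s^(-\<alpha>-1) exp (-(n+1) / s) and moving the
  operator to the test function gives the n-th moment of one fixed integrable function Q, up to a
  nonzero factor.\<close>

lemma cesaro_dual_injective:
  assumes p: "1 < p" and \<alpha>: "0 < \<alpha>" and k: "in_Lp p k" and zero: "AE t in half_line. cesaro_dual \<alpha> k t = 0"
  shows "AE t in half_line. k t = 0"
proof -
  define q where "q = p / (p - 1)"
  have q: "1 < q" "1 / q + 1 / p = 1" using p by (auto simp: q_def field_simps)
  have [measurable]: "k \<in> borel_measurable borel" using k by (simp add: in_Lp_def)
  define \<theta> where "\<theta> t = (if 0 < t then exp (- 1 / t) else 0)" for t :: real
  define Q where "Q t = complex_of_real (t powr (- 1) * exp (- 1 / t)) * k t" for t
  have "AE t in half_line. Q t = 0"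
  proof (rule moments_zero_imp_zero[where \<theta> = \<theta> and \<sigma> = 1])
    show "integrable half_line Q"
      unfolding Q_def[abs_def] using q p by (intro in_Lp_mult_integrable[OF q(1) p q(2)] in_Lp_powr_exp_inverse k) auto
    show "\<theta> \<in> borel_measurable borel" by (simp add: \<theta>_def[abs_def])
    show "\<theta> t \<in> {0..1}" for t by (auto simp: \<theta>_def)
    show "a < t \<longleftrightarrow> 0 < 1 * (\<theta> t - \<theta> a)" if "0 < a" "0 < t" for a t
      using that by (auto simp: \<theta>_def field_simps)
    fix n
    \<comment> \<open>Rate n + 1 rather than n: one factor exp (-1 / t) belongs to Q and makes it
      integrable, the other n factors form the n-th power of \<theta>.\<close>
    let ?r = "\<lambda>s. complex_of_real (s powr (- (\<alpha> + 1)) * exp (- real (Suc n) / s))"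
    let ?C = "complex_of_real (Gamma (\<alpha> + 1) * real (Suc n) powr (- \<alpha>))"
    have r: "in_Lp q ?r"
      using \<alpha> q by (intro in_Lp_powr_exp_inverse) (auto intro: less_1_mult)
    have "(LINT t|half_line. ?C * (Q t * complex_of_real (\<theta> t ^ n))) = (LINT t|half_line. cesaro \<alpha> ?r t * k t)"
    proof (rule integral_half_line_cong)
      fix t :: real assume t: "0 < t"
      have "exp (- real (Suc n) / t) = exp (- 1 / t) * exp (- 1 / t) ^ n"
      proof -
        have "- real (Suc n) / t = - 1 / t + real n * (- 1 / t)" using t by (simp add: field_simps)
        then show ?thesis by (simp only: exp_add exp_of_nat_mult)
      qed
      then show "?C * (Q t * complex_of_real (\<theta> t ^ n)) = cesaro \<alpha> ?r t * k t"
        using t by (subst cesaro_powr_exp_inverse[OF \<alpha> _ t]) (simp_all add: Q_def \<theta>_def mult_ac)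
    qed (auto simp: Q_def[abs_def] \<theta>_def)
    also have "\<dots> = (LINT s|half_line. ?r s * cesaro_dual \<alpha> k s)"
      by (rule cesaro_duality[OF q(1) p q(2) r k \<alpha>])
    also have "\<dots> = (LINT s|half_line. 0)"
      by (intro integral_cong_AE) (use zero in auto)
    finally have "?C * (LINT t|half_line. Q t * complex_of_real (\<theta> t ^ n)) = 0"
      by (simp only: integral_mult_right_zero) simp
    moreover have "?C \<noteq> 0"
      using \<alpha> by (simp add: Gamma_real_nonzero del: of_nat_Suc)
    ultimately show "(LINT t|half_line. Q t * complex_of_real (\<theta> t ^ n)) = 0"
      by (metis mult_eq_0_iff)
  qed
  then have "AE t in half_line. 0 < t \<longrightarrow> Q t = 0" by eventually_elim simp
  moreover have "AE t in half_line. 0 < t" by (simp add: AE_half_line)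
  ultimately show ?thesis
    by eventually_elim (simp add: Q_def)
qed

section \<open>Representation of the Sobolev--Lebesgue space\<close>

abbreviation weight :: "real \<Rightarrow> (real \<Rightarrow> complex) \<Rightarrow> real \<Rightarrow> complex" where
  "weight \<alpha> F \<equiv> (\<lambda>t. complex_of_real (t powr \<alpha>) * F t)"

text \<open>The operator from h = t^\<alpha> F to W^(-\<alpha>) F, parametrised by h so that its
  domain is the unweighted L^p. Order 0 is separate because \<open>cesaro_kernel 0\<close> vanishes
  identically.\<close>

definition weyl_pot :: "real \<Rightarrow> (real \<Rightarrow> complex) \<Rightarrow> real \<Rightarrow> complex" where
  "weyl_pot \<alpha> h = (if \<alpha> = 0 then h
     else (\<lambda>t. mult_conv (\<lambda>u. cesaro_kernel \<alpha> u 1) h t / complex_of_real (Gamma (\<alpha> + 1))))"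

lemma weyl_pot_measurable [measurable]:
  assumes [measurable]: "h \<in> borel_measurable borel"
  shows "weyl_pot \<alpha> h \<in> borel_measurable borel"
  unfolding weyl_pot_def by (cases "\<alpha> = 0") auto

lemma weyl_int_eq_weyl_pot:
  assumes \<alpha>: "0 < \<alpha>" and [measurable]: "F \<in> borel_measurable borel" and t: "0 < t"
  shows "weyl_int \<alpha> F t = weyl_pot \<alpha> (weight \<alpha> F) t"
proof -
  have "(LINT s:{t<..}|lborel. complex_of_real ((s - t) powr (\<alpha> - 1) / s powr \<alpha>) * weight \<alpha> F s) =
      (LINT s:{t<..}|lborel. complex_of_real ((s - t) powr (\<alpha> - 1)) * F s)"
    using t by (intro set_lebesgue_integral_cong) auto
  then have "cesaro_dual \<alpha> (weight \<alpha> F) t = complex_of_real (Gamma (\<alpha> + 1)) * weyl_int \<alpha> F t"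
    using \<alpha> by (simp add: cesaro_dual_def weyl_int_def Gamma_real_plus1 Gamma_real_nonzero)
  then show ?thesis
    using \<alpha> t by (simp add: weyl_pot_def cesaro_dual_eq_mult_conv[symmetric] Gamma_real_nonzero)
qed

lemma mult_conv_diff:
  assumes "1 < p" "in_Lp p h" "in_Lp p h'" "Lp_kernel p \<kappa>"
  shows "AE t in half_line. mult_conv \<kappa> (\<lambda>t. h t - h' t) t = mult_conv \<kappa> h t - mult_conv \<kappa> h' t"
  using mult_conv_AE_integrable[OF assms(1,2,4)] mult_conv_AE_integrable[OF assms(1,3,4)]
  by eventually_elim (simp add: mult_conv_def right_diff_distrib)

text \<open>Continuity in L^p, in the form needed to pass to limits; the size of B is
  irrelevant.\<close>

lemma weyl_pot_dist:
  assumes p: "1 < p" and \<alpha>: "0 \<le> \<alpha>"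
  obtains B where "\<And>h h'. in_Lp p h \<Longrightarrow> in_Lp p h' \<Longrightarrow>
    (\<integral>\<^sup>+t. ennreal (norm (weyl_pot \<alpha> h t - weyl_pot \<alpha> h' t) powr p) \<partial>half_line) \<le>
      ennreal B * (\<integral>\<^sup>+t. ennreal (norm (h t - h' t) powr p) \<partial>half_line)"
proof (cases "\<alpha> = 0")
  case True
  then show thesis using that[of 1] by (simp add: weyl_pot_def)
next
  case False
  then have \<alpha>: "0 < \<alpha>" using assms by simp
  let ?\<kappa> = "\<lambda>u. cesaro_kernel \<alpha> u 1"
  let ?G = "Gamma (\<alpha> + 1)"
  have G: "0 < ?G" using \<alpha> by (simp add: Gamma_real_pos)
  have ker: "Lp_kernel p ?\<kappa>" using Lp_kernel_cesaro_dual[OF \<alpha> p] by simp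
  show thesis
  proof (rule that)
    fix h h' assume h: "in_Lp p h" and h': "in_Lp p h'"
    have [measurable]: "h \<in> borel_measurable borel" "h' \<in> borel_measurable borel"
      using h h' by (auto simp: in_Lp_def)
    have "(\<integral>\<^sup>+t. ennreal (norm (weyl_pot \<alpha> h t - weyl_pot \<alpha> h' t) powr p) \<partial>half_line) =
        (\<integral>\<^sup>+t. ennreal (1 / ?G powr p) * ennreal (norm (mult_conv ?\<kappa> (\<lambda>t. h t - h' t) t) powr p) \<partial>half_line)"
    proof (rule nn_integral_cong_AE, use mult_conv_diff[OF p h h' ker] in eventually_elim)
      case (elim t)
      have "weyl_pot \<alpha> h t - weyl_pot \<alpha> h' t = mult_conv ?\<kappa> (\<lambda>t. h t - h' t) t / complex_of_real ?G"
        unfolding elim using \<alpha> by (simp add: weyl_pot_def diff_divide_distrib)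
      then show ?case
        using G by (simp add: norm_divide powr_divide ennreal_mult[symmetric])
    qed
    also have "\<dots> = ennreal (1 / ?G powr p) * (\<integral>\<^sup>+t. ennreal (norm (mult_conv ?\<kappa> (\<lambda>t. h t - h' t) t) powr p) \<partial>half_line)"
      by (simp add: nn_integral_cmult)
    also have "\<dots> \<le> ennreal (1 / ?G powr p) * (ennreal (kernel_mass p ?\<kappa> powr p) * (\<integral>\<^sup>+t. ennreal (norm (h t - h' t) powr p) \<partial>half_line))"
      using p h h' by (intro mult_left_mono mult_conv_bound ker in_Lp_diff) auto
    finally show "(\<integral>\<^sup>+t. ennreal (norm (weyl_pot \<alpha> h t - weyl_pot \<alpha> h' t) powr p) \<partial>half_line) \<le>
        ennreal (1 / ?G powr p * kernel_mass p ?\<kappa> powr p) * (\<integral>\<^sup>+t. ennreal (norm (h t - h' t) powr p) \<partial>half_line)"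
      by (subst ennreal_mult) (auto simp: mult.assoc)
  qed
qed

lemma in_Lp_cong_AE:
  assumes "in_Lp p h" "AE t in half_line. h t = h' t" "h' \<in> borel_measurable borel"
  shows "in_Lp p h'"
proof -
  have "(\<integral>\<^sup>+t. ennreal (norm (h t) powr p) \<partial>half_line) = (\<integral>\<^sup>+t. ennreal (norm (h' t) powr p) \<partial>half_line)"
    by (rule nn_integral_cong_AE) (use assms(2) in eventually_elim, simp)
  then show ?thesis using assms by (simp add: in_Lp_def)
qed

lemma weyl_pot_cong_AE:
  assumes [measurable]: "h \<in> borel_measurable borel" "h' \<in> borel_measurable borel"
    and "AE t in half_line. h t = h' t"
  shows "AE t in half_line. weyl_pot \<alpha> h t = weyl_pot \<alpha> h' t"
proof (cases "\<alpha> = 0")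
  case False
  then show ?thesis
    using mult_conv_cong_AE[OF _ assms, of "\<lambda>u. cesaro_kernel \<alpha> u 1"]
    by (intro AE_half_lineI) (simp add: weyl_pot_def)
qed (use assms in \<open>simp add: weyl_pot_def\<close>)

lemma weyl_pot_injective:
  assumes p: "1 < p" and "0 \<le> \<alpha>" and h: "in_Lp p h" and h': "in_Lp p h'"
    and eq: "AE t in half_line. weyl_pot \<alpha> h t = weyl_pot \<alpha> h' t"
  shows "AE t in half_line. h t = h' t"
proof (cases "\<alpha> = 0")
  case True
  then show ?thesis using eq by (simp add: weyl_pot_def)
next
  case False
  then have \<alpha>: "0 < \<alpha>" using assms by simp
  have [measurable]: "h \<in> borel_measurable borel" "h' \<in> borel_measurable borel"
    using h h' by (auto simp: in_Lp_def)
  have pos: "AE t in half_line. 0 < t" by (simp add: AE_half_line)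
  have "AE t in half_line. cesaro_dual \<alpha> (\<lambda>t. h t - h' t) t = 0"
    using eq mult_conv_diff[OF p h h' Lp_kernel_cesaro_dual(1)[OF \<alpha> p]] pos
    by eventually_elim (use \<alpha> in \<open>simp add: weyl_pot_def cesaro_dual_eq_mult_conv Gamma_real_nonzero\<close>)
  then have "AE t in half_line. h t - h' t = 0"
    using p by (intro cesaro_dual_injective[OF p \<alpha> in_Lp_diff[OF h h']]) auto
  then show ?thesis by simp
qed

text \<open>Membership in \<open>schwartz_plus\<close> says nothing about negative arguments, so a
  Schwartz function need not be Borel on the line. \<Phi> and \<Psi> are Borel representatives of it
  and of its Weyl derivative on the positive axis.\<close>

lemma schwartz_weyl_pot:
  assumes "\<phi> \<in> schwartz_plus" "0 \<le> \<alpha>"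
  obtains \<Phi> \<Psi> where "\<Phi> \<in> borel_measurable borel" "\<Psi> \<in> borel_measurable borel"
    "\<And>t. 0 < t \<Longrightarrow> \<phi> t = \<Phi> t" "\<And>t. 0 < t \<Longrightarrow> weyl_deriv \<alpha> \<phi> t = \<Psi> t"
    "\<And>t. 0 < t \<Longrightarrow> \<Phi> t = weyl_pot \<alpha> (weight \<alpha> \<Psi>) t"
proof -
  obtain D where D: "schwartz_family D" "\<And>t. 0 \<le> t \<Longrightarrow> \<phi> t = D 0 t"
    using schwartz_plus_family[OF assms(1)] by blast
  interpret schwartz_family D by fact
  show thesis
  proof (cases "\<alpha> = 0")
    case True
    show ?thesis
      by (rule that[of "D 0" "D 0"]) (use D True in \<open>auto simp: weyl_deriv_def weyl_pot_def\<close>)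
  next
    case False
    then have \<alpha>: "0 < \<alpha>" using assms by simp
    let ?n = "nat \<lfloor>\<alpha>\<rfloor> + 1"
    define \<Psi> where "\<Psi> t = (-1) ^ ?n * weyl_int (real ?n - \<alpha>) (D ?n) t" for t
    have [measurable]: "\<Psi> \<in> borel_measurable borel"
      unfolding \<Psi>_def[abs_def] weyl_int_half_line[OF D_measurable] by measurable
    have \<Psi>: "weyl_deriv \<alpha> \<phi> t = \<Psi> t" if "0 < t" for t
      unfolding \<Psi>_def by (rule weyl_deriv_eq[OF \<alpha> that D(2)])
    have "D 0 t = weyl_pot \<alpha> (weight \<alpha> \<Psi>) t" if t: "0 < t" for t
    proof -
      have "D 0 t = weyl_int \<alpha> (weyl_deriv \<alpha> \<phi>) t"
        using weyl_int_weyl_deriv[OF \<alpha> t D(2)] D(2)[of t] t by simp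
      also have "\<dots> = weyl_int \<alpha> \<Psi> t"
        using t \<Psi> by (intro weyl_int_cong) auto
      finally show ?thesis using weyl_int_eq_weyl_pot[OF \<alpha> _ t, of \<Psi>] by simp
    qed
    then show ?thesis
      using that[of "D 0" \<Psi>] D(2) \<Psi> by auto
  qed
qed

lemma norm_weight_powr: "norm (F t) powr p * t powr (\<alpha> * p) = norm (weight \<alpha> F t) powr p"
  by (simp add: norm_mult powr_mult powr_powr)

lemma weyl_deriv_dist_eq:
  assumes [measurable]: "F \<in> borel_measurable borel" "\<Psi> \<in> borel_measurable borel"
    and \<Psi>: "\<And>t. 0 < t \<Longrightarrow> weyl_deriv \<alpha> \<phi> t = \<Psi> t"
  shows "(\<integral>\<^sup>+t. indicator {0<..} t * ennreal (norm (weyl_deriv \<alpha> \<phi> t - F t) powr p * t powr (\<alpha> * p)) \<partial>lborel) =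
    (\<integral>\<^sup>+t. ennreal (norm (weight \<alpha> \<Psi> t - weight \<alpha> F t) powr p) \<partial>half_line)"
  using norm_weight_powr[of "\<lambda>t. \<Psi> t - F t" _ p \<alpha>] \<Psi>
  by (subst nn_integral_half_line) (auto intro!: nn_integral_cong simp: indicator_def right_diff_distrib)

text \<open>Left to right, continuity of the potential identifies the limit. Right to left,
  exponential sums approximate F in the weighted norm, and the same continuity carries the
  approximation over to f.\<close>

lemma T_approx_iff:
  assumes p: "1 < p" and \<alpha>: "0 \<le> \<alpha>"
  shows "T_approx \<alpha> p f F \<longleftrightarrow> f \<in> borel_measurable borel \<and> F \<in> borel_measurable borel \<and>
    in_Lp p (weight \<alpha> F) \<and> (AE t in half_line. f t = weyl_pot \<alpha> (weight \<alpha> F) t)"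
proof -
  have Lp: "in_Lp p (weight \<alpha> F) \<longleftrightarrow>
      (\<integral>\<^sup>+ t. indicator {0<..} t * ennreal (norm (F t) powr p * t powr (\<alpha> * p)) \<partial>lborel) < \<infinity>"
    if [measurable]: "F \<in> borel_measurable borel"
    by (simp add: in_Lp_def norm_weight_powr nn_integral_half_line)
  obtain B where B: "\<And>h h'. in_Lp p h \<Longrightarrow> in_Lp p h' \<Longrightarrow>
    (\<integral>\<^sup>+t. ennreal (norm (weyl_pot \<alpha> h t - weyl_pot \<alpha> h' t) powr p) \<partial>half_line) \<le>
      ennreal B * (\<integral>\<^sup>+t. ennreal (norm (h t - h' t) powr p) \<partial>half_line)"
    using weyl_pot_dist[OF p \<alpha>] by blast
  show ?thesis
  proof
    assume T: "T_approx \<alpha> p f F"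
    then have [measurable]: "f \<in> borel_measurable borel" "F \<in> borel_measurable borel"
      by (auto simp: T_approx_def)
    define h where "h = weight \<alpha> F"
    have h: "in_Lp p h"
      using T Lp by (simp add: h_def T_approx_def)
    have [measurable]: "h \<in> borel_measurable borel" by (simp add: h_def)
    obtain \<phi> where \<phi>: "\<And>k. \<phi> k \<in> schwartz_plus"
      "(\<lambda>k. \<integral>\<^sup>+ t. indicator {0<..} t * ennreal (norm (\<phi> k t - f t) powr p) \<partial>lborel) \<longlonglongrightarrow> 0"
      "(\<lambda>k. \<integral>\<^sup>+ t. indicator {0<..} t * ennreal (norm (weyl_deriv \<alpha> (\<phi> k) t - F t) powr p * t powr (\<alpha> * p)) \<partial>lborel) \<longlonglongrightarrow> 0"
      using T by (auto simp: T_approx_def)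
    define R where "R k \<Phi> \<Psi> \<longleftrightarrow> \<Phi> \<in> borel_measurable borel \<and> \<Psi> \<in> borel_measurable borel \<and>
        (\<forall>t>0. \<phi> k t = \<Phi> t \<and> weyl_deriv \<alpha> (\<phi> k) t = \<Psi> t \<and> \<Phi> t = weyl_pot \<alpha> (weight \<alpha> \<Psi>) t)" for k \<Phi> \<Psi>
    have "\<exists>\<Phi> \<Psi>. R k \<Phi> \<Psi>" for k
    proof (rule schwartz_weyl_pot[OF \<phi>(1)[of k] \<alpha>])
      fix \<Phi> \<Psi>
      assume "\<Phi> \<in> borel_measurable borel" "\<Psi> \<in> borel_measurable borel"
        "\<And>t. 0 < t \<Longrightarrow> \<phi> k t = \<Phi> t" "\<And>t. 0 < t \<Longrightarrow> weyl_deriv \<alpha> (\<phi> k) t = \<Psi> t"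
        "\<And>t. 0 < t \<Longrightarrow> \<Phi> t = weyl_pot \<alpha> (weight \<alpha> \<Psi>) t"
      then have "R k \<Phi> \<Psi>" unfolding R_def by blast
      then show ?thesis by blast
    qed
    then obtain \<Phi> \<Psi> where R: "\<And>k. R k (\<Phi> k) (\<Psi> k)" by metis
    have [measurable]: "\<Phi> k \<in> borel_measurable borel" "\<Psi> k \<in> borel_measurable borel" for k
      using R[of k] by (auto simp: R_def)
    have eq: "\<phi> k t = \<Phi> k t" "weyl_deriv \<alpha> (\<phi> k) t = \<Psi> k t" "\<Phi> k t = weyl_pot \<alpha> (weight \<alpha> (\<Psi> k)) t"
      if "0 < t" for k t
      using R[of k] that unfolding R_def by blast+
    define d where "d k = (\<integral>\<^sup>+t. ennreal (norm (weight \<alpha> (\<Psi> k) t - h t) powr p) \<partial>half_line)" for k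
    have d: "d \<longlonglongrightarrow> 0"
      using \<phi>(3) by (simp add: d_def[abs_def] h_def weyl_deriv_dist_eq[OF _ _ eq(2)])
    define e where "e k = (\<integral>\<^sup>+t. ennreal (norm (f t - \<Phi> k t) powr p) \<partial>half_line)" for k
    have e: "e \<longlonglongrightarrow> 0"
    proof -
      have "(\<integral>\<^sup>+ t. indicator {0<..} t * ennreal (norm (\<phi> k t - f t) powr p) \<partial>lborel) =
          (\<integral>\<^sup>+ t. indicator {0<..} t * ennreal (norm (f t - \<Phi> k t) powr p) \<partial>lborel)" for k
        using eq(1)[of _ k] by (intro nn_integral_cong) (auto simp: indicator_def norm_minus_commute)
      then show ?thesis using \<phi>(2) by (simp add: e_def[abs_def] nn_integral_half_line)
    qed
    \<comment> \<open>The distance \<open>d k\<close> is an extended real and may be infinite for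
      small k; once it is below 1 the weighted derivative of \<phi> k is known to lie in
      L^p.\<close>
    have bound: "(\<integral>\<^sup>+t. ennreal (norm (f t - weyl_pot \<alpha> h t) powr p) \<partial>half_line) \<le>
        ennreal (2 powr p) * (e k + ennreal B * d k)" if dk: "d k < 1" for k
    proof -
      have "in_Lp p (\<lambda>t. h t - weight \<alpha> (\<Psi> k) t)"
        using dk by (simp add: in_Lp_def d_def norm_minus_commute less_trans[OF _ ennreal_one_less_top])
      from in_Lp_diff[OF h this] p have hk: "in_Lp p (weight \<alpha> (\<Psi> k))" by simp
      have "(\<integral>\<^sup>+t. ennreal (norm (\<Phi> k t - weyl_pot \<alpha> h t) powr p) \<partial>half_line) =
          (\<integral>\<^sup>+t. ennreal (norm (weyl_pot \<alpha> (weight \<alpha> (\<Psi> k)) t - weyl_pot \<alpha> h t) powr p) \<partial>half_line)"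
        by (intro nn_integral_half_line_cong) (simp add: eq(3))
      also have "\<dots> \<le> ennreal B * d k"
        unfolding d_def by (rule B[OF hk h])
      finally have 1: "(\<integral>\<^sup>+t. ennreal (norm (\<Phi> k t - weyl_pot \<alpha> h t) powr p) \<partial>half_line) \<le> ennreal B * d k" .
      have "(\<integral>\<^sup>+t. ennreal (norm (f t - weyl_pot \<alpha> h t) powr p) \<partial>half_line) =
          (\<integral>\<^sup>+t. ennreal (norm ((f t - \<Phi> k t) + (\<Phi> k t - weyl_pot \<alpha> h t)) powr p) \<partial>half_line)"
        by simp
      also have "\<dots> \<le> ennreal (2 powr p) * (e k + (\<integral>\<^sup>+t. ennreal (norm (\<Phi> k t - weyl_pot \<alpha> h t) powr p) \<partial>half_line))"
        unfolding e_def using p by (intro nn_integral_powr_add_le) auto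
      also have "\<dots> \<le> ennreal (2 powr p) * (e k + ennreal B * d k)"
        by (intro mult_left_mono add_left_mono 1) auto
      finally show ?thesis .
    qed
    have "(\<lambda>k. ennreal (2 powr p) * (e k + ennreal B * d k)) \<longlonglongrightarrow> ennreal (2 powr p) * (0 + ennreal B * 0)"
      by (intro ennreal_tendsto_cmult tendsto_add e d) auto
    moreover have "\<forall>\<^sub>F k in sequentially. d k < 1"
      using order_tendstoD(2)[OF d] by simp
    then have "\<forall>\<^sub>F k in sequentially. (\<integral>\<^sup>+t. ennreal (norm (f t - weyl_pot \<alpha> h t) powr p) \<partial>half_line) \<le>
        ennreal (2 powr p) * (e k + ennreal B * d k)"
      by eventually_elim (rule bound)
    ultimately have "(\<integral>\<^sup>+t. ennreal (norm (f t - weyl_pot \<alpha> h t) powr p) \<partial>half_line) \<le> ennreal (2 powr p) * (0 + ennreal B * 0)"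
      by (intro tendsto_lowerbound) auto
    then have "(\<integral>\<^sup>+t. ennreal (norm (f t - weyl_pot \<alpha> h t) powr p) \<partial>half_line) = 0" by simp
    then have "AE t in half_line. ennreal (norm (f t - weyl_pot \<alpha> h t) powr p) = 0"
      by (subst (asm) nn_integral_0_iff_AE) auto
    then have "AE t in half_line. f t = weyl_pot \<alpha> h t"
      by eventually_elim (simp add: ennreal_eq_0_iff powr_nonneg_iff)
    then show "f \<in> borel_measurable borel \<and> F \<in> borel_measurable borel \<and>
        in_Lp p (weight \<alpha> F) \<and> (AE t in half_line. f t = weyl_pot \<alpha> (weight \<alpha> F) t)"
      using h by (simp add: h_def)
  next
    assume R: "f \<in> borel_measurable borel \<and> F \<in> borel_measurable borel \<and>
        in_Lp p (weight \<alpha> F) \<and> (AE t in half_line. f t = weyl_pot \<alpha> (weight \<alpha> F) t)"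
    then have [measurable]: "f \<in> borel_measurable borel" "F \<in> borel_measurable borel"
      and h: "in_Lp p (weight \<alpha> F)" and f: "AE t in half_line. f t = weyl_pot \<alpha> (weight \<alpha> F) t" by auto
    define R where "R k N c \<longleftrightarrow> (\<integral>\<^sup>+t. ennreal (norm (weight \<alpha> (exp_sum N c) t - weight \<alpha> F t) powr p) \<partial>half_line)
        < ennreal (1 / real (Suc k))" for k N c
    have "\<exists>N c. R k N c" for k
    proof (rule exp_sum_dense[OF \<alpha> p _ h, of "1 / real (Suc k)"])
      fix N c
      assume "(\<integral>\<^sup>+t. ennreal (norm (weight \<alpha> (exp_sum N c) t - weight \<alpha> F t) powr p) \<partial>half_line) < ennreal (1 / real (Suc k))"
      then have "R k N c" unfolding R_def .
      then show ?thesis by blast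
    qed auto
    then obtain N c where "\<And>k. R k (N k) (c k)" by metis
    then have Nc: "(\<integral>\<^sup>+t. ennreal (norm (weight \<alpha> (exp_sum (N k) (c k)) t - weight \<alpha> F t) powr p) \<partial>half_line)
        < ennreal (1 / real (Suc k))" for k
      unfolding R_def .
    define \<Psi> where "\<Psi> k = exp_sum (N k) (c k)" for k
    \<comment> \<open>The coefficients are divided in advance by the eigenvalues of the Weyl
      derivative, so that its value on \<phi> k is the given approximant \<Psi> k.\<close>
    define \<phi> where "\<phi> k = exp_sum (N k) (\<lambda>j. complex_of_real (real (Suc j) powr (- \<alpha>)) * c k j)" for k
    have [measurable]: "\<Psi> k \<in> borel_measurable borel" "\<phi> k \<in> borel_measurable borel" for k
      by (auto simp: \<Psi>_def \<phi>_def)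
    have sch: "\<phi> k \<in> schwartz_plus" for k by (simp add: \<phi>_def exp_sum_schwartz)
    have wd: "weyl_deriv \<alpha> (\<phi> k) t = \<Psi> k t" if "0 < t" for k t
    proof -
      have "real (Suc j) powr \<alpha> * real (Suc j) powr (- \<alpha>) = 1" for j
        by (simp add: powr_add[symmetric] del: of_nat_Suc)
      then have "complex_of_real (real (Suc j) powr \<alpha>) * (complex_of_real (real (Suc j) powr (- \<alpha>)) * z) = z" for j z
        by (simp only: mult.assoc[symmetric] of_real_mult[symmetric]) simp
      then show ?thesis
        unfolding \<phi>_def \<Psi>_def weyl_deriv_exp_sum[OF \<alpha> that] by (simp only:)
    qed
    define d where "d k = (\<integral>\<^sup>+t. ennreal (norm (weight \<alpha> (\<Psi> k) t - weight \<alpha> F t) powr p) \<partial>half_line)" for k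
    have lim1: "(\<lambda>k. ennreal (1 / real (Suc k))) \<longlonglongrightarrow> 0"
      using tendsto_ennrealI[OF LIMSEQ_inverse_real_of_nat] by (simp add: inverse_eq_divide)
    have d: "d \<longlonglongrightarrow> 0"
    proof (rule tendsto_sandwich[OF _ _ tendsto_const lim1])
      show "\<forall>\<^sub>F k in sequentially. d k \<le> ennreal (1 / real (Suc k))"
        unfolding d_def \<Psi>_def by (intro always_eventually allI less_imp_le Nc)
    qed simp
    have phi: "\<phi> k t = weyl_pot \<alpha> (weight \<alpha> (\<Psi> k)) t" if t: "0 < t" for k t
    proof -
      obtain \<Phi> \<Psi>' where *: "\<Phi> \<in> borel_measurable borel" "\<Psi>' \<in> borel_measurable borel" "\<And>t. 0 < t \<Longrightarrow> \<phi> k t = \<Phi> t" "\<And>t. 0 < t \<Longrightarrow> weyl_deriv \<alpha> (\<phi> k) t = \<Psi>' t"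
          "\<And>t. 0 < t \<Longrightarrow> \<Phi> t = weyl_pot \<alpha> (weight \<alpha> \<Psi>') t"
        using schwartz_weyl_pot[OF sch[of k] \<alpha>] by blast
      note [measurable] = *(2)
      have eq: "weight \<alpha> \<Psi>' s = weight \<alpha> (\<Psi> k) s" if "0 < s" for s using *(4)[OF that] wd[OF that] by simp
      have "weyl_pot \<alpha> (weight \<alpha> \<Psi>') t = weyl_pot \<alpha> (weight \<alpha> (\<Psi> k)) t"
      proof (cases "\<alpha> = 0")
        case True then show ?thesis using eq[OF t] by (simp add: weyl_pot_def)
      next
        case False
        have "mult_conv (\<lambda>u. cesaro_kernel \<alpha> u 1) (weight \<alpha> \<Psi>') t = mult_conv (\<lambda>u. cesaro_kernel \<alpha> u 1) (weight \<alpha> (\<Psi> k)) t"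
          using t eq by (intro mult_conv_cong_AE AE_half_lineI) auto
        then show ?thesis using False by (simp add: weyl_pot_def)
      qed
      then show ?thesis using *(3,5) t by simp
    qed
    have dfin: "d k < \<infinity>" for k
      using less_trans[OF Nc[of k] ennreal_less_top] by (simp add: d_def \<Psi>_def)
    have e: "(\<integral>\<^sup>+t. ennreal (norm (\<phi> k t - f t) powr p) \<partial>half_line) \<le> ennreal B * d k" for k
    proof -
      have "in_Lp p (\<lambda>t. weight \<alpha> F t - weight \<alpha> (\<Psi> k) t)"
        using dfin[of k] by (simp add: in_Lp_def d_def norm_minus_commute)
      from in_Lp_diff[OF h this] p have hk: "in_Lp p (weight \<alpha> (\<Psi> k))" by simp
      have pos: "AE t in half_line. 0 < t" by (simp add: AE_half_line)
      have "(\<integral>\<^sup>+t. ennreal (norm (\<phi> k t - f t) powr p) \<partial>half_line) =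
          (\<integral>\<^sup>+t. ennreal (norm (weyl_pot \<alpha> (weight \<alpha> (\<Psi> k)) t - weyl_pot \<alpha> (weight \<alpha> F) t) powr p) \<partial>half_line)"
        by (rule nn_integral_cong_AE) (use f pos in eventually_elim, simp add: phi)
      also have "\<dots> \<le> ennreal B * d k"
        unfolding d_def by (rule B[OF hk h])
      finally show ?thesis .
    qed
    have "(\<lambda>k. ennreal B * d k) \<longlonglongrightarrow> ennreal B * 0"
      by (intro ennreal_tendsto_cmult d) auto
    then have lim2: "(\<lambda>k. ennreal B * d k) \<longlonglongrightarrow> 0" by simp
    show "T_approx \<alpha> p f F"
      unfolding T_approx_def
    proof (intro conjI exI[of _ \<phi>] allI sch)
      show "(\<integral>\<^sup>+ t. indicator {0<..} t * ennreal (norm (F t) powr p * t powr (\<alpha> * p)) \<partial>lborel) < \<infinity>"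
        using h Lp by simp
      have "(\<lambda>k. \<integral>\<^sup>+t. ennreal (norm (\<phi> k t - f t) powr p) \<partial>half_line) \<longlonglongrightarrow> 0"
        by (rule tendsto_sandwich[OF _ _ tendsto_const lim2]) (auto intro!: always_eventually e)
      then show "(\<lambda>k. \<integral>\<^sup>+ t. indicator {0<..} t * ennreal (norm (\<phi> k t - f t) powr p) \<partial>lborel) \<longlonglongrightarrow> 0"
        by (simp add: nn_integral_half_line)
      show "(\<lambda>k. \<integral>\<^sup>+ t. indicator {0<..} t * ennreal (norm (weyl_deriv \<alpha> (\<phi> k) t - F t) powr p * t powr (\<alpha> * p)) \<partial>lborel) \<longlonglongrightarrow> 0"
        using d by (simp add: d_def[abs_def] weyl_deriv_dist_eq[OF _ _ wd])
    qed auto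
  qed
qed

text \<open>This makes the choice in \<open>weylD\<close> harmless: norm and pairing may be computed
  from any admissible derivative.\<close>

lemma T_approx_unique:
  assumes "1 < p" "0 \<le> \<alpha>" "T_approx \<alpha> p f F" "T_approx \<alpha> p f G"
  shows "AE t in half_line. weight \<alpha> F t = weight \<alpha> G t"
proof -
  note F = assms(3)[unfolded T_approx_iff[OF assms(1,2)]]
  note G = assms(4)[unfolded T_approx_iff[OF assms(1,2)]]
  have "AE t in half_line. weyl_pot \<alpha> (weight \<alpha> F) t = weyl_pot \<alpha> (weight \<alpha> G) t"
    using conjunct2[OF conjunct2[OF conjunct2[OF F]]] conjunct2[OF conjunct2[OF conjunct2[OF G]]]
    by eventually_elim simp
  then show ?thesis
    by (rule weyl_pot_injective[OF assms(1,2), rotated 2]) (use F G in auto)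
qed

lemma T_approx_weylD: "f \<in> T_space \<alpha> p \<Longrightarrow> T_approx \<alpha> p f (weylD \<alpha> p f)"
  using someI_ex[of "T_approx \<alpha> p f"] by (simp add: T_space_def weylD_def)

lemma AE_weylD:
  assumes "1 < p" "0 \<le> \<alpha>" "T_approx \<alpha> p f F"
  shows "AE t in half_line. weight \<alpha> (weylD \<alpha> p f) t = weight \<alpha> F t"
  using assms by (intro T_approx_unique[OF assms(1,2) T_approx_weylD]) (auto simp: T_space_def)

lemma weylD_measurable:
  assumes "1 < p" "0 \<le> \<alpha>" "T_approx \<alpha> p f F"
  shows "weylD \<alpha> p f \<in> borel_measurable borel"
  using T_approx_weylD[of f \<alpha> p] assms T_approx_iff[OF assms(1,2)] by (auto simp: T_space_def)

section \<open>Norm, pairing and operators in terms of the weighted derivative\<close>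

definition Lp_norm :: "real \<Rightarrow> (real \<Rightarrow> complex) \<Rightarrow> real" where
  "Lp_norm p h = (LINT t|half_line. norm (h t) powr p) powr (1 / p)"

lemma T_norm_eq:
  assumes "1 < p" "0 \<le> \<alpha>" "T_approx \<alpha> p f F"
  shows "T_norm \<alpha> p f = Lp_norm p (weight \<alpha> F) / Gamma (\<alpha> + 1)"
proof -
  have [measurable]: "weylD \<alpha> p f \<in> borel_measurable borel" "F \<in> borel_measurable borel"
    using weylD_measurable[OF assms] assms(3) T_approx_iff[OF assms(1,2)] by auto
  have "(LINT t:{0<..}|lborel. norm (weylD \<alpha> p f t) powr p * t powr (\<alpha> * p)) =
      (LINT t|half_line. norm (weight \<alpha> (weylD \<alpha> p f) t) powr p)"
    by (subst integral_half_line) (simp_all only: norm_weight_powr, auto)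
  also have "\<dots> = (LINT t|half_line. norm (weight \<alpha> F t) powr p)"
  proof (rule integral_cong_AE)
    show "AE t in half_line. norm (weight \<alpha> (weylD \<alpha> p f) t) powr p = norm (weight \<alpha> F t) powr p"
      using AE_weylD[OF assms] by eventually_elim (simp only:)
  qed auto
  finally show ?thesis by (simp only: T_norm_def Lp_norm_def)
qed

lemma T_pair_eq:
  assumes "1 < p" "1 < q" "0 \<le> \<alpha>" and f: "T_approx \<alpha> p f F" and g: "T_approx \<alpha> q g G"
  shows "T_pair \<alpha> p q f g = (LINT t|half_line. weight \<alpha> F t * weight \<alpha> G t) / complex_of_real (Gamma (\<alpha> + 1) ^ 2)"
proof -
  have [measurable]: "weylD \<alpha> p f \<in> borel_measurable borel" "F \<in> borel_measurable borel"
      "weylD \<alpha> q g \<in> borel_measurable borel" "G \<in> borel_measurable borel"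
    using weylD_measurable[OF _ _ f] weylD_measurable[OF _ _ g] f g T_approx_iff assms by auto
  have "(LINT t:{0<..}|lborel. weylD \<alpha> p f t * weylD \<alpha> q g t * complex_of_real (t powr (2 * \<alpha>))) =
      (LINT t|half_line. weylD \<alpha> p f t * weylD \<alpha> q g t * complex_of_real (t powr (2 * \<alpha>)))"
    by (rule integral_half_line[symmetric]) simp
  also have "\<dots> = (LINT t|half_line. weight \<alpha> F t * weight \<alpha> G t)"
  proof (rule integral_cong_AE)
    show "AE t in half_line. weylD \<alpha> p f t * weylD \<alpha> q g t * complex_of_real (t powr (2 * \<alpha>)) = weight \<alpha> F t * weight \<alpha> G t"
      using AE_weylD[OF assms(1,3) f] AE_weylD[OF assms(2,3) g]
    proof eventually_elim
      case (elim t)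
      have "weylD \<alpha> p f t * weylD \<alpha> q g t * complex_of_real (t powr (2 * \<alpha>)) =
          weight \<alpha> (weylD \<alpha> p f) t * weight \<alpha> (weylD \<alpha> q g) t"
        using powr_add[of t \<alpha> \<alpha>] by (simp add: mult_ac)
      then show ?case by (simp only: elim)
    qed
  qed auto
  finally show ?thesis by (simp only: T_pair_def)
qed

text \<open>Surjectivity: the weighted derivative can be prescribed freely in L^p. Images under the
  operators and the test functions for sharpness both enter the space this way.\<close>

lemma T_approx_weyl_pot:
  assumes "1 < p" "0 \<le> \<alpha>" and h: "in_Lp p h"
  obtains F where "T_approx \<alpha> p (weyl_pot \<alpha> h) F" "\<And>t. 0 < t \<Longrightarrow> weight \<alpha> F t = h t"
proof -
  have [measurable]: "h \<in> borel_measurable borel" using h by (simp add: in_Lp_def)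
  define F where "F t = complex_of_real (t powr (- \<alpha>)) * h t" for t
  have [measurable]: "F \<in> borel_measurable borel" by (simp add: F_def[abs_def])
  have wF: "weight \<alpha> F t = h t" if "0 < t" for t
    using that by (simp add: F_def powr_minus)
  have "in_Lp p (weight \<alpha> F)"
    by (rule in_Lp_cong_AE[OF h]) (auto intro!: AE_half_lineI simp: wF)
  moreover have "AE t in half_line. weyl_pot \<alpha> h t = weyl_pot \<alpha> (weight \<alpha> F) t"
    by (rule weyl_pot_cong_AE) (auto intro!: AE_half_lineI simp: wF)
  ultimately have "T_approx \<alpha> p (weyl_pot \<alpha> h) F"
    using T_approx_iff[OF assms(1,2)] by auto
  then show thesis using wF by (rule that)
qed

lemma mult_conv_weyl_pot:
  assumes p: "1 < p" and \<alpha>: "0 \<le> \<alpha>" and h: "in_Lp p h" and \<kappa>: "Lp_kernel p \<kappa>"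
  shows "AE t in half_line. mult_conv \<kappa> (weyl_pot \<alpha> h) t = weyl_pot \<alpha> (mult_conv \<kappa> h) t"
proof (cases "\<alpha> = 0")
  case False
  then have "0 < \<alpha>" using \<alpha> by simp
  have eq: "mult_conv \<kappa> (\<lambda>t. g t / c) t = mult_conv \<kappa> g t / c" for g c t
    unfolding mult_conv_def by (simp flip: integral_divide_zero)
  show ?thesis
    using mult_conv_commute[OF p h \<kappa> Lp_kernel_cesaro_dual(1)[OF \<open>0 < \<alpha>\<close> p]]
    by eventually_elim (use False in \<open>simp add: weyl_pot_def eq\<close>)
qed (simp add: weyl_pot_def)

text \<open>The potential is itself a multiplicative convolution, so \<kappa> acts directly on the
  weighted derivative. A separate g is allowed because the Cesaro operators agree with their
  convolution forms only at positive t.\<close>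

lemma T_approx_mult_conv:
  assumes p: "1 < p" and \<alpha>: "0 \<le> \<alpha>" and \<kappa>: "Lp_kernel p \<kappa>" and f: "T_approx \<alpha> p f F"
    and [measurable]: "g \<in> borel_measurable borel" and g: "\<And>t. 0 < t \<Longrightarrow> g t = mult_conv \<kappa> f t"
  obtains G where "T_approx \<alpha> p g G" "\<And>t. 0 < t \<Longrightarrow> weight \<alpha> G t = mult_conv \<kappa> (weight \<alpha> F) t"
proof -
  have [measurable]: "f \<in> borel_measurable borel" "F \<in> borel_measurable borel" "\<kappa> \<in> borel_measurable borel"
    and h: "in_Lp p (weight \<alpha> F)" and feq: "AE t in half_line. f t = weyl_pot \<alpha> (weight \<alpha> F) t"
    using f \<kappa> T_approx_iff[OF p \<alpha>] by (auto simp: Lp_kernel_def)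
  obtain G where G: "T_approx \<alpha> p (weyl_pot \<alpha> (mult_conv \<kappa> (weight \<alpha> F))) G"
      "\<And>t. 0 < t \<Longrightarrow> weight \<alpha> G t = mult_conv \<kappa> (weight \<alpha> F) t"
    using T_approx_weyl_pot[OF p \<alpha> in_Lp_mult_conv[OF p h \<kappa>]] by blast
  have pos: "AE t in half_line. 0 < t" by (simp add: AE_half_line)
  have "AE t in half_line. g t = weyl_pot \<alpha> (mult_conv \<kappa> (weight \<alpha> F)) t"
    using pos mult_conv_weyl_pot[OF p \<alpha> h \<kappa>]
  proof eventually_elim
    case (elim t)
    have "g t = mult_conv \<kappa> (weyl_pot \<alpha> (weight \<alpha> F)) t"
      using g[OF elim(1)] mult_conv_cong_AE[OF _ _ _ feq elim(1), of \<kappa>] by simp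
    then show ?case using elim(2) by simp
  qed
  moreover have "AE t in half_line. weyl_pot \<alpha> (mult_conv \<kappa> (weight \<alpha> F)) t = weyl_pot \<alpha> (weight \<alpha> G) t"
    using G(1) T_approx_iff[OF p \<alpha>] by auto
  ultimately have "AE t in half_line. g t = weyl_pot \<alpha> (weight \<alpha> G) t"
    by eventually_elim simp
  then have "T_approx \<alpha> p g G"
    using G(1) T_approx_iff[OF p \<alpha>] by auto
  then show thesis using G(2) by (rule that)
qed

lemma Lp_norm_cong:
  assumes "\<And>t. 0 < t \<Longrightarrow> h t = h' t" "h \<in> borel_measurable borel" "h' \<in> borel_measurable borel"
  shows "Lp_norm p h = Lp_norm p h'"
  unfolding Lp_norm_def using assms by (subst integral_half_line_cong[of _ "\<lambda>t. norm (h' t) powr p"]) auto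

lemma Lp_norm_mult_conv_le:
  assumes p: "1 < p" and h: "in_Lp p h" and \<kappa>: "Lp_kernel p \<kappa>"
  shows "Lp_norm p (mult_conv \<kappa> h) \<le> kernel_mass p \<kappa> * Lp_norm p h"
proof -
  let ?I = "\<lambda>h. LINT t|half_line. norm (h t) powr p"
  have nn: "(\<integral>\<^sup>+t. ennreal (norm (g t) powr p) \<partial>half_line) = ennreal (?I g)" if "in_Lp p g" for g
    using in_Lp_integrable[OF that] by (intro nn_integral_eq_integral) auto
  have I0: "0 \<le> ?I g" for g by (intro Bochner_Integration.integral_nonneg) simp
  have m: "0 \<le> kernel_mass p \<kappa>"
    unfolding kernel_mass_def using \<kappa> by (intro Bochner_Integration.integral_nonneg) (auto simp: Lp_kernel_def)
  have "ennreal (?I (mult_conv \<kappa> h)) \<le> ennreal (kernel_mass p \<kappa> powr p * ?I h)"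
    using mult_conv_bound[OF p h \<kappa>] nn[OF h] nn[OF in_Lp_mult_conv[OF p h \<kappa>]] I0[of h]
    by (simp add: ennreal_mult)
  then have "?I (mult_conv \<kappa> h) \<le> kernel_mass p \<kappa> powr p * ?I h"
    using I0[of h] by (subst (asm) ennreal_le_iff) auto
  then have "Lp_norm p (mult_conv \<kappa> h) \<le> (kernel_mass p \<kappa> powr p * ?I h) powr (1 / p)"
    unfolding Lp_norm_def using p I0 by (intro powr_mono2) auto
  also have "\<dots> = kernel_mass p \<kappa> * Lp_norm p h"
    unfolding Lp_norm_def using p m I0[of h] by (simp add: powr_mult powr_powr)
  finally show ?thesis .
qed

section \<open>Sharpness\<close>

text \<open>On t > 1 the kernel of order 1 is t^(-1), so the integral of t^(-a p) is the dual-kernel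
  integral for order 1, with value Beta(1, a p - 1); a > 1 / p makes the second argument
  positive.\<close>

lemma
  fixes a p :: real
  defines "h \<equiv> (\<lambda>t. if 1 < t then complex_of_real (t powr (- a)) else 0)"
  assumes p: "1 < p" and a: "1 / p < a"
  shows in_Lp_power_tail: "in_Lp p h"
    and Lp_norm_power_tail: "0 < Lp_norm p h"
proof -
  have [measurable]: "h \<in> borel_measurable borel" by (simp add: h_def)
  have ap: "0 < a * p - 1" using a p by (simp add: field_simps)
  have eq: "norm (h t) powr p = cesaro_kernel 1 t 1 * t powr (- (a * p - 1))" for t
  proof (cases "1 < t")
    case True
    then have "cesaro_kernel 1 t 1 = t powr (- 1)"
      by (simp add: cesaro_kernel_def powr_minus_divide)
    then have "cesaro_kernel 1 t 1 * t powr (- (a * p - 1)) = t powr (- (a * p))"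
      by (simp only: powr_add[symmetric]) simp
    then show ?thesis using True by (simp add: h_def powr_powr)
  qed (simp add: h_def cesaro_kernel_def)
  have "(\<integral>\<^sup>+t. ennreal (norm (h t) powr p) \<partial>half_line) = ennreal (1 * Beta 1 (a * p - 1))"
    unfolding eq by (rule nn_integral_cesaro_dual_kernel) (use ap in auto)
  then show "in_Lp p h" by (simp add: in_Lp_def)
  have "(LINT t|half_line. norm (h t) powr p) = 1 * Beta 1 (a * p - 1)"
    unfolding eq by (rule integrable_cesaro_dual_kernel) (use ap in auto)
  then show "0 < Lp_norm p h"
    using Beta_real_pos[of 1 "a * p - 1"] ap by (simp add: Lp_norm_def)
qed

text \<open>Only values of the argument above \<open>t\<close> enter \<open>cesaro_dual \<beta> h t\<close>, so on \<open>{1<..}\<close> the truncated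
  power behaves like an exact eigenfunction.\<close>
lemma Lp_norm_cesaro_dual_power_tail:
  fixes a p :: real
  defines "h \<equiv> (\<lambda>t. if 1 < t then complex_of_real (t powr (- a)) else 0)"
  assumes p: "1 < p" and a: "1 / p < a" and \<beta>: "0 < \<beta>"
  shows "\<beta> * Beta \<beta> a * Lp_norm p h \<le> Lp_norm p (mult_conv (\<lambda>u. cesaro_kernel \<beta> u 1) h)"
proof -
  have a0: "0 < a" using a p by (meson divide_pos_pos less_trans zero_less_one)
  have h: "in_Lp p h" unfolding h_def by (rule in_Lp_power_tail[OF p a])
  have [measurable]: "h \<in> borel_measurable borel" by (simp add: h_def)
  let ?C = "mult_conv (\<lambda>u. cesaro_kernel \<beta> u 1) h"
  let ?b = "\<beta> * Beta \<beta> a"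
  have b: "0 \<le> ?b" using \<beta> a0 by (simp add: Beta_real_pos less_imp_le)
  have C: "?C t = complex_of_real ?b * h t" if t: "1 < t" for t
  proof -
    have "?C t = (LINT u|half_line. complex_of_real (t powr (- a)) * complex_of_real (cesaro_kernel \<beta> u 1 * u powr (- a)))"
      unfolding mult_conv_def
    proof (rule integral_half_line_cong)
      fix u :: real assume "0 < u"
      show "complex_of_real (cesaro_kernel \<beta> u 1) * h (t * u) =
          complex_of_real (t powr (- a)) * complex_of_real (cesaro_kernel \<beta> u 1 * u powr (- a))"
        using t \<open>0 < u\<close> less_1_mult[of t u]
        by (cases "1 < u") (auto simp: h_def powr_mult cesaro_kernel_def)
    qed auto
    also have "\<dots> = complex_of_real (t powr (- a)) * complex_of_real ?b"
      using integrable_cesaro_dual_kernel(2)[OF \<beta> a0] by (simp only: integral_mult_right_zero integral_complex_of_real)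
    finally show ?thesis using t by (simp add: h_def)
  qed
  have "?b powr p * (LINT t|half_line. norm (h t) powr p) = (LINT t|half_line. ?b powr p * norm (h t) powr p)"
    by simp
  also have "\<dots> \<le> (LINT t|half_line. norm (?C t) powr p)"
  proof (rule integral_mono)
    show "integrable half_line (\<lambda>t. ?b powr p * norm (h t) powr p)"
      using in_Lp_integrable[OF h] by simp
    show "integrable half_line (\<lambda>t. norm (?C t) powr p)"
      by (intro in_Lp_integrable in_Lp_mult_conv p h Lp_kernel_cesaro_dual \<beta>)
    fix t :: real
    show "?b powr p * norm (h t) powr p \<le> norm (?C t) powr p"
    proof (cases "1 < t")
      case True
      then have "norm (?C t) = ?b * norm (h t)" 
        by (simp only: C norm_mult norm_of_real abs_of_nonneg[OF b])
      then show ?thesis using b by (simp add: powr_mult)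
    qed (simp add: h_def)
  qed
  finally have "(?b powr p * (LINT t|half_line. norm (h t) powr p)) powr (1 / p) \<le> Lp_norm p ?C"
    unfolding Lp_norm_def using p by (intro powr_mono2) (auto intro!: mult_nonneg_nonneg Bochner_Integration.integral_nonneg)
  also have "(?b powr p * (LINT t|half_line. norm (h t) powr p)) powr (1 / p) = ?b * Lp_norm p h"
    unfolding Lp_norm_def using p b by (subst powr_mult) (auto simp: powr_powr intro!: Bochner_Integration.integral_nonneg)
  finally show ?thesis .
qed

lemma tendsto_Beta_right:
  fixes b c :: real
  assumes "0 < b" "0 < c"
  shows "((\<lambda>a. Beta b a) \<longlongrightarrow> Beta b c) (at_right c)"
proof -
  have "c \<notin> \<int>\<^sub>\<le>\<^sub>0" "b + c \<notin> \<int>\<^sub>\<le>\<^sub>0" using assms by (auto elim!: nonpos_Ints_cases)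
  moreover have "Gamma (b + c) \<noteq> 0" using assms by (simp add: Gamma_real_nonzero)
  ultimately show ?thesis
    unfolding Beta_def by (intro tendsto_intros) auto
qed

theorem theorem3p7:
  fixes \<alpha> \<beta> p p' :: real
  assumes "\<alpha> \<ge> 0" and "p > 1" and "\<beta> > 0" and "1 / p + 1 / p' = 1"
  shows "(\<forall>f \<in> T_space \<alpha> p. cesaro_dual \<beta> f \<in> T_space \<alpha> p \<and>
            T_norm \<alpha> p (cesaro_dual \<beta> f)
              \<le> Gamma (\<beta> + 1) * Gamma (1 / p) / Gamma (\<beta> + 1 / p) * T_norm \<alpha> p f)
       \<and> Sup {T_norm \<alpha> p (cesaro_dual \<beta> f) / T_norm \<alpha> p f | f.
                f \<in> T_space \<alpha> p \<and> T_norm \<alpha> p f \<noteq> 0}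
           = Gamma (\<beta> + 1) * Gamma (1 / p) / Gamma (\<beta> + 1 / p)
       \<and> (\<forall>f \<in> T_space \<alpha> p. \<forall>g \<in> T_space \<alpha> p'.
            cesaro \<beta> f \<in> T_space \<alpha> p \<and>
            T_pair \<alpha> p p' (cesaro \<beta> f) g = T_pair \<alpha> p p' f (cesaro_dual \<beta> g))
       \<and> (\<forall>f \<in> T_space \<alpha> p. \<forall>t > 0.
            cesaro_dual \<beta> f t = complex_of_real \<beta> *
              (LINT r:{..<0}|lborel.
                 complex_of_real ((exp (- r) - 1) powr (\<beta> - 1) * exp (- r * (1 - 1 / p - \<beta>)))
                 * T_dil r p f t))"
proof -
  note \<alpha> = assms(1) and p = assms(2) and \<beta> = assms(3)
  have p': "1 < p'"
  proof -
    have "1 / p' = 1 - 1 / p" using assms(4) by simp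
    moreover have "0 < 1 - 1 / p" "1 - 1 / p < 1" using p by auto
    ultimately have "0 < 1 / p'" "1 / p' < 1" by simp_all
    then show ?thesis by (simp add: field_simps split: if_splits)
  qed
  let ?K = "Gamma (\<beta> + 1) * Gamma (1 / p) / Gamma (\<beta> + 1 / p)"
  let ?d = "\<lambda>u. cesaro_kernel \<beta> u 1"
  have K: "?K = \<beta> * Beta \<beta> (1 / p)"
    using \<beta> by (simp add: Beta_def Gamma_real_plus1)
  have G: "0 < Gamma (\<alpha> + 1)" using \<alpha> by (simp add: Gamma_real_pos)
  have meas: "f \<in> borel_measurable borel" "weylD \<alpha> q f \<in> borel_measurable borel" "in_Lp q (weight \<alpha> (weylD \<alpha> q f))"
    if "f \<in> T_space \<alpha> q" "1 < q" for f q
    using T_approx_weylD[OF that(1)] T_approx_iff[OF that(2) \<alpha>] by auto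
  \<comment> \<open>Stated for a general exponent: the norm uses it with p, the pairing with the
    conjugate p'.\<close>
  have dual: "\<exists>H. T_approx \<alpha> q (cesaro_dual \<beta> f) H \<and> (\<forall>t>0. weight \<alpha> H t = cesaro_dual \<beta> (weight \<alpha> F) t)"
    if f: "T_approx \<alpha> q f F" and q: "1 < q" for f F q
  proof -
    have [measurable]: "f \<in> borel_measurable borel" "F \<in> borel_measurable borel"
      using f T_approx_iff[OF q \<alpha>] by auto
    obtain H where "T_approx \<alpha> q (cesaro_dual \<beta> f) H" "\<And>t. 0 < t \<Longrightarrow> weight \<alpha> H t = mult_conv ?d (weight \<alpha> F) t"
      by (rule T_approx_mult_conv[OF q \<alpha> Lp_kernel_cesaro_dual(1)[OF \<beta> q] f, of "cesaro_dual \<beta> f"])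
        (auto simp: cesaro_dual_eq_mult_conv)
    then show ?thesis by (auto simp: cesaro_dual_eq_mult_conv)
  qed
  have norm_dual: "T_norm \<alpha> p (cesaro_dual \<beta> f) = Lp_norm p (mult_conv ?d (weight \<alpha> F)) / Gamma (\<alpha> + 1)"
    if f: "T_approx \<alpha> p f F" for f F
  proof -
    have [measurable]: "F \<in> borel_measurable borel"
      using f T_approx_iff[OF p \<alpha>] by auto
    obtain H where H: "T_approx \<alpha> p (cesaro_dual \<beta> f) H" "\<forall>t>0. weight \<alpha> H t = cesaro_dual \<beta> (weight \<alpha> F) t"
      using dual[OF f p] by blast
    have [measurable]: "H \<in> borel_measurable borel"
      using H T_approx_iff[OF p \<alpha>] by auto
    have "Lp_norm p (weight \<alpha> H) = Lp_norm p (mult_conv ?d (weight \<alpha> F))"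
      using H(2) by (intro Lp_norm_cong) (auto simp: cesaro_dual_eq_mult_conv)
    then show ?thesis using T_norm_eq[OF p \<alpha> H(1)] by simp
  qed
  have bound: "T_norm \<alpha> p (cesaro_dual \<beta> f) \<le> ?K * T_norm \<alpha> p f" if "f \<in> T_space \<alpha> p" for f
  proof -
    note f = T_approx_weylD[OF that]
    have "Lp_norm p (mult_conv ?d (weight \<alpha> (weylD \<alpha> p f))) \<le> ?K * Lp_norm p (weight \<alpha> (weylD \<alpha> p f))"
      using Lp_norm_mult_conv_le[OF p meas(3)[OF that p] Lp_kernel_cesaro_dual(1)[OF \<beta> p]]
      by (simp only: Lp_kernel_cesaro_dual(2)[OF \<beta> p] K)
    then show ?thesis
      unfolding norm_dual[OF f] T_norm_eq[OF p \<alpha> f] times_divide_eq_right[of ?K]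
      using G by (intro divide_right_mono) auto
  qed
  have part1: "cesaro_dual \<beta> f \<in> T_space \<alpha> p" if "f \<in> T_space \<alpha> p" for f
    using dual[OF T_approx_weylD[OF that] p] by (auto simp: T_space_def)
  let ?S = "{T_norm \<alpha> p (cesaro_dual \<beta> f) / T_norm \<alpha> p f | f. f \<in> T_space \<alpha> p \<and> T_norm \<alpha> p f \<noteq> 0}"
  have ub: "x \<le> ?K" if x_in: "x \<in> ?S" for x
  proof -
    obtain f where f: "f \<in> T_space \<alpha> p" "T_norm \<alpha> p f \<noteq> 0" and x: "x = T_norm \<alpha> p (cesaro_dual \<beta> f) / T_norm \<alpha> p f"
      using x_in by blast
    have "0 \<le> T_norm \<alpha> p f" using G by (simp add: T_norm_def)
    then have "0 < T_norm \<alpha> p f" using f(2) by simp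
    then show ?thesis using bound[OF f(1)] unfolding x by (simp add: pos_divide_le_eq)
  qed
  have lb: "\<exists>x\<in>?S. y \<le> x" if y: "y < ?K" for y
  proof -
    \<comment> \<open>The test power needs a > 1 / p to lie in L^p, so the constant is approached by
      letting a decrease to 1 / p and using continuity of Beta.\<close>
    have "((\<lambda>a. \<beta> * Beta \<beta> a) \<longlongrightarrow> \<beta> * Beta \<beta> (1 / p)) (at_right (1 / p))"
      using \<beta> p by (intro tendsto_intros tendsto_Beta_right) auto
    then have "\<forall>\<^sub>F a in at_right (1 / p). y < \<beta> * Beta \<beta> a"
      using y unfolding K by (rule order_tendstoD)
    then have "\<forall>\<^sub>F a in at_right (1 / p). y < \<beta> * Beta \<beta> a \<and> 1 / p < a"
      using eventually_at_right_less[of "1 / p"] by eventually_elim simp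
    then obtain a where a: "y < \<beta> * Beta \<beta> a" "1 / p < a"
      using eventually_happens'[OF trivial_limit_at_right_real] by blast
    define h where "h = (\<lambda>t. if 1 < t then complex_of_real (t powr (- a)) else 0)"
    have h: "in_Lp p h" "0 < Lp_norm p h"
      unfolding h_def using in_Lp_power_tail[OF p a(2)] Lp_norm_power_tail[OF p a(2)] by auto
    have hC: "\<beta> * Beta \<beta> a * Lp_norm p h \<le> Lp_norm p (mult_conv ?d h)"
      unfolding h_def by (rule Lp_norm_cesaro_dual_power_tail[OF p a(2) \<beta>])
    \<comment> \<open>The test function is the potential of h. Its quotient of norms equals the L^p
      quotient for h, as the factors Gamma(\<alpha> + 1) cancel.\<close>
    obtain F where F: "T_approx \<alpha> p (weyl_pot \<alpha> h) F" "\<And>t. 0 < t \<Longrightarrow> weight \<alpha> F t = h t"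
      using T_approx_weyl_pot[OF p \<alpha> h(1)] by blast
    have [measurable]: "F \<in> borel_measurable borel" "h \<in> borel_measurable borel"
      using F(1) T_approx_iff[OF p \<alpha>] h by (auto simp: in_Lp_def)
    have n1: "T_norm \<alpha> p (weyl_pot \<alpha> h) = Lp_norm p h / Gamma (\<alpha> + 1)"
      unfolding T_norm_eq[OF p \<alpha> F(1)] using F(2) by (subst Lp_norm_cong[of _ h]) auto
    have "mult_conv ?d (weight \<alpha> F) t = mult_conv ?d h t" if "0 < t" for t
      using F(2) that by (intro mult_conv_cong_AE AE_half_lineI) auto
    then have n2: "T_norm \<alpha> p (cesaro_dual \<beta> (weyl_pot \<alpha> h)) = Lp_norm p (mult_conv ?d h) / Gamma (\<alpha> + 1)"
      unfolding norm_dual[OF F(1)] by (subst Lp_norm_cong[of _ "mult_conv ?d h"]) auto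
    have "y \<le> \<beta> * Beta \<beta> a" using a by simp
    also have "\<dots> \<le> Lp_norm p (mult_conv ?d h) / Lp_norm p h"
      using hC h(2) by (simp add: pos_le_divide_eq)
    also have "\<dots> = T_norm \<alpha> p (cesaro_dual \<beta> (weyl_pot \<alpha> h)) / T_norm \<alpha> p (weyl_pot \<alpha> h)"
      unfolding n1 n2 using G by simp
    finally have "y \<le> T_norm \<alpha> p (cesaro_dual \<beta> (weyl_pot \<alpha> h)) / T_norm \<alpha> p (weyl_pot \<alpha> h)" .
    moreover have "weyl_pot \<alpha> h \<in> T_space \<alpha> p" using F(1) by (auto simp: T_space_def)
    moreover have "T_norm \<alpha> p (weyl_pot \<alpha> h) \<noteq> 0" unfolding n1 using h(2) G by simp
    ultimately show ?thesis by blast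
  qed
  have part2: "Sup ?S = ?K"
  proof (rule antisym)
    \<comment> \<open>The supremum is over a conditionally complete order, so nonemptiness must be
      shown; any y below the constant provides an element.\<close>
    obtain x0 where "x0 \<in> ?S" using lb[of "?K - 1"] by auto
    then show "Sup ?S \<le> ?K" using ub by (intro cSup_least) auto
    have bdd: "bdd_above ?S" using ub by (rule bdd_aboveI)
    show "?K \<le> Sup ?S"
    proof (rule dense_le)
      fix y assume "y < ?K"
      then obtain x where "x \<in> ?S" "y \<le> x" using lb by blast
      then show "y \<le> Sup ?S" using bdd by (rule cSup_upper2)
    qed
  qed
  have part3: "cesaro \<beta> f \<in> T_space \<alpha> p \<and> T_pair \<alpha> p p' (cesaro \<beta> f) g = T_pair \<alpha> p p' f (cesaro_dual \<beta> g)"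
    if f: "f \<in> T_space \<alpha> p" and g: "g \<in> T_space \<alpha> p'" for f g
  proof -
    define F G where "F = weylD \<alpha> p f" and "G = weylD \<alpha> p' g"
    have [measurable]: "f \<in> borel_measurable borel" "g \<in> borel_measurable borel" "F \<in> borel_measurable borel" "G \<in> borel_measurable borel"
      and h: "in_Lp p (weight \<alpha> F)" "in_Lp p' (weight \<alpha> G)"
      using meas[OF f p] meas[OF g p'] by (auto simp: F_def G_def)
    have FG: "T_approx \<alpha> p f F" "T_approx \<alpha> p' g G"
      using T_approx_weylD f g by (auto simp: F_def G_def)
    obtain H where H: "T_approx \<alpha> p (cesaro \<beta> f) H" "\<And>t. 0 < t \<Longrightarrow> weight \<alpha> H t = mult_conv (\<lambda>u. cesaro_kernel \<beta> 1 u) (weight \<alpha> F) t"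
      by (rule T_approx_mult_conv[OF p \<alpha> Lp_kernel_cesaro[OF \<beta> p] FG(1), of "cesaro \<beta> f"])
        (auto simp: cesaro_eq_mult_conv)
    obtain J where J: "T_approx \<alpha> p' (cesaro_dual \<beta> g) J" "\<forall>t>0. weight \<alpha> J t = cesaro_dual \<beta> (weight \<alpha> G) t"
      using dual[OF FG(2) p'] by blast
    have [measurable]: "H \<in> borel_measurable borel" "J \<in> borel_measurable borel"
      using H J T_approx_iff[OF p \<alpha>] T_approx_iff[OF p' \<alpha>] by auto
    have "(LINT t|half_line. weight \<alpha> H t * weight \<alpha> G t) = (LINT t|half_line. cesaro \<beta> (weight \<alpha> F) t * weight \<alpha> G t)"
      using H(2) by (intro integral_half_line_cong) (auto simp: cesaro_eq_mult_conv)
    also have "\<dots> = (LINT t|half_line. weight \<alpha> F t * cesaro_dual \<beta> (weight \<alpha> G) t)"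
      by (rule cesaro_duality[OF p p' assms(4) h \<beta>])
    also have "\<dots> = (LINT t|half_line. weight \<alpha> F t * weight \<alpha> J t)"
      using J(2) by (intro integral_half_line_cong) auto
    finally have "T_pair \<alpha> p p' (cesaro \<beta> f) g = T_pair \<alpha> p p' f (cesaro_dual \<beta> g)"
      using T_pair_eq[OF p p' \<alpha> H(1) FG(2)] T_pair_eq[OF p p' \<alpha> FG(1) J(1)] by simp
    then show ?thesis using H(1) by (auto simp: T_space_def)
  qed
  have part4: "cesaro_dual \<beta> f t = complex_of_real \<beta> *
      (LINT r:{..<0}|lborel.
         complex_of_real ((exp (- r) - 1) powr (\<beta> - 1) * exp (- r * (1 - 1 / p - \<beta>))) * T_dil r p f t)"
    if "f \<in> T_space \<alpha> p" "0 < t" for f t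
    using meas(1)[OF that(1) p] that(2) by (rule cesaro_dual_eq_dilation_integral)
  show ?thesis
    using part1 bound part3 part4 by (intro conjI ballI allI impI part2) simp_all
qed

end
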